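(* There exist absolute constants $C,C'>0$ such that the following holds. Let $p=p_n$ be positive integers and $\sigma=\sigma_n$, $\Delta=\Delta_n$ be positive reals (possibly depending on $n$) such that $$\mathbf r_n:=\frac{\Delta^2/\sigma^2}{\sqrt{\Delta^2/\sigma^2+p/n}}>C .$$ Let $\eta^0$ be the spectral estimator and $(\eta^k)_{k\ge0}$ the iterative sequence started at $\eta^0$, as defined in the context. Then there is a sequence $\epsilon_n=o(1)$ such that, for $k=\lfloor 3\log n\rfloor$, $$\sup_{(\boldsymbol\theta,\eta)\in\Omega_\Delta}\frac1n\mathbf E_{(\boldsymbol\theta,\eta)}r(\eta^k,\eta)\le C'\,\Phi^{\mathsf c}\left(\mathbf r_n\left(1-\epsilon_n-\frac{C'\log\mathbf r_n}{\mathbf r_n}\right)\right).$$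
   Context: Model: for $n\ge 2$, $p\ge1$, $\sigma>0$, one observes $Y_i=\boldsymbol\theta\eta_i+\sigma\xi_i\in\mathbf R^p$, $i=1,\dots,n$, where $\boldsymbol\theta\in\mathbf R^p$ and $\eta\in\{-1,1\}^n$ are unknown and $\xi_1,\dots,\xi_n$ are i.i.d. standard Gaussian vectors in $\mathbf R^p$. $Y$ is the $p\times n$ matrix with columns $Y_1,\dots,Y_n$; $\mathbf E_{(\boldsymbol\theta,\eta)}$ is expectation under the law of $Y$. $\|\cdot\|$ is the Euclidean norm. $\Phi^{\mathsf c}(t)=\mathbf P(z>t)$ for $z$ standard Gaussian. $\Omega_\Delta=\{\boldsymbol\theta\in\mathbf R^p:\|\boldsymbol\theta\|\ge\Delta\}\times\{-1,1\}^n$. Loss: $r(\hat\eta,\eta)=\min_{\nu\in\{-1,1\}}\sum_{j=1}^n|\hat\eta_j-\nu\eta_j|$. The parameters $p,\sigma,\Delta$ may depend on $n$, and asymptotics are as $n\to\infty$. For a square matrix $M$, $\mathbf H(M)=M-\mathrm{diag}(M)$, where $\mathrm{diag}(M)$ is the diagonal matrix with the same diagonal as $M$. Let $\hat v$ be an eigenvector of $\mathbf H(Y^\top Y)$ for its top (largest) eigenvalue, $\eta^0=\mathrm{sign}(\hat v)$, and $\eta^{j+1}=\mathrm{sign}(\mathbf H(Y^\top Y)\eta^j)$ for $j\ge0$; $\mathrm{sign}$ is applied entrywise, with any fixed convention $\mathrm{sign}(0)\in\{-1,1\}$. *)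

theory Defs
  imports "HOL-Probability.Probability" "Jordan_Normal_Form.Char_Poly"
begin

no_notation Finite_Cartesian_Product.vec_nth (infixl \<open>$\<close> 90)
no_notation inner (infix \<open>\<bullet>\<close> 70)

definition std_normal_tail :: "real \<Rightarrow> real" where
  "std_normal_tail t = measure std_normal_distribution {t<..}"

definition eucl_norm :: "real Matrix.vec \<Rightarrow> real" where
  "eucl_norm v = sqrt (v \<bullet> v)"

definition label_vecs :: "nat \<Rightarrow> real Matrix.vec set" where
  "label_vecs n = {\<eta> \<in> carrier_vec n. \<forall>i<n. \<eta> $ i \<in> {-1, 1}}"

definition param_space :: "nat \<Rightarrow> nat \<Rightarrow> real \<Rightarrow> (real Matrix.vec \<times> real Matrix.vec) set" where
  "param_space p n \<Delta> = {\<theta> \<in> carrier_vec p. eucl_norm \<theta> \<ge> \<Delta>} \<times> label_vecs n"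

(* The p * n independent standard normal coordinates of xi_1, ..., xi_n;
   the pair (i, j) indexes the i-th coordinate of xi_j. *)
definition noise :: "nat \<Rightarrow> nat \<Rightarrow> (nat \<times> nat \<Rightarrow> real) measure" where
  "noise p n = Pi\<^sub>M ({..<p} \<times> {..<n}) (\<lambda>_. std_normal_distribution)"

definition observation ::
    "nat \<Rightarrow> nat \<Rightarrow> real \<Rightarrow> real Matrix.vec \<Rightarrow> real Matrix.vec \<Rightarrow> (nat \<times> nat \<Rightarrow> real) \<Rightarrow> real Matrix.mat" where
  "observation p n \<sigma> \<theta> \<eta> \<xi> = Matrix.mat p n (\<lambda>(i, j). \<theta> $ i * \<eta> $ j + \<sigma> * \<xi> (i, j))"

definition expect ::
    "nat \<Rightarrow> nat \<Rightarrow> real \<Rightarrow> real Matrix.vec \<Rightarrow> real Matrix.vec \<Rightarrow> (real Matrix.mat \<Rightarrow> real) \<Rightarrow> real" where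
  "expect p n \<sigma> \<theta> \<eta> f = (LINT \<xi>|noise p n. f (observation p n \<sigma> \<theta> \<eta> \<xi>))"

definition loss :: "nat \<Rightarrow> real Matrix.vec \<Rightarrow> real Matrix.vec \<Rightarrow> real" where
  "loss n \<eta>' \<eta> = (MIN \<nu>\<in>{-1, 1}. \<Sum>j<n. \<bar>\<eta>' $ j - \<nu> * \<eta> $ j\<bar>)"

definition off_diag :: "real Matrix.mat \<Rightarrow> real Matrix.mat" where
  "off_diag M = M - mat_diag (dim_row M) (\<lambda>i. M $$ (i, i))"

definition hollow_gram :: "real Matrix.mat \<Rightarrow> real Matrix.mat" where
  "hollow_gram Y = off_diag (transpose_mat Y * Y)"

(* Only used for symmetric M, all of whose eigenvalues are real. *)
definition top_eigenvector :: "real Matrix.mat \<Rightarrow> real Matrix.vec \<Rightarrow> bool" where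
  "top_eigenvector M v \<longleftrightarrow> (\<exists>l. eigenvector M v l \<and> (\<forall>l'. eigenvalue M l' \<longrightarrow> l' \<le> l))"

(* The top eigenvector is determined only up to scaling (or less, if the top eigenvalue is
   multiple), so the choice of the eigenvector is a parameter.  It has to be measurable in Y for
   the risk to be defined. *)
definition spectral_selector :: "nat \<Rightarrow> nat \<Rightarrow> (real Matrix.mat \<Rightarrow> real Matrix.vec) \<Rightarrow> bool" where
  "spectral_selector p n vhat \<longleftrightarrow>
     (\<forall>Y \<in> carrier_mat p n. top_eigenvector (hollow_gram Y) (vhat Y)) \<and>
     (\<forall>j<n. (\<lambda>y. vhat (Matrix.mat p n y) $ j)
        \<in> borel_measurable (Pi\<^sub>M ({..<p} \<times> {..<n}) (\<lambda>_. borel)))"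

(* s0 is the value assigned to sign(0). *)
definition sign_vec :: "real \<Rightarrow> real Matrix.vec \<Rightarrow> real Matrix.vec" where
  "sign_vec s0 v = map_vec (\<lambda>x. if x = 0 then s0 else sgn x) v"

fun iter_est :: "real \<Rightarrow> (real Matrix.mat \<Rightarrow> real Matrix.vec) \<Rightarrow> nat \<Rightarrow> real Matrix.mat \<Rightarrow> real Matrix.vec" where
  "iter_est s0 vhat 0 Y = sign_vec s0 (vhat Y)"
| "iter_est s0 vhat (Suc k) Y = sign_vec s0 (hollow_gram Y *\<^sub>v iter_est s0 vhat k Y)"

definition snr :: "nat \<Rightarrow> nat \<Rightarrow> real \<Rightarrow> real \<Rightarrow> real" where
  "snr p n \<sigma> \<Delta> = (\<Delta>\<^sup>2 / \<sigma>\<^sup>2) / sqrt (\<Delta>\<^sup>2 / \<sigma>\<^sup>2 + real p / real n)"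

end

theory Submission
  imports Defs "HOL-Real_Asymp.Real_Asymp"
begin

text \<open>
Write \<open>T = |\<theta>|\<^sup>2\<close>, \<open>B = T / \<sigma>\<^sup>2\<close>, let \<open>M\<close> be the hollow Gram matrix of the data and \<open>r\<close> the signal-to-noise ratio
at \<open>\<theta>\<close>, so that \<open>r\<^sup>2 = B\<^sup>2 / (B + p / n)\<close>. Then \<open>M = T \<eta> \<eta>\<^sup>T + N\<close>, and the argument compares the
remainder \<open>N\<close> with the signal \<open>T n\<close> through a single small number \<open>\<gamma>\<close>. Two facts are needed.

On the event that \<open>|x\<cdot>N x| \<le> (\<gamma> n T / 32) |x|\<^sup>2\<close> for all \<open>x\<close>, everything is deterministic. The top
eigenvector nearly maximizes \<open>(\<eta>\<cdot>v)\<^sup>2\<close>, so its signs err in at most \<open>\<gamma> n / 8\<close> places (\<open>spectral_start\<close>, up to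
a global sign). From a start with so few errors, an update can only err at the coordinates
that are thin, that is, whose margin \<open>\<eta> i (M \<eta>) i\<close> at the truth is at most \<open>\<gamma> n T / 2\<close>, and at no more than
a quarter as many others as there were errors before (\<open>iteration_contracts\<close>). After \<open>3 ln n\<close> steps the second
kind has disappeared and the loss is at most a multiple of \<open>1 / \<gamma>\<close> times the number of thin
coordinates (\<open>loss_iter_est_le\<close>).

It remains to estimate two probabilities. A coordinate is thin with probability at most about
\<open>exp (- r\<^sup>2 / 2 + \<gamma> r\<^sup>2)\<close>, by a Chernoff bound that factors over the rows of the noise (\<open>thin_prob\<close>). The
form of \<open>N\<close> is too large with probability at most \<open>exp (O(n) - c \<gamma>\<^sup>2 n r\<^sup>2)\<close>, by chi-square tails and a
union bound over an integer grid that is a net of the sphere (\<open>good_noise_prob\<close> and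
\<open>good_noise_bounds_form\<close>). With \<open>\<gamma> = a / r + a / sqrt n\<close> for a large constant \<open>a\<close> the second probability is
below \<open>exp (- r\<^sup>2)\<close>, uniformly in \<open>r\<close>, while the first is
\<open>exp (- (r\<^sup>2 / 2) (1 - O(1 / sqrt n)) + O(r))\<close> (\<open>risk_exponential_bound\<close>). The relative error
\<open>O(1 / sqrt n)\<close> becomes \<open>\<epsilon>\<close>, and the factor \<open>exp (O(r))\<close> is dominated by the gain \<open>exp (C' r ln r)\<close> from
the logarithmic correction in the argument of the tail (\<open>exponential_le_tail\<close>).
\<close>

section \<open>Quadratic forms and the top eigenvector\<close>

text \<open>Vectors and matrices are functions of indices of which only those below \<open>n\<close> count. The dimension
  varies with the sample size, and integer grid points, labels, noise and data can then be added and
  multiplied without conversions.\<close>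

definition sqnorm :: "nat \<Rightarrow> (nat \<Rightarrow> real) \<Rightarrow> real" where
  "sqnorm n x = (\<Sum>i<n. (x i)\<^sup>2)"

definition matvec :: "nat \<Rightarrow> (nat \<Rightarrow> nat \<Rightarrow> real) \<Rightarrow> (nat \<Rightarrow> real) \<Rightarrow> nat \<Rightarrow> real" where
  "matvec n N x i = (\<Sum>j<n. N i j * x j)"

definition bilin :: "nat \<Rightarrow> (nat \<Rightarrow> nat \<Rightarrow> real) \<Rightarrow> (nat \<Rightarrow> real) \<Rightarrow> (nat \<Rightarrow> real) \<Rightarrow> real" where
  "bilin n N x y = (\<Sum>i<n. \<Sum>j<n. x i * N i j * y j)"

definition symmetric_on :: "nat \<Rightarrow> (nat \<Rightarrow> nat \<Rightarrow> real) \<Rightarrow> bool" where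
  "symmetric_on n N \<longleftrightarrow> (\<forall>i<n. \<forall>j<n. N i j = N j i)"

lemma sqnorm_nonneg [simp]: "0 \<le> sqnorm n x"
  by (simp add: sqnorm_def sum_nonneg)

lemma sqnorm_scale: "sqnorm n (\<lambda>i. c * x i) = c\<^sup>2 * sqnorm n x"
  by (simp add: sqnorm_def power_mult_distrib sum_distrib_left)

lemma sqnorm_pos: "sqnorm n x \<noteq> 0 \<Longrightarrow> 0 < sqnorm n x"
  using sqnorm_nonneg[of n x] by linarith

lemma sqnorm_eq_0D: "sqnorm n x = 0 \<Longrightarrow> i < n \<Longrightarrow> x i = 0"
  by (simp add: sqnorm_def sum_nonneg_eq_0_iff)

lemma sqnorm_le_sum: "sqnorm n (\<lambda>i. x i + y i) \<le> 2 * sqnorm n x + 2 * sqnorm n y"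
proof -
  have "(a + b)\<^sup>2 \<le> 2 * a\<^sup>2 + 2 * b\<^sup>2" for a b :: real
    using zero_le_power2[of "a - b"] by (simp add: power2_eq_square algebra_simps)
  then show ?thesis
    unfolding sqnorm_def by (simp add: sum_distrib_left sum.distrib[symmetric] sum_mono)
qed

lemma sqnorm_parallelogram:
  "sqnorm n (\<lambda>i. x i + y i) + sqnorm n (\<lambda>i. x i - y i) = 2 * (sqnorm n x + sqnorm n y)"
  unfolding sqnorm_def sum.distrib[symmetric] sum_distrib_left
  by (intro sum.cong refl) (simp add: power2_eq_square algebra_simps)

lemma bilin_matvec: "bilin n N x y = (\<Sum>i<n. x i * matvec n N y i)"
  by (simp add: bilin_def matvec_def sum_distrib_left mult.assoc)

lemma bilin_commute: "symmetric_on n N \<Longrightarrow> bilin n N x y = bilin n N y x"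
  unfolding bilin_def symmetric_on_def
  by (subst sum.swap) (auto intro!: sum.cong)

lemma bilin_left_add: "bilin n N (\<lambda>i. x i + y i) z = bilin n N x z + bilin n N y z"
  by (simp add: bilin_def algebra_simps sum.distrib)
lemma bilin_right_add: "bilin n N z (\<lambda>i. x i + y i) = bilin n N z x + bilin n N z y"
  by (simp add: bilin_def algebra_simps sum.distrib)
lemma bilin_left_scale: "bilin n N (\<lambda>i. c * x i) z = c * bilin n N x z"
  by (simp add: bilin_def sum_distrib_left mult.assoc)
lemma bilin_right_scale: "bilin n N z (\<lambda>i. c * x i) = c * bilin n N z x"
  by (simp add: bilin_def sum_distrib_left algebra_simps)

lemma bilin_expand:
  assumes "symmetric_on n N"
  shows "bilin n N (\<lambda>i. x i + c * y i) (\<lambda>i. x i + c * y i) =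
    bilin n N x x + 2 * c * bilin n N x y + c\<^sup>2 * bilin n N y y"
  using bilin_commute[OF assms, of y x]
  by (simp add: bilin_left_add bilin_right_add bilin_left_scale bilin_right_scale power2_eq_square algebra_simps)

lemma bilin_diff_sum:
  assumes "symmetric_on n N"
  shows "bilin n N (\<lambda>i. x i - z i) (\<lambda>i. x i + z i) = bilin n N x x - bilin n N z z"
  using bilin_left_add[of n N x "\<lambda>i. (-1) * z i" "\<lambda>i. x i + z i"] bilin_commute[OF assms, of x z]
  unfolding bilin_left_scale bilin_right_add by simp

lemma bilin_polarization:
  assumes s: "symmetric_on n N" and q: "\<And>x. \<bar>bilin n N x x\<bar> \<le> K * sqnorm n x"
  shows "\<bar>bilin n N x y\<bar> \<le> K / 2 * (sqnorm n x + sqnorm n y)"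
proof -
  have "bilin n N (\<lambda>i. x i + 1 * y i) (\<lambda>i. x i + 1 * y i)
      - bilin n N (\<lambda>i. x i + (-1) * y i) (\<lambda>i. x i + (-1) * y i) = 4 * bilin n N x y"
    by (simp only: bilin_expand[OF s]) simp
  then have "\<bar>4 * bilin n N x y\<bar> \<le> K * sqnorm n (\<lambda>i. x i + 1 * y i) + K * sqnorm n (\<lambda>i. x i + (-1) * y i)"
    using q[of "\<lambda>i. x i + 1 * y i"] q[of "\<lambda>i. x i + (-1) * y i"] by linarith
  also have "\<dots> = K * (sqnorm n (\<lambda>i. x i + y i) + sqnorm n (\<lambda>i. x i - y i))"
    by (simp add: distrib_left)
  also have "\<dots> = 2 * K * (sqnorm n x + sqnorm n y)"
    unfolding sqnorm_parallelogram by simp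
  finally show ?thesis by simp
qed

text \<open>The bilinear form is tested against the image of \<open>d\<close>, divided by \<open>K\<close> so that both arguments of the
  polarized bound have comparable length.\<close>

lemma matvec_sqnorm_le:
  assumes s: "symmetric_on n N" and q: "\<And>x. \<bar>bilin n N x x\<bar> \<le> K * sqnorm n x" and K: "K > 0"
  shows "sqnorm n (matvec n N d) \<le> K\<^sup>2 * sqnorm n d"
proof -
  let ?y = "matvec n N d"
  have "bilin n N (\<lambda>i. (1/K) * ?y i) d = (1/K) * sqnorm n ?y"
    unfolding bilin_left_scale by (simp add: bilin_matvec sqnorm_def power2_eq_square)
  moreover have "\<bar>bilin n N (\<lambda>i. (1/K) * ?y i) d\<bar> \<le> K/2 * (sqnorm n (\<lambda>i. (1/K) * ?y i) + sqnorm n d)"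
    by (rule bilin_polarization[OF s q])
  ultimately have "(1/K) * sqnorm n ?y \<le> K/2 * ((1/K)\<^sup>2 * sqnorm n ?y + sqnorm n d)"
    unfolding sqnorm_scale by linarith
  then show ?thesis using K by (simp add: field_simps power2_eq_square)
qed

lemma matvec_frobenius: "sqnorm n (matvec n B x) \<le> (\<Sum>i<n. \<Sum>j<n. (B i j)\<^sup>2) * sqnorm n x"
  unfolding sqnorm_def matvec_def sum_distrib_right
  by (rule sum_mono) (use Cauchy_Schwarz_ineq_sum in \<open>simp add: sum_distrib_right[symmetric]\<close>)

lemma bilin_crude: "\<exists>C>0. \<forall>x. \<bar>bilin n N x x\<bar> \<le> C * sqnorm n x"
proof (intro exI conjI allI)
  let ?F = "\<Sum>i<n. \<Sum>j<n. (N i j)\<^sup>2"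
  show "0 < 1 + ?F" by (simp add: sum_nonneg add_pos_nonneg)
  fix x
  have *: "\<bar>a * b\<bar> \<le> a\<^sup>2 + b\<^sup>2" for a b :: real
    using zero_le_power2[of "a - b"] zero_le_power2[of "a + b"] zero_le_power2[of a] zero_le_power2[of b]
    by (simp add: power2_eq_square algebra_simps abs_if)
  have "\<bar>bilin n N x x\<bar> \<le> (\<Sum>i<n. \<bar>x i * matvec n N x i\<bar>)"
    unfolding bilin_matvec by (rule sum_abs)
  also have "\<dots> \<le> sqnorm n x + sqnorm n (matvec n N x)"
    unfolding sqnorm_def sum.distrib[symmetric] by (intro sum_mono *)
  also have "\<dots> \<le> (1 + ?F) * sqnorm n x"
    using matvec_frobenius[of n N x] by (simp add: algebra_simps)
  finally show "\<bar>bilin n N x x\<bar> \<le> (1 + ?F) * sqnorm n x" .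
qed

text \<open>Put \<open>y = N x\<close>. Nonnegativity of the form at \<open>x - y / C\<close>, for a constant \<open>C\<close> bounding the form, gives
  \<open>|y|\<^sup>2 \<le> C x\<cdot>N x\<close>, and \<open>|x|\<close> is at most a constant times \<open>|y|\<close> because \<open>B\<close> is bounded.\<close>

lemma invertible_psd_is_definite:
  assumes s: "symmetric_on n N" and psd: "\<And>x. 0 \<le> bilin n N x x"
    and inv: "\<And>x i. i < n \<Longrightarrow> matvec n B (matvec n N x) i = x i"
  shows "\<exists>c>0. \<forall>x. c * sqnorm n x \<le> bilin n N x x"
proof -
  obtain C where C: "C > 0" "\<And>x. \<bar>bilin n N x x\<bar> \<le> C * sqnorm n x" using bilin_crude by blast
  define D where "D = 1 + (\<Sum>i<n. \<Sum>j<n. (B i j)\<^sup>2)"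
  have D: "D > 0" unfolding D_def by (simp add: sum_nonneg add_pos_nonneg)
  have "sqnorm n x / (C * D) \<le> bilin n N x x" for x
  proof -
    let ?y = "matvec n N x"
    have "sqnorm n x = sqnorm n (matvec n B ?y)" unfolding sqnorm_def using inv by (intro sum.cong) auto
    also have "\<dots> \<le> D * sqnorm n ?y" using matvec_frobenius[of n B ?y] unfolding D_def
      by (simp add: algebra_simps add_increasing)
    finally have 1: "sqnorm n x \<le> D * sqnorm n ?y" .
    have "bilin n N ?y x = sqnorm n ?y" by (simp add: bilin_matvec sqnorm_def power2_eq_square)
    then have "bilin n N x ?y = sqnorm n ?y" using bilin_commute[OF s] by simp
    then have "0 \<le> bilin n N x x + 2 * (-(1/C)) * sqnorm n ?y + (-(1/C))\<^sup>2 * bilin n N ?y ?y"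
      using psd[of "\<lambda>i. x i + (-(1/C)) * ?y i"] unfolding bilin_expand[OF s] by simp
    also have "\<dots> \<le> bilin n N x x + 2 * (-(1/C)) * sqnorm n ?y + (-(1/C))\<^sup>2 * (C * sqnorm n ?y)"
      using C(2)[of ?y] by (intro add_left_mono mult_left_mono) auto
    also have "\<dots> = bilin n N x x - sqnorm n ?y / C" using C(1) by (simp add: power2_eq_square field_simps)
    finally have "sqnorm n ?y / C \<le> bilin n N x x" by simp
    moreover have "sqnorm n x / (C * D) \<le> sqnorm n ?y / C" using 1 C(1) D by (simp add: field_simps)
    ultimately show ?thesis by linarith
  qed
  then show ?thesis using C(1) D by (intro exI[of _ "1 / (C * D)"]) auto
qed

text \<open>Let \<open>a\<close> be the least number with \<open>x\<cdot>M x \<le> a |x|\<^sup>2\<close> for all \<open>x\<close>. The form of \<open>a I - M\<close> is nonnegative but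
  not definite, since otherwise \<open>a\<close> could be lowered; by the preceding lemma \<open>a I - M\<close> is therefore
  singular, so \<open>a\<close> is an eigenvalue. Hence the top eigenvalue maximizes the Rayleigh quotient. This is
  an algebraic substitute for maximizing over the compact unit sphere.\<close>

lemma top_eigenvector_rayleigh:
  assumes M: "M \<in> carrier_mat n n" and s: "symmetric_on n (\<lambda>i j. M $$ (i,j))"
    and top: "top_eigenvector M v"
  shows "v \<in> carrier_vec n" "sqnorm n (\<lambda>i. v $ i) > 0"
    "bilin n (\<lambda>i j. M $$ (i,j)) x x * sqnorm n (\<lambda>i. v $ i)
      \<le> bilin n (\<lambda>i j. M $$ (i,j)) (\<lambda>i. v $ i) (\<lambda>i. v $ i) * sqnorm n x"
proof -
  let ?N = "\<lambda>i j. M $$ (i,j)" and ?v = "\<lambda>i. v $ i"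
  obtain l where l: "eigenvector M v l" and lmax: "\<And>l'. eigenvalue M l' \<Longrightarrow> l' \<le> l"
    using top unfolding top_eigenvector_def by blast
  have v: "v \<in> carrier_vec n" "v \<noteq> 0\<^sub>v n" "M *\<^sub>v v = l \<cdot>\<^sub>v v"
    using l M unfolding eigenvector_def by auto
  show "v \<in> carrier_vec n" by fact
  have "sqnorm n ?v \<noteq> 0" using sqnorm_eq_0D[of n ?v] v(1,2) by (auto simp: vec_eq_iff)
  then show vpos: "sqnorm n ?v > 0" by (rule sqnorm_pos)
  have appv: "matvec n ?N ?v i = l * v $ i" if "i < n" for i
  proof -
    have "(M *\<^sub>v v) $ i = matvec n ?N ?v i"
      using that M v(1) by (auto simp: matvec_def scalar_prod_def atLeast0LessThan intro!: sum.cong)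
    then show ?thesis using v that by simp
  qed
  then have qv: "bilin n ?N ?v ?v = l * sqnorm n ?v"
    by (simp add: bilin_matvec sqnorm_def sum_distrib_left power2_eq_square algebra_simps)
  define S where "S = {a. \<forall>x. bilin n ?N x x \<le> a * sqnorm n x}"
  obtain C where C: "C > 0" "\<And>x. \<bar>bilin n ?N x x\<bar> \<le> C * sqnorm n x" using bilin_crude by blast
  have "C \<in> S" using C(2) unfolding S_def by (auto simp: abs_le_iff)
  have lb: "l \<le> a" if "a \<in> S" for a
    using that vpos qv unfolding S_def by (metis (mono_tags) mem_Collect_eq mult_right_le_imp_le)
  have bdd: "bdd_below S" by (rule bdd_belowI[of S l]) (rule lb)
  define a where "a = Inf S"
  have aS: "a \<in> S" unfolding S_def
  proof safe
    fix x show "bilin n ?N x x \<le> a * sqnorm n x"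
    proof (cases "sqnorm n x = 0")
      case True then show ?thesis using C(2)[of x] by simp
    next
      case False
      then have p: "sqnorm n x > 0" by (rule sqnorm_pos)
      have "bilin n ?N x x / sqnorm n x \<le> a" unfolding a_def
      proof (rule cInf_greatest)
        show "S \<noteq> {}" using \<open>C \<in> S\<close> by auto
        show "bilin n ?N x x / sqnorm n x \<le> y" if "y \<in> S" for y
          using that p unfolding S_def by (auto simp: field_simps)
      qed
      then show ?thesis using p by (simp add: field_simps)
    qed
  qed
  have "eigenvalue M a"
  proof (rule ccontr)
    assume ne: "\<not> eigenvalue M a"
    define A where "A = char_matrix M a"
    have A: "A \<in> carrier_mat n n" unfolding A_def using M by auto
    have detA: "Determinant.det A \<noteq> 0" using ne eigenvalue_det[OF M] unfolding A_def by auto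
    let ?D = "\<lambda>i j. - A $$ (i,j)"
    have Aij: "A $$ (i,j) = M $$ (i,j) - (if i = j then a else 0)" if "i < n" "j < n" for i j
      using that M unfolding A_def char_matrix_def by auto
    have bD: "bilin n ?D x y = a * (\<Sum>i<n. x i * y i) - bilin n ?N x y" for x y
    proof -
      have "bilin n ?D x y = (\<Sum>i<n. \<Sum>j<n. (if i = j then a * (x i * y j) else 0) - x i * M $$ (i,j) * y j)"
        unfolding bilin_def by (intro sum.cong refl) (auto simp: Aij algebra_simps)
      then show ?thesis by (simp add: bilin_def sum_subtractf sum_distrib_left sum.delta)
    qed
    have bDD: "bilin n ?D x x = a * sqnorm n x - bilin n ?N x x" for x
      unfolding bD sqnorm_def by (simp add: power2_eq_square)
    define B where "B = (\<lambda>i j. - (adj_mat A $$ (i,j)) / Determinant.det A)"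
    have adj: "adj_mat A \<in> carrier_mat n n" "adj_mat A * A = Determinant.det A \<cdot>\<^sub>m 1\<^sub>m n"
      using adj_mat[OF A] by auto
    have entry: "(\<Sum>j<n. adj_mat A $$ (i,j) * A $$ (j,k)) = (if i = k then Determinant.det A else 0)"
      if "i < n" "k < n" for i k
    proof -
      have "(adj_mat A * A) $$ (i,k) = (\<Sum>j<n. adj_mat A $$ (i,j) * A $$ (j,k))"
        using that adj(1) A by (auto simp: scalar_prod_def atLeast0LessThan intro!: sum.cong)
      then show ?thesis using adj(2) that by (cases "i = k") auto
    qed
    have inv: "matvec n B (matvec n ?D x) i = x i" if i: "i < n" for x i
    proof -
      have "matvec n B (matvec n ?D x) i = (\<Sum>j<n. \<Sum>k<n. (adj_mat A $$ (i,j) * A $$ (j,k)) * x k / Determinant.det A)"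
        unfolding matvec_def B_def by (simp add: sum_distrib_left algebra_simps)
      also have "\<dots> = (\<Sum>k<n. (\<Sum>j<n. adj_mat A $$ (i,j) * A $$ (j,k)) * x k / Determinant.det A)"
        by (subst sum.swap) (simp add: sum_distrib_right sum_divide_distrib)
      also have "\<dots> = (\<Sum>k<n. if i = k then x k else 0)"
        using detA i by (intro sum.cong refl) (auto simp: entry)
      also have "\<dots> = x i" using i by simp
      finally show ?thesis .
    qed
    have "symmetric_on n ?D" using s Aij unfolding symmetric_on_def by auto
    moreover have "0 \<le> bilin n ?D x x" for x using aS unfolding bDD S_def by auto
    ultimately obtain c where c: "c > 0" "\<And>x. c * sqnorm n x \<le> bilin n ?D x x"
      using invertible_psd_is_definite[of n ?D B] inv by blast
    then have "a - c \<in> S" unfolding S_def bDD by (auto simp: algebra_simps)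
    then show False using cInf_lower[OF _ bdd] c(1) unfolding a_def by fastforce
  qed
  then have "a = l" using lmax lb aS by force
  then have "bilin n ?N x x * sqnorm n ?v \<le> (l * sqnorm n x) * sqnorm n ?v"
    using aS vpos unfolding S_def by (intro mult_right_mono) auto
  then show "bilin n ?N x x * sqnorm n ?v \<le> bilin n ?N ?v ?v * sqnorm n x"
    unfolding qv by (simp add: algebra_simps)
qed

section \<open>An integer net of the sphere\<close>

text \<open>Rounding down the coordinates of a vector of squared norm \<open>100 n\<close> moves it by at most \<open>sqrt n\<close>, a tenth
  of its length. The grid thus acts as a net of the sphere, and it has only exponentially many
  points. The box makes its finiteness evident.\<close>

definition grid :: "nat \<Rightarrow> (nat \<Rightarrow> int) set" where
  "grid n = {z \<in> PiE {..<n} (\<lambda>_. {- int (202 * n)..int (202 * n)}). (\<Sum>i<n. (z i)\<^sup>2) \<le> int (202 * n)}"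

lemma finite_grid: "finite (grid n)"
  unfolding grid_def by (rule finite_subset[of _ "PiE {..<n} (\<lambda>_. {- int (202 * n)..int (202 * n)})"])
    (auto intro!: finite_PiE)

lemma abs_le_square_int: "\<bar>a\<bar> \<le> a\<^sup>2" for a :: int
proof (cases "a = 0")
  case False
  then have "\<bar>a\<bar> * 1 \<le> \<bar>a\<bar> * \<bar>a\<bar>" by (intro mult_left_mono) auto
  then show ?thesis by (simp add: power2_eq_square)
qed simp

lemma sum_half_powers: "(\<Sum>k\<in>{- int m..int m}. (1/2::real) ^ nat \<bar>k\<bar>) = 3 - 2 * (1/2) ^ m"
proof (induction m)
  case (Suc m)
  have "{- int (Suc m)..int (Suc m)} = insert (int (Suc m)) (insert (- int (Suc m)) {- int m..int m})"
    by auto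
  then show ?case using Suc by (simp add: nat_add_distrib)
qed simp

text \<open>Give \<open>z\<close> the weight \<open>(1/2) ^ (\<Sum>i. |z i|)\<close>. On the grid the weight is at least \<open>(1/2) ^ (202 n)\<close>, because
  \<open>|a| \<le> a\<^sup>2\<close> for integers, while the total weight of the box is a product of \<open>n\<close> geometric sums that
  are each below 3.\<close>

lemma card_grid: "real (card (grid n)) \<le> (3 * 2 ^ 202) ^ n"
proof -
  let ?m = "202 * n" and ?P = "PiE {..<n} (\<lambda>_. {- int (202 * n)..int (202 * n)})"
  have fin: "finite ?P" by (auto intro!: finite_PiE)
  have low: "(1/2::real) ^ ?m \<le> (\<Prod>i<n. (1/2) ^ nat \<bar>z i\<bar>)" if z: "z \<in> grid n" for z
  proof -
    have "(\<Sum>i<n. \<bar>z i\<bar>) \<le> (\<Sum>i<n. (z i)\<^sup>2)" by (intro sum_mono abs_le_square_int)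
    also have "\<dots> \<le> int ?m" using z unfolding grid_def by auto
    finally have "(\<Sum>i<n. nat \<bar>z i\<bar>) \<le> ?m"
      by (simp flip: of_nat_le_iff[where 'a = int])
    then have "(1/2::real) ^ ?m \<le> (1/2) ^ (\<Sum>i<n. nat \<bar>z i\<bar>)" by (intro power_decreasing) auto
    then show ?thesis by (simp add: power_sum)
  qed
  have "real (card (grid n)) * (1/2) ^ ?m = (\<Sum>z\<in>grid n. (1/2::real) ^ ?m)" by simp
  also have "\<dots> \<le> (\<Sum>z\<in>grid n. \<Prod>i<n. (1/2) ^ nat \<bar>z i\<bar>)" by (intro sum_mono low)
  also have "\<dots> \<le> (\<Sum>z\<in>?P. \<Prod>i<n. (1/2) ^ nat \<bar>z i\<bar>)"
  proof (rule sum_mono2[OF fin])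
    show "grid n \<subseteq> ?P" unfolding grid_def by blast
  qed (simp add: prod_nonneg)
  also have "\<dots> = (\<Prod>i<n. \<Sum>k\<in>{- int ?m..int ?m}. (1/2) ^ nat \<bar>k\<bar>)"
    by (rule prod_sum_PiE[symmetric]) auto
  also have "\<dots> = (3 - 2 * (1/2) ^ ?m) ^ n" by (simp only: sum_half_powers prod_constant card_lessThan)
  also have "\<dots> \<le> 3 ^ n"
  proof (intro power_mono)
    have "(1/2::real) ^ ?m \<le> 1" by (intro power_le_one) auto
    then show "0 \<le> 3 - 2 * (1/2::real) ^ ?m" by linarith
  qed simp
  finally have "real (card (grid n)) * (1/2) ^ ?m * 2 ^ ?m \<le> 3 ^ n * 2 ^ ?m" by (intro mult_right_mono) auto
  moreover have "(1/2::real) ^ ?m * 2 ^ ?m = 1" unfolding power_mult_distrib[symmetric] by simp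
  ultimately show ?thesis unfolding power_mult_distrib power_mult[symmetric] by (simp only: mult.assoc mult_1_right)
qed

lemma grid_approx:
  assumes x: "sqnorm n x = 100 * real n"
  obtains z where "z \<in> grid n" "sqnorm n (\<lambda>i. x i - of_int (z i)) \<le> real n"
    "sqnorm n (\<lambda>i. of_int (z i)) \<le> 202 * real n"
proof -
  define z where "z = (\<lambda>i\<in>{..<n}. \<lfloor>x i\<rfloor>)"
  have "(x i - of_int (z i))\<^sup>2 \<le> 1" if "i < n" for i
  proof -
    have "0 \<le> x i - of_int (z i)" "x i - of_int (z i) \<le> 1" using that unfolding z_def by auto linarith
    then show ?thesis by (simp add: power_le_one)
  qed
  then have 1: "sqnorm n (\<lambda>i. x i - of_int (z i)) \<le> real n"
    unfolding sqnorm_def using sum_bounded_above[of "{..<n}" "\<lambda>i. (x i - of_int (z i))\<^sup>2" 1] by simp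
  have "sqnorm n (\<lambda>i. x i + - (x i - of_int (z i))) \<le> 2 * sqnorm n x + 2 * sqnorm n (\<lambda>i. - (x i - of_int (z i)))"
    by (rule sqnorm_le_sum)
  also have "sqnorm n (\<lambda>i. - (x i - of_int (z i))) = sqnorm n (\<lambda>i. x i - of_int (z i))"
    unfolding sqnorm_def by (simp add: power2_commute)
  finally have 2: "sqnorm n (\<lambda>i. of_int (z i)) \<le> 202 * real n" using 1 x by simp
  then have "of_int (\<Sum>i<n. (z i)\<^sup>2) \<le> (of_int (int (202 * n)) :: real)" unfolding sqnorm_def by simp
  then have 3: "(\<Sum>i<n. (z i)\<^sup>2) \<le> int (202 * n)" by (simp only: of_int_le_iff)
  have "- int (202 * n) \<le> z i \<and> z i \<le> int (202 * n)" if "i < n" for i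
  proof -
    have "\<bar>z i\<bar> \<le> (z i)\<^sup>2" by (rule abs_le_square_int)
    also have "\<dots> \<le> (\<Sum>i<n. (z i)\<^sup>2)" using that by (intro member_le_sum) auto
    finally show ?thesis using 3 by linarith
  qed
  then have "z \<in> PiE {..<n} (\<lambda>_. {- int (202 * n)..int (202 * n)})"
    by (intro PiE_I) (auto simp: z_def)
  then have "z \<in> grid n" unfolding grid_def using 3 by simp
  then show ?thesis using that 1 2 by blast
qed

text \<open>If \<open>K\<close> bounds the form on all vectors then so does \<open>2.02 t + 0.285 K\<close>: a vector \<open>y\<close> of the right length
  has a grid point \<open>z\<close> nearby, and \<open>y\<cdot>N y - z\<cdot>N z = (y - z)\<cdot>N (y + z)\<close> is controlled by \<open>K\<close>. The best constant
  is a fixed point of this improvement up to inequality, hence at most \<open>3 t\<close>.\<close>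

lemma grid_bounds_quadratic_form:
  assumes s: "symmetric_on n N" and t: "t \<ge> 0"
    and g: "\<And>z. z \<in> grid n \<Longrightarrow> \<bar>bilin n N (\<lambda>i. of_int (z i)) (\<lambda>i. of_int (z i))\<bar> \<le> t * sqnorm n (\<lambda>i. of_int (z i))"
  shows "\<bar>bilin n N x x\<bar> \<le> 3 * t * sqnorm n x"
proof -
  define S where "S = {K. \<forall>x. \<bar>bilin n N x x\<bar> \<le> K * sqnorm n x}"
  have step: "202 / 100 * t + 57 / 200 * K \<in> S" if K: "K \<in> S" "K \<ge> 0" for K
    unfolding S_def
  proof safe
    fix x
    show "\<bar>bilin n N x x\<bar> \<le> (202 / 100 * t + 57 / 200 * K) * sqnorm n x"
    proof (cases "sqnorm n x = 0")
      case True
      then show ?thesis using K unfolding S_def by (auto dest: spec[of _ x])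
    next
      case False
      then have p: "sqnorm n x > 0" by (rule sqnorm_pos)
      then have n: "real n > 0" by (cases n) (auto simp: sqnorm_def)
      define c where "c = sqrt (100 * real n / sqnorm n x)"
      have c2: "c\<^sup>2 = 100 * real n / sqnorm n x" unfolding c_def using p n by simp
      let ?y = "\<lambda>i. c * x i"
      have ny: "sqnorm n ?y = 100 * real n" using p by (simp add: sqnorm_scale c2)
      obtain z where z: "z \<in> grid n" "sqnorm n (\<lambda>i. ?y i - of_int (z i)) \<le> real n"
        "sqnorm n (\<lambda>i. of_int (z i)) \<le> 202 * real n" using grid_approx[OF ny] by blast
      let ?z = "\<lambda>i. real_of_int (z i)"
      \<comment> \<open>The factors 5 and 1/5 balance the short difference against the long sum.\<close>
      let ?a = "\<lambda>i. 5 * (?y i - ?z i)" and ?b = "\<lambda>i. (1/5) * (?y i + ?z i)"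
      have ab: "bilin n N ?a ?b = bilin n N ?y ?y - bilin n N ?z ?z"
        by (subst bilin_left_scale, subst bilin_right_scale, subst bilin_diff_sum[OF s]) simp
      have na: "sqnorm n ?a \<le> 25 * real n" unfolding sqnorm_scale using z(2) by simp
      have "sqnorm n (\<lambda>i. ?y i + ?z i) \<le> 2 * (100 * real n) + 2 * (202 * real n)"
        using sqnorm_le_sum[of n ?y ?z] z(3) ny by linarith
      then have nb: "sqnorm n ?b \<le> 1/25 * (604 * real n)" unfolding sqnorm_scale by (simp add: power2_eq_square)
      have "\<bar>bilin n N ?a ?b\<bar> \<le> K / 2 * (sqnorm n ?a + sqnorm n ?b)"
        by (rule bilin_polarization[OF s]) (use K in \<open>auto simp: S_def\<close>)
      also have "\<dots> \<le> K / 2 * (57 * real n)"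
        using na nb K(2) n by (intro mult_left_mono) auto
      finally have 1: "\<bar>bilin n N ?y ?y - bilin n N ?z ?z\<bar> \<le> K / 2 * (57 * real n)" unfolding ab .
      have "\<bar>bilin n N ?z ?z\<bar> \<le> t * (202 * real n)"
        using g[OF z(1)] mult_left_mono[OF z(3) t] by linarith
      with 1 have "\<bar>bilin n N ?y ?y\<bar> \<le> K / 2 * (57 * real n) + t * (202 * real n)" by linarith
      moreover have "bilin n N ?y ?y = c\<^sup>2 * bilin n N x x"
        by (simp add: bilin_left_scale bilin_right_scale power2_eq_square)
      ultimately have "c\<^sup>2 * \<bar>bilin n N x x\<bar> \<le> K / 2 * (57 * real n) + t * (202 * real n)"
        by (simp add: abs_mult)
      then have "real n * (100 * \<bar>bilin n N x x\<bar>) \<le> real n * ((K / 2 * 57 + t * 202) * sqnorm n x)"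
        using p unfolding c2 by (simp add: field_simps)
      then have "100 * \<bar>bilin n N x x\<bar> \<le> (K / 2 * 57 + t * 202) * sqnorm n x"
        using n by (rule mult_left_le_imp_le)
      then show ?thesis by (simp add: field_simps)
    qed
  qed
  show ?thesis
  proof (cases "sqnorm n x = 0")
    case True
    moreover obtain C where "\<bar>bilin n N x x\<bar> \<le> C * sqnorm n x" using bilin_crude[of n N] by blast
    ultimately show ?thesis by simp
  next
    case False
    then have p: "sqnorm n x > 0" by (rule sqnorm_pos)
    have pos: "K \<ge> 0" if "K \<in> S" for K
    proof -
      have "0 \<le> K * sqnorm n x" using that unfolding S_def by (metis (mono_tags) abs_ge_zero mem_Collect_eq order_trans)
      then show ?thesis using p by (simp add: zero_le_mult_iff)
    qed
    obtain C where C: "C \<in> S" using bilin_crude[of n N] unfolding S_def by blast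
    have bdd: "bdd_below S" by (rule bdd_belowI[of S 0]) (rule pos)
    have "(Inf S - 202 / 100 * t) / (57 / 200) \<le> Inf S"
    proof (rule cInf_greatest)
      show "(Inf S - 202 / 100 * t) / (57 / 200) \<le> K" if "K \<in> S" for K
        using cInf_lower[OF step[OF that pos[OF that]] bdd] by simp
    qed (use C in auto)
    then have I: "Inf S \<le> 3 * t" using t by simp
    have "\<bar>bilin n N x x\<bar> / sqnorm n x \<le> Inf S"
      by (rule cInf_greatest) (use C p in \<open>auto simp: S_def field_simps\<close>)
    then have "\<bar>bilin n N x x\<bar> \<le> Inf S * sqnorm n x" using p by (simp only: pos_divide_le_eq)
    also have "\<dots> \<le> 3 * t * sqnorm n x" by (intro mult_right_mono I) simp
    finally show ?thesis .
  qed
qed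

text \<open>It suffices to round a multiple of \<open>a\<close> itself.\<close>

lemma grid_bounds_linear_form:
  assumes t: "t \<ge> 0" and n: "n > 0"
    and g: "\<And>z. z \<in> grid n \<Longrightarrow> (\<Sum>i<n. a i * of_int (z i)) \<le> t * sqrt (sqnorm n (\<lambda>i. of_int (z i)))"
  shows "sqrt (sqnorm n a) \<le> 2 * t"
proof (cases "sqnorm n a = 0")
  case False
  then have p: "sqnorm n a > 0" by (rule sqnorm_pos)
  define A where "A = sqrt (sqnorm n a)"
  have A: "A > 0" "sqnorm n a = A\<^sup>2" using p unfolding A_def by auto
  define R where "R = sqrt (real n)"
  have R: "R > 0" "real n = R\<^sup>2" using n unfolding R_def by auto
  let ?x = "\<lambda>i. (10 * R / A) * a i"
  have nx: "sqnorm n ?x = 100 * real n" unfolding sqnorm_scale A R using A(1) by (simp add: power2_eq_square)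
  obtain z where z: "z \<in> grid n" "sqnorm n (\<lambda>i. ?x i - of_int (z i)) \<le> real n"
    "sqnorm n (\<lambda>i. of_int (z i)) \<le> 202 * real n" using grid_approx[OF nx] by blast
  have "(\<Sum>i<n. a i * (?x i - of_int (z i))) \<le> A * R"
  proof (rule power2_le_imp_le)
    have "(\<Sum>i<n. a i * (?x i - of_int (z i)))\<^sup>2 \<le> sqnorm n a * sqnorm n (\<lambda>i. ?x i - of_int (z i))"
      unfolding sqnorm_def by (rule Cauchy_Schwarz_ineq_sum)
    also have "\<dots> \<le> A\<^sup>2 * R\<^sup>2" using z(2) unfolding A(2) R(2) by (intro mult_left_mono) auto
    finally show "(\<Sum>i<n. a i * (?x i - of_int (z i)))\<^sup>2 \<le> (A * R)\<^sup>2" by (simp add: power_mult_distrib)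
  qed (use A R in auto)
  moreover have "(\<Sum>i<n. a i * ?x i) = 10 * R * A"
  proof -
    have "(\<Sum>i<n. a i * ?x i) = (10 * R / A) * sqnorm n a"
      unfolding sqnorm_def sum_distrib_left by (intro sum.cong refl) (simp add: power2_eq_square)
    then show ?thesis using A by (simp add: power2_eq_square)
  qed
  ultimately have "9 * A * R \<le> (\<Sum>i<n. a i * of_int (z i))"
    by (simp add: right_diff_distrib sum_subtractf)
  also have "\<dots> \<le> t * sqrt (sqnorm n (\<lambda>i. of_int (z i)))" by (rule g[OF z(1)])
  also have "\<dots> \<le> t * (15 * R)"
  proof (intro mult_left_mono t real_le_lsqrt)
    show "sqnorm n (\<lambda>i. of_int (z i)) \<le> (15 * R)\<^sup>2" using z(3) R by (simp add: power_mult_distrib)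
  qed (use R in auto)
  finally have "9 * A \<le> 15 * t" using R by (simp add: mult.commute mult.left_commute)
  then show ?thesis unfolding A_def[symmetric] using t by simp
qed (use t in simp)

section \<open>Errors of the spectral estimator and of the iteration\<close>

definition is_label :: "nat \<Rightarrow> (nat \<Rightarrow> real) \<Rightarrow> bool" where
  "is_label n x \<longleftrightarrow> (\<forall>i<n. x i = 1 \<or> x i = -1)"

definition error_set :: "nat \<Rightarrow> (nat \<Rightarrow> real) \<Rightarrow> (nat \<Rightarrow> real) \<Rightarrow> nat set" where
  "error_set n x h = {i. i < n \<and> x i \<noteq> h i}"

text \<open>The sign of \<open>h i * (M h) i\<close> decides whether one update started from the truth \<open>h\<close> gets coordinate \<open>i\<close>
  right; the set collects the coordinates where this margin is not above \<open>a\<close>.\<close>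

definition thin_set :: "nat \<Rightarrow> (nat \<Rightarrow> nat \<Rightarrow> real) \<Rightarrow> (nat \<Rightarrow> real) \<Rightarrow> real \<Rightarrow> nat set" where
  "thin_set n M h a = {i. i < n \<and> h i * matvec n M h i \<le> a}"

lemma sqnorm_label: "is_label n h \<Longrightarrow> sqnorm n h = real n"
  unfolding sqnorm_def is_label_def
  by (subst sum.cong[OF refl, of _ _ "\<lambda>_. 1"]) auto

text \<open>Scale \<open>v\<close> to the length \<open>sqrt n\<close> of \<open>e\<close>. Optimality of \<open>v\<close> and the smallness of \<open>N\<close> force the correlation
  \<open>|e\<cdot>v|\<close> to be at least \<open>n - 2 K / T\<close>, so \<open>|v - \<nu> e|\<^sup>2 \<le> 4 K / T\<close> for the right sign \<open>\<nu>\<close>; every coordinate of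
  wrong sign contributes at least 1 to this distance.\<close>

lemma spectral_start:
  assumes s: "symmetric_on n N" and q: "\<And>x. \<bar>bilin n N x x\<bar> \<le> K * sqnorm n x"
    and e: "is_label n e" and T: "T > 0" and n: "n > 0"
    and M: "\<And>i j. i < n \<Longrightarrow> j < n \<Longrightarrow> M i j = T * e i * e j + N i j"
    and v: "sqnorm n v > 0" and ray: "bilin n M e e * sqnorm n v \<le> bilin n M v v * sqnorm n e"
  shows "\<exists>\<nu>\<in>{-1, 1}. real (card {i. i < n \<and> v i * (\<nu> * e i) \<le> 0}) \<le> 4 * K / T"
proof -
  have bM: "bilin n M x x = T * (\<Sum>i<n. e i * x i)\<^sup>2 + bilin n N x x" for x
  proof -
    have "bilin n M x x = (\<Sum>i<n. \<Sum>j<n. T * ((e i * x i) * (e j * x j)) + x i * N i j * x j)"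
      unfolding bilin_def by (intro sum.cong refl) (simp add: M algebra_simps)
    also have "\<dots> = T * (\<Sum>i<n. e i * x i)\<^sup>2 + bilin n N x x"
      unfolding power2_eq_square sum_product by (simp only: bilin_def sum.distrib sum_distrib_left)
    finally show ?thesis .
  qed
  have ee: "(\<Sum>i<n. e i * e i) = real n"
    using sqnorm_label[OF e] by (simp add: sqnorm_def power2_eq_square)
  define w where "w = (\<lambda>i. sqrt (real n / sqnorm n v) * v i)"
  define c where "c = sqrt (real n / sqnorm n v)"
  have c: "c > 0" "c\<^sup>2 = real n / sqnorm n v" using n v unfolding c_def by auto
  have nw: "sqnorm n w = real n"
    unfolding w_def c_def[symmetric] sqnorm_scale c(2) using v by simp
  define S where "S = (\<Sum>i<n. e i * w i)"
  have "bilin n M e e \<le> bilin n M v v * real n / sqnorm n v"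
    using ray v unfolding sqnorm_label[OF e] by (simp add: pos_le_divide_eq)
  also have "\<dots> = bilin n M w w"
    unfolding w_def c_def[symmetric] bilin_left_scale bilin_right_scale using c(2)
    by (simp add: power2_eq_square mult.assoc[symmetric])
  finally have "bilin n M e e \<le> bilin n M w w" .
  then have "T * (real n)\<^sup>2 \<le> T * S\<^sup>2 + 2 * K * real n"
    unfolding bM ee S_def[symmetric] using q[of e] q[of w] nw sqnorm_label[OF e] by (simp add: abs_le_iff)
  moreover have S2: "S\<^sup>2 \<le> \<bar>S\<bar> * real n"
  proof -
    have "S\<^sup>2 \<le> real n * real n" unfolding S_def
      using Cauchy_Schwarz_ineq_sum[of e w "{..<n}"] nw sqnorm_label[OF e] by (simp add: sqnorm_def)
    then have "\<bar>S\<bar> \<le> real n" by (metis abs_le_square_iff abs_of_nat power2_eq_square)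
    then show ?thesis using mult_left_mono[of "\<bar>S\<bar>" "real n" "\<bar>S\<bar>"] by (simp add: power2_eq_square)
  qed
  ultimately have "T * (real n)\<^sup>2 \<le> T * (\<bar>S\<bar> * real n) + 2 * K * real n"
    using mult_left_mono[OF S2, of T] T by linarith
  then have "(T * real n) * real n \<le> (T * \<bar>S\<bar> + 2 * K) * real n"
    by (simp add: power2_eq_square algebra_simps)
  then have S: "T * real n \<le> T * \<bar>S\<bar> + 2 * K" using n by simp
  define \<nu> where "\<nu> = (if S \<ge> 0 then 1 else -1 :: real)"
  have \<nu>: "\<nu> \<in> {-1, 1}" "\<nu> * S = \<bar>S\<bar>" "\<nu>\<^sup>2 = 1" unfolding \<nu>_def by auto
  have "real (card {i. i < n \<and> v i * (\<nu> * e i) \<le> 0}) = (\<Sum>i | i < n \<and> v i * (\<nu> * e i) \<le> 0. 1)" by simp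
  also have "\<dots> \<le> (\<Sum>i | i < n \<and> v i * (\<nu> * e i) \<le> 0. (w i - \<nu> * e i)\<^sup>2)"
  proof (intro sum_mono)
    fix i assume "i \<in> {i. i < n \<and> v i * (\<nu> * e i) \<le> 0}"
    then have i: "i < n" "v i * (\<nu> * e i) \<le> 0" by auto
    have "w i * (\<nu> * e i) = c * (v i * (\<nu> * e i))" unfolding w_def c_def[symmetric] by simp
    then have "w i * (\<nu> * e i) \<le> 0" using mult_nonneg_nonpos[OF less_imp_le[OF c(1)] i(2)] by linarith
    moreover have "(\<nu> * e i)\<^sup>2 = 1" using e i(1) \<nu>(3) unfolding is_label_def by (auto simp: power_mult_distrib)
    moreover have "(w i - \<nu> * e i)\<^sup>2 = (w i)\<^sup>2 - 2 * (w i * (\<nu> * e i)) + (\<nu> * e i)\<^sup>2"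
      by (simp add: power2_diff algebra_simps)
    ultimately show "1 \<le> (w i - \<nu> * e i)\<^sup>2" using zero_le_power2[of "w i"] by linarith
  qed
  also have "\<dots> \<le> (\<Sum>i<n. (w i - \<nu> * e i)\<^sup>2)" by (intro sum_mono2) auto
  also have "\<dots> = (\<Sum>i<n. (w i)\<^sup>2 - 2 * \<nu> * (e i * w i) + \<nu>\<^sup>2 * (e i)\<^sup>2)"
    by (intro sum.cong refl) (simp add: power2_diff power_mult_distrib algebra_simps)
  also have "\<dots> = sqnorm n w - 2 * \<nu> * S + \<nu>\<^sup>2 * sqnorm n e"
    by (simp add: sqnorm_def S_def sum.distrib sum_subtractf sum_distrib_left)
  also have "\<dots> = 2 * (real n - \<bar>S\<bar>)" using nw sqnorm_label[OF e] \<nu> by (simp add: mult.assoc)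
  also have "\<dots> \<le> 4 * K / T" using S T by (simp add: field_simps)
  finally show ?thesis using \<nu>(1) by blast
qed

lemma card_error_set_le: "card (error_set n x h) \<le> n"
  using card_mono[of "{..<n}" "error_set n x h"] unfolding error_set_def by auto

lemma sum_label_diff:
  assumes "is_label n x" "is_label n h"
  shows "(\<Sum>i<n. \<bar>x i - h i\<bar>) = 2 * real (card (error_set n x h))"
    "sqnorm n (\<lambda>i. x i - h i) = 4 * real (card (error_set n x h))"
    "(\<Sum>i<n. h i * (x i - h i)) = - 2 * real (card (error_set n x h))"
proof -
  have E: "error_set n x h = {i \<in> {..<n}. x i \<noteq> h i}" unfolding error_set_def by auto
  have c: "(\<Sum>i<n. if x i \<noteq> h i then a else 0) = a * real (card (error_set n x h))" for a
    unfolding E by (subst sum.inter_filter[symmetric]) auto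
  have l: "x i = 1 \<or> x i = -1" "h i = 1 \<or> h i = -1" if "i < n" for i
    using assms that unfolding is_label_def by auto
  show "(\<Sum>i<n. \<bar>x i - h i\<bar>) = 2 * real (card (error_set n x h))"
    unfolding c[symmetric] by (intro sum.cong refl) (use l in fastforce)
  show "sqnorm n (\<lambda>i. x i - h i) = 4 * real (card (error_set n x h))"
    unfolding c[symmetric] sqnorm_def by (intro sum.cong refl) (use l in fastforce)
  show "(\<Sum>i<n. h i * (x i - h i)) = - 2 * real (card (error_set n x h))"
    unfolding c[symmetric] by (intro sum.cong refl) (use l in fastforce)
qed

text \<open>With \<open>d = x - h\<close>, the margin of coordinate \<open>i\<close> at \<open>x\<close> is its margin at \<open>h\<close>, lowered by the common amount
  \<open>2 m T\<close> for \<open>m\<close> errors, plus \<open>h i * (N d) i\<close>. A new error off the thin set therefore needs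
  \<open>|(N d) i| \<ge> \<gamma> n T / 4\<close>, and the bound on \<open>|N d|\<^sup>2\<close> allows at most \<open>m / 16\<close> such coordinates.\<close>

lemma iteration_contracts:
  assumes s: "symmetric_on n N" and q: "\<And>x. \<bar>bilin n N x x\<bar> \<le> (\<gamma> * n * T / 32) * sqnorm n x"
    and h: "is_label n h" and T: "T > 0" and n: "n > 0" and \<gamma>: "\<gamma> > 0"
    and M: "\<And>i j. i < n \<Longrightarrow> j < n \<Longrightarrow> M i j = T * h i * h j + N i j"
    and x: "is_label n x" and m: "real (card (error_set n x h)) \<le> \<gamma> * n / 8"
    and x': "\<And>i. i < n \<Longrightarrow> x' i \<noteq> h i \<Longrightarrow> h i * matvec n M x i \<le> 0"
  shows "real (card (error_set n x' h)) \<le> real (card (thin_set n M h (\<gamma> * n * T / 2))) + real (card (error_set n x h)) / 4"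
proof -
  define g where "g = \<gamma> * n * T / 4"
  have g: "g > 0" using \<gamma> n T unfolding g_def by simp
  define d where "d = (\<lambda>i. x i - h i)"
  define F where "F = {i. i < n \<and> g \<le> \<bar>matvec n N d i\<bar>}"
  have sub: "error_set n x' h \<subseteq> thin_set n M h (\<gamma> * n * T / 2) \<union> F"
  proof
    fix i assume "i \<in> error_set n x' h"
    then have i: "i < n" "x' i \<noteq> h i" unfolding error_set_def by auto
    have hi: "h i * h i = 1" "\<bar>h i\<bar> = 1" using h i unfolding is_label_def by auto
    have "matvec n M x i = matvec n M h i + matvec n M d i"
      by (simp add: matvec_def d_def sum.distrib[symmetric] algebra_simps)
    moreover have "matvec n M d i = T * h i * (\<Sum>j<n. h j * d j) + matvec n N d i"
      using i by (simp add: matvec_def M sum.distrib[symmetric] sum_distrib_left algebra_simps)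
    moreover have "(\<Sum>j<n. h j * d j) = - 2 * real (card (error_set n x h))"
      unfolding d_def by (rule sum_label_diff(3)[OF x h])
    ultimately have "matvec n M x i = matvec n M h i + (T * h i * (- 2 * real (card (error_set n x h))) + matvec n N d i)"
      by simp
    then have "h i * matvec n M x i = h i * matvec n M h i
        - (h i * h i) * (T * (2 * real (card (error_set n x h)))) + h i * matvec n N d i"
      by (simp only:) (simp add: algebra_simps)
    then have "h i * matvec n M h i + h i * matvec n N d i \<le> T * (2 * real (card (error_set n x h)))"
      using x'[OF i] unfolding hi by simp
    also have "\<dots> \<le> T * (\<gamma> * n / 4)" using m T by (intro mult_left_mono) auto
    finally have "h i * matvec n M h i + h i * matvec n N d i \<le> g" unfolding g_def by (simp add: algebra_simps)
    moreover have "- \<bar>matvec n N d i\<bar> \<le> h i * matvec n N d i"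
      using hi(2) abs_ge_minus_self[of "h i * matvec n N d i"] by (simp add: abs_mult)
    ultimately have "h i * matvec n M h i \<le> 2 * g \<or> g \<le> \<bar>matvec n N d i\<bar>" by linarith
    then show "i \<in> thin_set n M h (\<gamma> * n * T / 2) \<union> F"
      using i unfolding thin_set_def F_def g_def by (auto simp: algebra_simps)
  qed
  have fin: "finite F" "finite (thin_set n M h (\<gamma> * n * T / 2))" unfolding F_def thin_set_def by auto
  have "g\<^sup>2 * real (card F) = (\<Sum>i\<in>F. g\<^sup>2)" by simp
  also have "\<dots> \<le> (\<Sum>i\<in>F. (matvec n N d i)\<^sup>2)"
    by (intro sum_mono) (use g in \<open>auto simp: F_def abs_le_square_iff[symmetric]\<close>)
  also have "\<dots> \<le> sqnorm n (matvec n N d)" unfolding sqnorm_def by (intro sum_mono2) (auto simp: F_def)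
  also have "\<dots> \<le> (\<gamma> * n * T / 32)\<^sup>2 * sqnorm n d"
    by (rule matvec_sqnorm_le[OF s q]) (use \<gamma> n T in auto)
  also have "\<dots> = g\<^sup>2 * (real (card (error_set n x h)) / 16)"
    unfolding d_def sum_label_diff(2)[OF x h] g_def by (simp add: power2_eq_square)
  finally have F: "real (card F) \<le> real (card (error_set n x h)) / 16" using g by simp
  have "card (error_set n x' h) \<le> card (thin_set n M h (\<gamma> * n * T / 2)) + card F"
    using card_mono[OF _ sub] card_Un_le[of "thin_set n M h (\<gamma> * n * T / 2)" F] fin by fastforce
  then have "real (card (error_set n x' h)) \<le> real (card (thin_set n M h (\<gamma> * n * T / 2))) + real (card F)" by linarith
  then show ?thesis using F by linarith
qed

lemma sign_vec_nth: "i < dim_vec v \<Longrightarrow> sign_vec s0 v $ i = (if v $ i = 0 then s0 else sgn (v $ i))"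
  by (simp add: sign_vec_def)

lemma dim_sign_vec [simp]: "dim_vec (sign_vec s0 v) = dim_vec v"
  by (simp add: sign_vec_def)

lemma sign_vec_label:
  assumes "dim_vec v = n" "s0 \<in> {-1, 1}"
  shows "is_label n (\<lambda>i. sign_vec s0 v $ i)"
  using assms unfolding is_label_def by (auto simp: sign_vec_nth sgn_if)

lemma sign_vec_error:
  assumes "i < dim_vec v" "s0 \<in> {-1, 1}" "h = 1 \<or> h = (-1::real)" "sign_vec s0 v $ i \<noteq> h"
  shows "v $ i * h \<le> 0"
  using assms by (auto simp: sign_vec_nth sgn_if split: if_splits)

lemma loss_le:
  assumes "\<nu> \<in> {-1, 1::real}"
  shows "loss n x' x \<le> (\<Sum>j<n. \<bar>x' $ j - \<nu> * x $ j\<bar>)"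
  unfolding loss_def using assms by (intro Min_le) auto

lemma is_label_flip: "is_label n h \<Longrightarrow> \<nu> \<in> {-1, 1} \<Longrightarrow> is_label n (\<lambda>i. \<nu> * h i)"
  unfolding is_label_def by auto

lemma iter_est_label:
  assumes "hollow_gram Y \<in> carrier_mat n n" "dim_vec (vhat Y) = n" "s0 \<in> {-1, 1}"
  shows "dim_vec (iter_est s0 vhat k Y) = n" "is_label n (\<lambda>i. iter_est s0 vhat k Y $ i)"
proof -
  show "dim_vec (iter_est s0 vhat k Y) = n" using assms by (cases k) auto
  show "is_label n (\<lambda>i. iter_est s0 vhat k Y $ i)" using assms by (cases k) (auto intro!: sign_vec_label)
qed

lemma loss_le_2n:
  assumes "is_label n (\<lambda>i. x' $ i)" "is_label n (\<lambda>i. x $ i)"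
  shows "loss n x' x \<le> 2 * real n"
proof -
  have "loss n x' x \<le> (\<Sum>j<n. \<bar>x' $ j - 1 * x $ j\<bar>)" by (rule loss_le) simp
  also have "\<dots> = 2 * real (card (error_set n (\<lambda>i. x' $ i) (\<lambda>i. x $ i)))" using sum_label_diff(1)[OF assms] by simp
  also have "\<dots> \<le> 2 * real n" using card_error_set_le[of n "\<lambda>i. x' $ i" "\<lambda>i. x $ i"] by simp
  finally show ?thesis .
qed

text \<open>If the thin set is larger than a small multiple of \<open>\<gamma> n\<close>, then the trivial bound \<open>2 n\<close> on the loss
  already has the required form. Otherwise the spectral estimate and all iterates have at most
  \<open>\<gamma> n / 8\<close> errors, so the contraction applies at each step, and after \<open>k\<close> steps the contribution of
  the initial error is below 1. One margin \<open>\<gamma>\<close> thus serves both for the start and for the limit of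
  the iteration, at the price of the factor \<open>1 / \<gamma>\<close>.\<close>

lemma loss_iter_est_le:
  fixes M N :: "nat \<Rightarrow> nat \<Rightarrow> real" and Y :: "real mat" and \<eta> :: "real Matrix.vec" and T :: real
  defines "M \<equiv> \<lambda>i j. hollow_gram Y $$ (i, j)"
  defines "N \<equiv> \<lambda>i j. M i j - T * \<eta> $ i * \<eta> $ j"
  assumes car: "hollow_gram Y \<in> carrier_mat n n" and s: "symmetric_on n M"
    and q: "\<And>x. \<bar>bilin n N x x\<bar> \<le> (\<gamma> * n * T / 32) * sqnorm n x"
    and \<eta>: "is_label n (\<lambda>i. \<eta> $ i)" and T: "T > 0" and n: "n > 0" and \<gamma>: "0 < \<gamma>" "\<gamma> \<le> 1"
    and s0: "s0 \<in> {-1, 1}" and top: "top_eigenvector (hollow_gram Y) (vhat Y)"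
    and k: "real n < 8 * 4 ^ k"
  shows "loss n (iter_est s0 vhat k Y) \<eta> \<le> 22 / \<gamma> * real (card (thin_set n M (\<lambda>i. \<eta> $ i) (\<gamma> * n * T / 2)))"
proof -
  define b where "b = real (card (thin_set n M (\<lambda>i. \<eta> $ i) (\<gamma> * n * T / 2)))"
  note ray = top_eigenvector_rayleigh[OF car s[unfolded M_def] top]
  have dv: "dim_vec (vhat Y) = n" using ray(1) by auto
  have lab: "is_label n (\<lambda>i. iter_est s0 vhat j Y $ i)" for j by (rule iter_est_label(2)[where vhat = vhat and Y = Y, OF car dv s0])
  show ?thesis
  proof (cases "b \<le> 3 * \<gamma> * n / 32")
    case False
    have "loss n (iter_est s0 vhat k Y) \<eta> \<le> 2 * real n" by (rule loss_le_2n[OF lab \<eta>])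
    also have "b \<ge> 0" unfolding b_def by simp
    then have "2 * real n \<le> 22 / \<gamma> * b" using False \<gamma> by (simp add: field_simps)
    finally show ?thesis unfolding b_def .
  next
    case True
    have sN: "symmetric_on n N" using s unfolding symmetric_on_def N_def by (auto simp: algebra_simps)
    have "\<exists>\<nu>\<in>{-1, 1}. real (card {i. i < n \<and> vhat Y $ i * (\<nu> * \<eta> $ i) \<le> 0}) \<le> 4 * (\<gamma> * n * T / 32) / T"
    proof (rule spectral_start[OF sN q \<eta> T n _ ray(2)])
      show "M i j = T * \<eta> $ i * \<eta> $ j + N i j" for i j unfolding N_def by simp
    qed (use ray(3) in \<open>simp add: M_def\<close>)
    then obtain \<nu> where \<nu>: "\<nu> \<in> {-1, 1::real}"
      and start: "real (card {i. i < n \<and> vhat Y $ i * (\<nu> * \<eta> $ i) \<le> 0}) \<le> 4 * (\<gamma> * n * T / 32) / T"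
      by blast
    define h where "h = (\<lambda>i. \<nu> * \<eta> $ i)"
    have h: "is_label n h" unfolding h_def by (rule is_label_flip[OF \<eta> \<nu>])
    have \<nu>2: "\<nu> * \<nu> = 1" using \<nu> by auto
    have Mh: "M i j = T * h i * h j + N i j" if "i < n" "j < n" for i j
    proof -
      have "T * h i * h j = (\<nu> * \<nu>) * (T * \<eta> $ i * \<eta> $ j)" unfolding h_def by (simp add: algebra_simps)
      then show ?thesis unfolding N_def \<nu>2 by simp
    qed
    have thin_h: "thin_set n M h a = thin_set n M (\<lambda>i. \<eta> $ i) a" for a
    proof -
      have "h i * matvec n M h i = (\<nu> * \<nu>) * (\<eta> $ i * matvec n M (\<lambda>i. \<eta> $ i) i)" for i
        unfolding h_def matvec_def by (simp add: sum_distrib_left algebra_simps)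
      then show ?thesis unfolding thin_set_def \<nu>2 by simp
    qed
    define m where "m = (\<lambda>j. real (card (error_set n (\<lambda>i. iter_est s0 vhat j Y $ i) h)))"
    have hl: "h i = 1 \<or> h i = -1" if "i < n" for i using h that unfolding is_label_def by auto
    have "m j \<le> \<gamma> * n / 8 \<and> m j \<le> 4 / 3 * b + \<gamma> * n / 8 / 4 ^ j" for j
    proof (induction j)
      case 0
      have "error_set n (\<lambda>i. iter_est s0 vhat 0 Y $ i) h \<subseteq> {i. i < n \<and> vhat Y $ i * (\<nu> * \<eta> $ i) \<le> 0}"
        using sign_vec_error[of _ "vhat Y" s0] s0 hl dv unfolding error_set_def h_def by auto
      then have "m 0 \<le> real (card {i. i < n \<and> vhat Y $ i * (\<nu> * \<eta> $ i) \<le> 0})"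
        unfolding m_def by (intro of_nat_mono card_mono) auto
      also have "\<dots> \<le> \<gamma> * n / 8" using start T by simp
      finally show ?case unfolding b_def by simp
    next
      case (Suc j)
      have "h i * matvec n M (\<lambda>i. iter_est s0 vhat j Y $ i) i \<le> 0"
        if i: "i < n" "iter_est s0 vhat (Suc j) Y $ i \<noteq> h i" for i
      proof -
        have "(hollow_gram Y *\<^sub>v iter_est s0 vhat j Y) $ i * h i \<le> 0"
          using sign_vec_error[of i "hollow_gram Y *\<^sub>v iter_est s0 vhat j Y" s0 "h i"] i hl car s0 by auto
        moreover have "(hollow_gram Y *\<^sub>v iter_est s0 vhat j Y) $ i = matvec n M (\<lambda>i. iter_est s0 vhat j Y $ i) i"
          using i car iter_est_label(1)[where vhat = vhat and Y = Y, OF car dv s0, of j]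
          by (auto simp: matvec_def M_def scalar_prod_def atLeast0LessThan intro!: sum.cong)
        ultimately show ?thesis by (simp add: mult.commute)
      qed
      then have "m (Suc j) \<le> b + m j / 4"
        using iteration_contracts[OF sN q h T n \<gamma>(1) Mh lab[of j], of "\<lambda>i. iter_est s0 vhat (Suc j) Y $ i"] Suc
        unfolding m_def b_def thin_h by simp
      then show ?case using Suc True by simp
    qed
    then have "m k \<le> 4 / 3 * b + \<gamma> * n / 8 / 4 ^ k" by blast
    moreover have "\<gamma> * n / 8 / 4 ^ k < 1"
    proof -
      have "\<gamma> * n \<le> 1 * real n" using \<gamma> by (intro mult_right_mono) auto
      then show ?thesis using k by (simp add: field_simps)
    qed
    ultimately have mk: "m k < 4 / 3 * b + 1" by linarith
    \<comment> \<open>both counts are integers\<close>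
    have "m k \<le> 3 * b"
    proof (cases "b = 0")
      case True
      then have "m k < 1" using mk by simp
      then show ?thesis using True unfolding m_def by simp
    next
      case False
      then have "b \<ge> 1" unfolding b_def by simp
      then show ?thesis using mk by simp
    qed
    have "loss n (iter_est s0 vhat k Y) \<eta> \<le> (\<Sum>j<n. \<bar>iter_est s0 vhat k Y $ j - h j\<bar>)"
      unfolding h_def by (rule loss_le[OF \<nu>])
    also have "\<dots> = 2 * m k" unfolding m_def by (rule sum_label_diff(1)[OF lab h])
    also have "\<dots> \<le> 6 * b" using \<open>m k \<le> 3 * b\<close> by simp
    also have "\<dots> \<le> 22 / \<gamma> * b" using \<gamma> unfolding b_def by (intro mult_right_mono) (auto simp: field_simps)
    finally show ?thesis unfolding b_def .
  qed
qed

section \<open>Gaussian exponential moments\<close>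

lemma (in prob_space) chernoff_bound:
  assumes [measurable]: "Z \<in> borel_measurable M"
    and B: "(\<integral>\<^sup>+\<omega>. ennreal (exp (Z \<omega>)) \<partial>M) \<le> ennreal B" "B \<ge> 0"
  shows "prob {\<omega> \<in> space M. a \<le> Z \<omega>} \<le> exp (- a) * B"
proof -
  have "{\<omega> \<in> space M. a \<le> Z \<omega>} = {\<omega> \<in> space M. 1 \<le> ennreal (exp (- a)) * ennreal (exp (Z \<omega>))}"
    by (auto simp: ennreal_mult[symmetric] exp_add[symmetric] simp del: ennreal_mult)
  also have "emeasure M \<dots> \<le> ennreal (exp (- a)) * (\<integral>\<^sup>+\<omega>. ennreal (exp (Z \<omega>)) * indicator (space M) \<omega> \<partial>M)"
    by (rule nn_integral_Markov_inequality) auto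
  also have "(\<integral>\<^sup>+\<omega>. ennreal (exp (Z \<omega>)) * indicator (space M) \<omega> \<partial>M) = (\<integral>\<^sup>+\<omega>. ennreal (exp (Z \<omega>)) \<partial>M)"
    by (intro nn_integral_cong) auto
  also have "ennreal (exp (- a)) * \<dots> \<le> ennreal (exp (- a)) * ennreal B"
    by (intro mult_left_mono B) auto
  also have "\<dots> = ennreal (exp (- a) * B)" using B(2) by (simp add: ennreal_mult)
  finally show ?thesis using B(2) by (simp add: emeasure_eq_measure)
qed

text \<open>Completing the square, the integrand is a constant times a Gaussian density of variance
  \<open>s\<^sup>2 / (1 - 2 \<alpha> s\<^sup>2)\<close>. Integrals with values in the extended nonnegative reals keep integrability out
  of the way.\<close>

lemma (in prob_space) gaussian_mgf:
  assumes X: "distributed M lborel X (normal_density 0 s)" and s: "s > 0" and \<alpha>: "2 * \<alpha> * s\<^sup>2 < 1"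
  shows "(\<integral>\<^sup>+\<omega>. ennreal (exp (\<alpha> * (X \<omega>)\<^sup>2 + \<beta> * X \<omega>)) \<partial>M) =
    ennreal (inverse (sqrt (1 - 2 * \<alpha> * s\<^sup>2)) * exp (\<beta>\<^sup>2 * s\<^sup>2 / (2 * (1 - 2 * \<alpha> * s\<^sup>2))))" (is "_ = ennreal ?c")
proof -
  define d where "d = 1 - 2 * \<alpha> * s\<^sup>2"
  have d: "d > 0" using \<alpha> unfolding d_def by simp
  define \<tau> where "\<tau> = s / sqrt d"
  have \<tau>: "\<tau> > 0" "\<tau>\<^sup>2 = s\<^sup>2 / d" using s d unfolding \<tau>_def by (auto simp: power_divide)
  have eq: "normal_density 0 s x * exp (\<alpha> * x\<^sup>2 + \<beta> * x) = ?c * normal_density (\<beta> * \<tau>\<^sup>2) \<tau> x" for x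
  proof -
    have "- (x\<^sup>2) / (2 * s\<^sup>2) + (\<alpha> * x\<^sup>2 + \<beta> * x) = \<beta>\<^sup>2 * s\<^sup>2 / (2 * d) + - ((x - \<beta> * \<tau>\<^sup>2)\<^sup>2) / (2 * \<tau>\<^sup>2)"
    proof -
      have \<alpha>': "\<alpha> = (1 - d) / (2 * s\<^sup>2)" using s unfolding d_def by simp
      show ?thesis unfolding \<tau>(2) \<alpha>' using s d
        by (simp add: divide_simps) (simp add: power2_eq_square algebra_simps)
    qed
    moreover have "inverse (sqrt d) * (1 / sqrt (2 * pi * \<tau>\<^sup>2)) = 1 / sqrt (2 * pi * s\<^sup>2)"
      unfolding \<tau>(2) using s d by (simp add: real_sqrt_mult real_sqrt_divide field_simps)
    moreover have "normal_density 0 s x * exp (\<alpha> * x\<^sup>2 + \<beta> * x)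
        = 1 / sqrt (2 * pi * s\<^sup>2) * exp (- (x\<^sup>2) / (2 * s\<^sup>2) + (\<alpha> * x\<^sup>2 + \<beta> * x))"
      unfolding normal_density_def exp_add[of "- (x\<^sup>2) / (2 * s\<^sup>2)"] by simp
    moreover have "?c * normal_density (\<beta> * \<tau>\<^sup>2) \<tau> x = inverse (sqrt d) * (1 / sqrt (2 * pi * \<tau>\<^sup>2))
        * exp (\<beta>\<^sup>2 * s\<^sup>2 / (2 * d) + - ((x - \<beta> * \<tau>\<^sup>2)\<^sup>2) / (2 * \<tau>\<^sup>2))"
      unfolding normal_density_def exp_add[of "\<beta>\<^sup>2 * s\<^sup>2 / (2 * d)"] d_def[symmetric] by simp
    ultimately show ?thesis by (simp only:)
  qed
  have "(\<integral>\<^sup>+\<omega>. ennreal (exp (\<alpha> * (X \<omega>)\<^sup>2 + \<beta> * X \<omega>)) \<partial>M)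
      = (\<integral>\<^sup>+x. ennreal (normal_density 0 s x) * ennreal (exp (\<alpha> * x\<^sup>2 + \<beta> * x)) \<partial>lborel)"
    by (rule distributed_nn_integral[OF X, symmetric]) auto
  also have "\<dots> = (\<integral>\<^sup>+x. ennreal ?c * ennreal (normal_density (\<beta> * \<tau>\<^sup>2) \<tau> x) \<partial>lborel)"
  proof (intro nn_integral_cong)
    fix x
    have c: "?c \<ge> 0" using d unfolding d_def[symmetric] by simp
    have "ennreal (normal_density 0 s x) * ennreal (exp (\<alpha> * x\<^sup>2 + \<beta> * x))
        = ennreal (normal_density 0 s x * exp (\<alpha> * x\<^sup>2 + \<beta> * x))"
      by (rule ennreal_mult'[symmetric]) simp
    also have "\<dots> = ennreal ?c * ennreal (normal_density (\<beta> * \<tau>\<^sup>2) \<tau> x)"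
      unfolding eq by (rule ennreal_mult'[OF c])
    finally show "ennreal (normal_density 0 s x) * ennreal (exp (\<alpha> * x\<^sup>2 + \<beta> * x))
        = ennreal ?c * ennreal (normal_density (\<beta> * \<tau>\<^sup>2) \<tau> x)" .
  qed
  also have "\<dots> = ennreal ?c * (\<integral>\<^sup>+x. ennreal (normal_density (\<beta> * \<tau>\<^sup>2) \<tau> x) \<partial>lborel)"
    by (rule nn_integral_cmult) auto
  also have "(\<integral>\<^sup>+x. ennreal (normal_density (\<beta> * \<tau>\<^sup>2) \<tau> x) \<partial>lborel) = 1"
    using \<tau> by (subst nn_integral_eq_integral) auto
  finally show ?thesis by simp
qed

text \<open>The variables are indexed by an arbitrary finite set because they will be the entries of the noise
  matrix, which are grouped into rows, single entries and rows with one entry removed.\<close>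

locale gaussian_family = prob_space +
  fixes I :: "'i set" and X :: "'i \<Rightarrow> 'a \<Rightarrow> real"
  assumes finite_index: "finite I"
    and indep: "indep_vars (\<lambda>_. borel) X I"
    and normal: "\<And>i. i \<in> I \<Longrightarrow> distributed M lborel (X i) std_normal_density"
begin

lemma measurable_X [measurable (raw)]: "i \<in> I \<Longrightarrow> X i \<in> borel_measurable M"
  using indep unfolding indep_vars_def by auto

definition lin :: "('i \<Rightarrow> real) \<Rightarrow> 'i set \<Rightarrow> 'a \<Rightarrow> real" where
  "lin x K \<omega> = (\<Sum>i\<in>K. x i * X i \<omega>)"

lemma measurable_lin [measurable (raw)]: "K \<subseteq> I \<Longrightarrow> lin x K \<in> borel_measurable M"
  unfolding lin_def by (intro borel_measurable_sum borel_measurable_times) (auto intro: measurable_X)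

text \<open>Terms with coefficient 0 are removed first: they have no density.\<close>

lemma lin_normal:
  assumes K: "K \<subseteq> I" and x: "(\<Sum>i\<in>K. (x i)\<^sup>2) > 0"
  shows "distributed M lborel (lin x K) (normal_density 0 (sqrt (\<Sum>i\<in>K. (x i)\<^sup>2)))"
proof -
  let ?S = "{i \<in> K. x i \<noteq> 0}"
  have finK: "finite K" using K finite_index finite_subset by auto
  have ne: "?S \<noteq> {}"
  proof
    assume "?S = {}"
    then have "(\<Sum>i\<in>K. (x i)\<^sup>2) = 0" by (intro sum.neutral) auto
    with x show False by simp
  qed
  have "indep_vars (\<lambda>_. borel) X ?S" by (rule indep_vars_subset[OF indep]) (use K in auto)
  then have ind: "indep_vars (\<lambda>_. borel) (\<lambda>i \<omega>. x i * X i \<omega>) ?S"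
    by (rule indep_vars_compose2) auto
  have "distributed M lborel (\<lambda>\<omega>. \<Sum>i\<in>?S. x i * X i \<omega>) (normal_density (\<Sum>i\<in>?S. 0) (sqrt (\<Sum>i\<in>?S. \<bar>x i\<bar>\<^sup>2)))"
  proof (rule sum_indep_normal[OF _ ne ind])
    fix i assume i: "i \<in> ?S"
    then show "distributed M lborel (\<lambda>\<omega>. x i * X i \<omega>) (normal_density 0 \<bar>x i\<bar>)"
      using normal_density_affine[of "X i" 0 1 "x i" 0] normal[of i] K by auto
  qed (use finK in auto)
  moreover have "(\<Sum>i\<in>?S. \<bar>x i\<bar>\<^sup>2) = (\<Sum>i\<in>K. (x i)\<^sup>2)"
    using finK by (intro sum.mono_neutral_cong_left) auto
  moreover have "(\<lambda>\<omega>. \<Sum>i\<in>?S. x i * X i \<omega>) = lin x K"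
    unfolding lin_def using finK by (intro ext sum.mono_neutral_cong_left) auto
  ultimately show ?thesis by simp
qed

lemma lin_upper_tail:
  assumes K: "K \<subseteq> I" and s: "s \<ge> 0"
  shows "prob {\<omega> \<in> space M. (\<Sum>i\<in>K. (x i)\<^sup>2) > 0 \<and> s * sqrt (\<Sum>i\<in>K. (x i)\<^sup>2) \<le> lin x K \<omega>} \<le> exp (- (s\<^sup>2 / 2))"
proof (cases "(\<Sum>i\<in>K. (x i)\<^sup>2) > 0")
  case True
  define v where "v = sqrt (\<Sum>i\<in>K. (x i)\<^sup>2)"
  have v: "v > 0" using True unfolding v_def by simp
  note [measurable] = measurable_lin[OF K]
  have "prob {\<omega> \<in> space M. s * s \<le> s / v * lin x K \<omega>} \<le> exp (- (s * s)) * exp (s\<^sup>2 / 2)"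
  proof (rule chernoff_bound)
    have "(\<integral>\<^sup>+\<omega>. ennreal (exp (0 * (lin x K \<omega>)\<^sup>2 + s / v * lin x K \<omega>)) \<partial>M) = ennreal (exp (s\<^sup>2 / 2))"
      using v by (subst gaussian_mgf[OF lin_normal[OF K True, folded v_def] v])
        (auto simp: power_divide)
    then show "(\<integral>\<^sup>+\<omega>. ennreal (exp (s / v * lin x K \<omega>)) \<partial>M) \<le> ennreal (exp (s\<^sup>2 / 2))" by simp
  qed auto
  also have "\<dots> = exp (- (s\<^sup>2 / 2))" by (simp add: exp_add[symmetric] power2_eq_square)
  finally have 1: "prob {\<omega> \<in> space M. s * s \<le> s / v * lin x K \<omega>} \<le> exp (- (s\<^sup>2 / 2))" .
  have "s * s \<le> s / v * lin x K \<omega>" if "s * v \<le> lin x K \<omega>" for \<omega>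
    using mult_left_mono[OF that, of "s / v"] s v by simp
  then have "prob {\<omega> \<in> space M. s * v \<le> lin x K \<omega>} \<le> prob {\<omega> \<in> space M. s * s \<le> s / v * lin x K \<omega>}"
    by (intro finite_measure_mono) auto
  with 1 show ?thesis using True unfolding v_def[symmetric] by simp
qed simp

lemma indep_vars_of_blocks:
  assumes K: "\<And>k. k \<in> L \<Longrightarrow> K k \<subseteq> I" "disjoint_family_on K L"
    and f: "\<And>k. k \<in> L \<Longrightarrow> f k \<in> borel_measurable (PiM (K k) (\<lambda>_. borel))"
    and g: "\<And>k \<omega>. k \<in> L \<Longrightarrow> f k (restrict (\<lambda>i. X i \<omega>) (K k)) = g k \<omega>"
  shows "indep_vars (\<lambda>_. borel :: real measure) g L"
proof -
  have "indep_vars (\<lambda>_. borel) (\<lambda>k \<omega>. f k (restrict (\<lambda>i. X i \<omega>) (K k))) L"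
    by (rule indep_vars_compose2[OF indep_vars_restrict[OF indep K]]) (use f in auto)
  then show ?thesis by (rule indep_vars_cong[THEN iffD1, rotated -1]) (use g in auto)
qed

lemma measurable_lin_PiM:
  "K \<subseteq> K' \<Longrightarrow> (\<lambda>y. \<Sum>i\<in>K. x i * y i :: real) \<in> borel_measurable (PiM K' (\<lambda>_. borel))"
  by (intro borel_measurable_sum borel_measurable_times borel_measurable_const measurable_component_singleton) auto

text \<open>Exponential moments factor over disjoint blocks of indices, which will be the rows of the noise
  matrix. Each \<open>g k\<close> is required to be a measurable function \<open>f k\<close> of the variables in block \<open>K k\<close>.\<close>

lemma nn_integral_exp_rows:
  assumes K: "\<And>k. k \<in> L \<Longrightarrow> K k \<subseteq> I" "disjoint_family_on K L" and L: "finite L"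
    and f: "\<And>k. k \<in> L \<Longrightarrow> f k \<in> borel_measurable (PiM (K k) (\<lambda>_. borel))"
    and g: "\<And>k \<omega>. k \<in> L \<Longrightarrow> f k (restrict (\<lambda>i. X i \<omega>) (K k)) = g k \<omega>"
    and B: "\<And>k. k \<in> L \<Longrightarrow> (\<integral>\<^sup>+\<omega>. ennreal (exp (g k \<omega>)) \<partial>M) = ennreal (B k)" "\<And>k. k \<in> L \<Longrightarrow> B k \<ge> 0"
  shows "(\<integral>\<^sup>+\<omega>. ennreal (exp (\<Sum>k\<in>L. g k \<omega>)) \<partial>M) = ennreal (\<Prod>k\<in>L. B k)"
proof -
  have "indep_vars (\<lambda>_. borel :: real measure) g L" by (rule indep_vars_of_blocks[OF K f g])
  then have ind: "indep_vars (\<lambda>_. borel) (\<lambda>k \<omega>. ennreal (exp (g k \<omega>))) L"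
    by (rule indep_vars_compose2) auto
  have "(\<integral>\<^sup>+\<omega>. ennreal (exp (\<Sum>k\<in>L. g k \<omega>)) \<partial>M) = (\<integral>\<^sup>+\<omega>. (\<Prod>k\<in>L. ennreal (exp (g k \<omega>))) \<partial>M)"
    by (simp add: exp_sum[OF L] prod_ennreal)
  also have "\<dots> = (\<Prod>k\<in>L. \<integral>\<^sup>+\<omega>. ennreal (exp (g k \<omega>)) \<partial>M)"
    by (rule indep_vars_nn_integral[OF L ind]) auto
  also have "\<dots> = ennreal (\<Prod>k\<in>L. B k)" using B by (simp add: prod_ennreal)
  finally show ?thesis .
qed

end

section \<open>Sums of squares and products of Gaussians\<close>

lemma inverse_sqrt_le_exp:
  fixes y :: real
  assumes "\<bar>y\<bar> \<le> 1 / 2"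
  shows "inverse (sqrt (1 - y)) \<le> exp (y / 2 + y\<^sup>2)"
proof -
  have "- y - 2 * y\<^sup>2 \<le> ln (1 - y)"
  proof (cases "y \<ge> 0")
    case True then show ?thesis using assms by (intro ln_one_minus_pos_lower_bound) auto
  next
    case False
    then have "- y - (- y)\<^sup>2 \<le> ln (1 + (- y))" using assms by (intro ln_one_plus_pos_lower_bound) auto
    then have "- y - y\<^sup>2 \<le> ln (1 - y)" by simp
    then show ?thesis using zero_le_power2[of y] by linarith
  qed
  then have "exp (- y - 2 * y\<^sup>2) \<le> 1 - y" using assms by (subst (asm) ln_ge_iff) auto
  then have "sqrt (exp (- y - 2 * y\<^sup>2)) \<le> sqrt (1 - y)" by (rule real_sqrt_le_mono)
  also have "sqrt (exp (- y - 2 * y\<^sup>2)) = exp (- (y / 2 + y\<^sup>2))"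
    by (rule real_sqrt_unique) (auto simp: power2_eq_square exp_add[symmetric] algebra_simps)
  finally have "inverse (sqrt (1 - y)) \<le> inverse (exp (- (y / 2 + y\<^sup>2)))"
    by (intro le_imp_inverse_le) auto
  then show ?thesis by (simp only: exp_minus inverse_inverse_eq)
qed

context gaussian_family begin

lemma sq_sum_mgf:
  assumes K: "\<And>k. k \<in> L \<Longrightarrow> K k \<subseteq> I" "disjoint_family_on K L" and L: "finite L"
    and V: "\<And>k. k \<in> L \<Longrightarrow> (\<Sum>i\<in>K k. (x i)\<^sup>2) = V" "V > 0" and l: "\<bar>l\<bar> \<le> 1 / 4"
  shows "(\<integral>\<^sup>+\<omega>. ennreal (exp (l * ((\<Sum>k\<in>L. (lin x (K k) \<omega>)\<^sup>2) / V - card L))) \<partial>M) \<le> ennreal (exp (4 * l\<^sup>2 * card L))"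
proof -
  have "(\<integral>\<^sup>+\<omega>. ennreal (exp (\<Sum>k\<in>L. l / V * (lin x (K k) \<omega>)\<^sup>2)) \<partial>M) = ennreal (\<Prod>k\<in>L. inverse (sqrt (1 - 2 * l)))"
  proof (rule nn_integral_exp_rows[OF K L, where f = "\<lambda>k y. l / V * (\<Sum>i\<in>K k. x i * y i)\<^sup>2"])
    fix k assume k: "k \<in> L"
    show "(\<lambda>y. l / V * (\<Sum>i\<in>K k. x i * y i)\<^sup>2) \<in> borel_measurable (PiM (K k) (\<lambda>_. borel))"
      by (intro borel_measurable_times borel_measurable_const borel_measurable_power measurable_lin_PiM) auto
    show "l / V * (\<Sum>i\<in>K k. x i * restrict (\<lambda>i. X i \<omega>) (K k) i)\<^sup>2 = l / V * (lin x (K k) \<omega>)\<^sup>2" for \<omega>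
      by (simp add: lin_def)
    have V0: "(\<Sum>i\<in>K k. (x i)\<^sup>2) > 0" "sqrt V > 0" using V(2) V(1)[OF k] by auto
    have "(\<integral>\<^sup>+\<omega>. ennreal (exp (l / V * (lin x (K k) \<omega>)\<^sup>2 + 0 * lin x (K k) \<omega>)) \<partial>M) = ennreal (inverse (sqrt (1 - 2 * l)))"
      using V(2) l by (subst gaussian_mgf[OF lin_normal[OF K(1)[OF k] V0(1), unfolded V(1)[OF k]] V0(2)]) auto
    then show "(\<integral>\<^sup>+\<omega>. ennreal (exp (l / V * (lin x (K k) \<omega>)\<^sup>2)) \<partial>M) = ennreal (inverse (sqrt (1 - 2 * l)))" by simp
  qed (use l in auto)
  then have *: "(\<integral>\<^sup>+\<omega>. ennreal (exp (\<Sum>k\<in>L. l / V * (lin x (K k) \<omega>)\<^sup>2)) \<partial>M) = ennreal (inverse (sqrt (1 - 2 * l)) ^ card L)"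
    by simp
  have [measurable]: "lin x (K k) \<in> borel_measurable M" if "k \<in> L" for k by (rule measurable_lin[OF K(1)[OF that]])
  have "(\<integral>\<^sup>+\<omega>. ennreal (exp (l * ((\<Sum>k\<in>L. (lin x (K k) \<omega>)\<^sup>2) / V - card L))) \<partial>M)
      = (\<integral>\<^sup>+\<omega>. ennreal (exp (- l * card L)) * ennreal (exp (\<Sum>k\<in>L. l / V * (lin x (K k) \<omega>)\<^sup>2)) \<partial>M)"
    by (intro nn_integral_cong)
      (simp add: ennreal_mult'[symmetric] exp_add[symmetric] sum_distrib_left sum_divide_distrib algebra_simps)
  also have "\<dots> = ennreal (exp (- l * card L)) * ennreal (inverse (sqrt (1 - 2 * l)) ^ card L)"
    by (subst nn_integral_cmult) (use * in auto)
  also have "\<dots> = ennreal (exp (- l * card L) * inverse (sqrt (1 - 2 * l)) ^ card L)"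
    by (simp add: ennreal_mult')
  also have "\<dots> \<le> ennreal (exp (- l * card L) * exp (l + 4 * l\<^sup>2) ^ card L)"
    using inverse_sqrt_le_exp[of "2 * l"] l
    by (intro ennreal_leI mult_left_mono power_mono) (auto simp: power_mult_distrib)
  also have "exp (- l * card L) * exp (l + 4 * l\<^sup>2) ^ card L = exp (4 * l\<^sup>2 * card L)"
    by (simp add: exp_of_nat_mult[symmetric] exp_add[symmetric] algebra_simps)
  finally show ?thesis .
qed

text \<open>The Chernoff parameter \<open>l = t / (8 (p + t))\<close> yields the exponent \<open>t\<^sup>2 / (16 (p + t))\<close>, which covers the
  Gaussian range \<open>t \<le> p\<close> and the exponential range \<open>t \<ge> p\<close> of the chi-square distribution at once.\<close>

lemma sq_sum_tail:
  fixes t :: real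
  assumes K: "\<And>k. k \<in> L \<Longrightarrow> K k \<subseteq> I" "disjoint_family_on K L" and L: "finite L"
    and V: "\<And>k. k \<in> L \<Longrightarrow> (\<Sum>i\<in>K k. (x i)\<^sup>2) = V" "V > 0" and t: "t > 0"
  shows "prob {\<omega> \<in> space M. t \<le> \<bar>(\<Sum>k\<in>L. (lin x (K k) \<omega>)\<^sup>2) / V - card L\<bar>} \<le> 2 * exp (- (t\<^sup>2 / (16 * (card L + t))))"
proof -
  define p where "p = real (card L)"
  have p: "p \<ge> 0" unfolding p_def by simp
  define l where "l = t / (8 * (p + t))"
  have l: "l > 0" "l \<le> 1 / 4" using t p unfolding l_def by (auto simp: divide_simps)
  define Z where "Z = (\<lambda>\<omega>. (\<Sum>k\<in>L. (lin x (K k) \<omega>)\<^sup>2) / V - card L)"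
  have [measurable]: "lin x (K k) \<in> borel_measurable M" if "k \<in> L" for k by (rule measurable_lin[OF K(1)[OF that]])
  have [measurable]: "Z \<in> borel_measurable M" unfolding Z_def by measurable
  have one: "prob {\<omega> \<in> space M. l * t \<le> c * l * Z \<omega>} \<le> exp (- (t\<^sup>2 / (16 * (p + t))))" if c: "c = 1 \<or> c = -1" for c
  proof -
    have "prob {\<omega> \<in> space M. l * t \<le> c * l * Z \<omega>} \<le> exp (- (l * t)) * exp (4 * (c * l)\<^sup>2 * p)"
      unfolding Z_def p_def
      by (rule chernoff_bound[OF _ sq_sum_mgf[OF K L V]]) (use l c in auto)
    also have "(c * l)\<^sup>2 = l\<^sup>2" using c by auto
    also have "exp (- (l * t)) * exp (4 * l\<^sup>2 * p) = exp (- (l * t) + 4 * l\<^sup>2 * p)" by (rule exp_add[symmetric])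
    also have "\<dots> \<le> exp (- (t\<^sup>2 / (16 * (p + t))))"
    proof -
      have "4 * l\<^sup>2 * p \<le> 4 * l\<^sup>2 * (p + t)" using t by (intro mult_left_mono) auto
      also have "\<dots> = l * (l * (8 * (p + t))) / 2" by (simp add: power2_eq_square)
      also have "l * (8 * (p + t)) = t" using p t unfolding l_def by simp
      finally have "- (l * t) + 4 * l\<^sup>2 * p \<le> - (l * t / 2)" by simp
      also have "l * t / 2 = t\<^sup>2 / (16 * (p + t))" unfolding l_def by (simp add: power2_eq_square)
      finally show ?thesis by simp
    qed
    finally show ?thesis .
  qed
  have "prob {\<omega> \<in> space M. t \<le> \<bar>Z \<omega>\<bar>}
      \<le> prob ({\<omega> \<in> space M. l * t \<le> 1 * l * Z \<omega>} \<union> {\<omega> \<in> space M. l * t \<le> (-1) * l * Z \<omega>})"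
  proof (intro finite_measure_mono)
    show "{\<omega> \<in> space M. t \<le> \<bar>Z \<omega>\<bar>} \<subseteq> {\<omega> \<in> space M. l * t \<le> 1 * l * Z \<omega>} \<union> {\<omega> \<in> space M. l * t \<le> (-1) * l * Z \<omega>}"
    proof safe
      fix \<omega> assume a: "t \<le> \<bar>Z \<omega>\<bar>" "\<omega> \<in> space M" "\<not> l * t \<le> - 1 * l * Z \<omega>"
      have "\<not> t \<le> - Z \<omega>" using a(3) mult_left_mono[of t "- Z \<omega>" l] l by auto
      then have "t \<le> Z \<omega>" using a(1) by linarith
      then show "l * t \<le> 1 * l * Z \<omega>" using l by simp
    qed
  qed auto
  also have "\<dots> \<le> prob {\<omega> \<in> space M. l * t \<le> 1 * l * Z \<omega>} + prob {\<omega> \<in> space M. l * t \<le> (-1) * l * Z \<omega>}"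
    by (rule measure_Un_le) auto
  also have "\<dots> \<le> 2 * exp (- (t\<^sup>2 / (16 * (p + t))))" using one[of 1] one[of "-1"] by simp
  finally show ?thesis unfolding Z_def p_def .
qed

end

text \<open>Integrate over \<open>U\<close> first: for fixed \<open>W\<close> the exponent is linear in \<open>U\<close>, and what remains is quadratic in
  \<open>W\<close>.\<close>

lemma (in prob_space) product_mgf:
  assumes ind: "indep_var borel W borel U"
    and U: "distributed M lborel U std_normal_density" and W: "distributed M lborel W (normal_density 0 s)"
    and s: "s > 0" and ls: "l\<^sup>2 * s\<^sup>2 < 1"
  shows "(\<integral>\<^sup>+\<omega>. ennreal (exp (- l * ((b + U \<omega>) * (b + W \<omega>)))) \<partial>M) =
    ennreal (exp (- l * b\<^sup>2 + l\<^sup>2 * b\<^sup>2 / 2) * (inverse (sqrt (1 - l\<^sup>2 * s\<^sup>2))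
       * exp (((l\<^sup>2 - l) * b)\<^sup>2 * s\<^sup>2 / (2 * (1 - l\<^sup>2 * s\<^sup>2)))))"
proof -
  have rv[measurable]: "random_variable borel W" "random_variable borel U"
    using ind indep_var_rv1 indep_var_rv2 by blast+
  interpret U: prob_space "distr M borel U" by (rule prob_space_distr) simp
  have "(\<integral>\<^sup>+\<omega>. ennreal (exp (- l * ((b + U \<omega>) * (b + W \<omega>)))) \<partial>M)
     = (\<integral>\<^sup>+z. ennreal (exp (- l * ((b + snd z) * (b + fst z)))) \<partial>distr M (borel \<Otimes>\<^sub>M borel) (\<lambda>\<omega>. (W \<omega>, U \<omega>)))"
    by (subst nn_integral_distr) auto
  also have "distr M (borel \<Otimes>\<^sub>M borel) (\<lambda>\<omega>. (W \<omega>, U \<omega>)) = distr M borel W \<Otimes>\<^sub>M distr M borel U"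
    using ind unfolding indep_var_distribution_eq by simp
  also have "(\<integral>\<^sup>+z. ennreal (exp (- l * ((b + snd z) * (b + fst z)))) \<partial>(distr M borel W \<Otimes>\<^sub>M distr M borel U))
     = (\<integral>\<^sup>+w. \<integral>\<^sup>+u. ennreal (exp (- l * ((b + u) * (b + w)))) \<partial>distr M borel U \<partial>distr M borel W)"
    by (subst U.nn_integral_fst[symmetric]) auto
  also have "\<dots> = (\<integral>\<^sup>+w. ennreal (exp (- l * b\<^sup>2 + l\<^sup>2 * b\<^sup>2 / 2) * exp (l\<^sup>2 / 2 * w\<^sup>2 + (l\<^sup>2 - l) * b * w)) \<partial>distr M borel W)"
  proof (intro nn_integral_cong)
    fix w
    have "(\<integral>\<^sup>+u. ennreal (exp (- l * ((b + u) * (b + w)))) \<partial>distr M borel U)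
       = (\<integral>\<^sup>+\<omega>. ennreal (exp (- l * ((b + U \<omega>) * (b + w)))) \<partial>M)" by (subst nn_integral_distr) auto
    also have "\<dots> = (\<integral>\<^sup>+\<omega>. ennreal (exp (- l * (b * (b + w)))) * ennreal (exp (0 * (U \<omega>)\<^sup>2 + (- l * (b + w)) * U \<omega>)) \<partial>M)"
      by (intro nn_integral_cong) (simp add: ennreal_mult'[symmetric] exp_add[symmetric] algebra_simps)
    also have "\<dots> = ennreal (exp (- l * (b * (b + w)))) * ennreal (exp ((l * (b + w))\<^sup>2 / 2))"
      by (subst nn_integral_cmult, measurable, subst gaussian_mgf[OF U]) auto
    also have "\<dots> = ennreal (exp (- l * b\<^sup>2 + l\<^sup>2 * b\<^sup>2 / 2) * exp (l\<^sup>2 / 2 * w\<^sup>2 + (l\<^sup>2 - l) * b * w))"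
      by (simp add: ennreal_mult'[symmetric] exp_add[symmetric] power2_eq_square) (simp add: field_simps)
    finally show "(\<integral>\<^sup>+u. ennreal (exp (- l * ((b + u) * (b + w)))) \<partial>distr M borel U)
      = ennreal (exp (- l * b\<^sup>2 + l\<^sup>2 * b\<^sup>2 / 2) * exp (l\<^sup>2 / 2 * w\<^sup>2 + (l\<^sup>2 - l) * b * w))" .
  qed
  also have "\<dots> = (\<integral>\<^sup>+\<omega>. ennreal (exp (- l * b\<^sup>2 + l\<^sup>2 * b\<^sup>2 / 2)) * ennreal (exp (l\<^sup>2 / 2 * (W \<omega>)\<^sup>2 + (l\<^sup>2 - l) * b * W \<omega>)) \<partial>M)"
    by (subst nn_integral_distr) (auto simp: ennreal_mult')
  also have "\<dots> = ennreal (exp (- l * b\<^sup>2 + l\<^sup>2 * b\<^sup>2 / 2)) * ennreal (inverse (sqrt (1 - l\<^sup>2 * s\<^sup>2))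
       * exp (((l\<^sup>2 - l) * b)\<^sup>2 * s\<^sup>2 / (2 * (1 - l\<^sup>2 * s\<^sup>2))))"
    by (subst nn_integral_cmult, measurable, subst gaussian_mgf[OF W s]) (use ls in auto)
  finally show ?thesis by (simp add: ennreal_mult')
qed

text \<open>For small \<open>v\<close> the right-hand side is what one gets by treating \<open>U\<close> and \<open>W\<close> as contributing the variance
  \<open>b\<^sup>2 + v\<close> to the product; the corrections are of relative order \<open>v\<close>, which will be \<open>1 / (n - 1)\<close>.\<close>

lemma product_mgf_factor_le:
  fixes l v b :: real
  assumes l: "0 \<le> l" "l \<le> 1" and v: "0 < v" "v \<le> 1 / 2"
  shows "exp (- l * b\<^sup>2 + l\<^sup>2 * b\<^sup>2 / 2) * (inverse (sqrt (1 - l\<^sup>2 * v))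
       * exp (((l\<^sup>2 - l) * b)\<^sup>2 * v / (2 * (1 - l\<^sup>2 * v))))
    \<le> exp (- l * b\<^sup>2 + l\<^sup>2 / 2 * (1 + 2 * v) * (b\<^sup>2 + v))"
proof -
  have l2: "0 \<le> l\<^sup>2" "l\<^sup>2 \<le> 1" using l by (auto simp: power_le_one)
  have lv: "0 \<le> l\<^sup>2 * v" "l\<^sup>2 * v \<le> 1 / 2"
    using l2(1) v mult_right_mono[OF l2(2), of v] by (simp, linarith)
  have "0 \<le> l\<^sup>2 * v * v" using v by simp
  from mult_right_mono[OF l2(2) this] have "(l\<^sup>2 * v)\<^sup>2 \<le> l\<^sup>2 * v * v"
    unfolding power2_eq_square[of "l\<^sup>2 * v"] by (simp only: mult_ac mult_1_left)
  then have "inverse (sqrt (1 - l\<^sup>2 * v)) \<le> exp (l\<^sup>2 * v / 2 + l\<^sup>2 * v * v)"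
    using inverse_sqrt_le_exp[of "l\<^sup>2 * v"] lv by (auto elim!: order_trans)
  moreover have "((l\<^sup>2 - l) * b)\<^sup>2 * v / (2 * (1 - l\<^sup>2 * v)) \<le> l\<^sup>2 * b\<^sup>2 * v"
  proof -
    have "(1 - l)\<^sup>2 \<le> 1" using l by (simp add: power_le_one)
    moreover have "((l\<^sup>2 - l) * b)\<^sup>2 = (1 - l)\<^sup>2 * (l\<^sup>2 * b\<^sup>2)"
      by (simp add: power2_eq_square algebra_simps)
    ultimately have "((l\<^sup>2 - l) * b)\<^sup>2 \<le> l\<^sup>2 * b\<^sup>2"
      using mult_right_mono[of "(1 - l)\<^sup>2" 1 "l\<^sup>2 * b\<^sup>2"] by simp
    then have "((l\<^sup>2 - l) * b)\<^sup>2 * v \<le> l\<^sup>2 * b\<^sup>2 * v * 1" using v by (simp add: mult_right_mono)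
    also have "\<dots> \<le> l\<^sup>2 * b\<^sup>2 * v * (2 * (1 - l\<^sup>2 * v))" using lv v l2 by (intro mult_left_mono) auto
    finally show ?thesis using lv by (subst pos_divide_le_eq) auto
  qed
  ultimately have "inverse (sqrt (1 - l\<^sup>2 * v)) * exp (((l\<^sup>2 - l) * b)\<^sup>2 * v / (2 * (1 - l\<^sup>2 * v)))
    \<le> exp (l\<^sup>2 * v / 2 + l\<^sup>2 * v * v) * exp (l\<^sup>2 * b\<^sup>2 * v)"
    using lv by (intro mult_mono) auto
  then have "exp (- l * b\<^sup>2 + l\<^sup>2 * b\<^sup>2 / 2) * (inverse (sqrt (1 - l\<^sup>2 * v)) * exp (((l\<^sup>2 - l) * b)\<^sup>2 * v / (2 * (1 - l\<^sup>2 * v))))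
    \<le> exp (- l * b\<^sup>2 + l\<^sup>2 * b\<^sup>2 / 2) * (exp (l\<^sup>2 * v / 2 + l\<^sup>2 * v * v) * exp (l\<^sup>2 * b\<^sup>2 * v))"
    by (intro mult_left_mono) auto
  also have "\<dots> = exp (- l * b\<^sup>2 + l\<^sup>2 / 2 * (1 + 2 * v) * (b\<^sup>2 + v))"
    unfolding exp_add[symmetric] by (rule arg_cong[where f = exp]) (simp add: algebra_simps)
  finally show ?thesis .
qed

context gaussian_family begin

lemma indep_lin:
  assumes "K1 \<inter> K2 = {}" "K1 \<subseteq> I" "K2 \<subseteq> I"
  shows "indep_var borel (lin x K1) borel (lin y K2)"
proof -
  have "indep_var borel ((\<lambda>z. \<Sum>i\<in>K1. x i * z i) \<circ> (\<lambda>\<omega>. restrict (\<lambda>i. X i \<omega>) K1))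
    borel ((\<lambda>z. \<Sum>i\<in>K2. y i * z i) \<circ> (\<lambda>\<omega>. restrict (\<lambda>i. X i \<omega>) K2))"
    by (intro indep_var_compose[OF indep_var_restrict[OF indep assms]] measurable_lin_PiM) auto
  then show ?thesis by (simp add: comp_def lin_def[abs_def])
qed

text \<open>This is the estimate that fixes the leading exponent of the risk, so nothing may be lost here beyond
  a factor \<open>1 + O(v)\<close>. It is the Chernoff bound for a sum over rows of independent products.\<close>

lemma product_sum_lower_tail:
  fixes a l v :: real and b :: "_ \<Rightarrow> real"
  assumes K: "\<And>k. k \<in> L \<Longrightarrow> K k \<subseteq> I" "disjoint_family_on K L" and L: "finite L"
    and K12: "\<And>k. k \<in> L \<Longrightarrow> K1 k \<inter> K2 k = {} \<and> K1 k \<subseteq> K k \<and> K2 k \<subseteq> K k"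
    and x: "\<And>k. k \<in> L \<Longrightarrow> (\<Sum>i\<in>K1 k. (x i)\<^sup>2) = 1"
    and y: "\<And>k. k \<in> L \<Longrightarrow> (\<Sum>i\<in>K2 k. (y i)\<^sup>2) = v" and v: "0 < v" "v \<le> 1 / 2"
    and l: "0 < l" "l \<le> 1"
  shows "prob {\<omega> \<in> space M. (\<Sum>k\<in>L. (b k + lin x (K1 k) \<omega>) * (b k + lin y (K2 k) \<omega>)) \<le> a}
    \<le> exp (l * a - l * (\<Sum>k\<in>L. (b k)\<^sup>2) + l\<^sup>2 / 2 * (1 + 2 * v) * ((\<Sum>k\<in>L. (b k)\<^sup>2) + card L * v))"
proof -
  let ?g = "\<lambda>k \<omega>. - l * ((b k + lin x (K1 k) \<omega>) * (b k + lin y (K2 k) \<omega>))"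
  let ?B = "\<lambda>k. exp (- l * (b k)\<^sup>2 + l\<^sup>2 * (b k)\<^sup>2 / 2) * (inverse (sqrt (1 - l\<^sup>2 * v))
       * exp (((l\<^sup>2 - l) * b k)\<^sup>2 * v / (2 * (1 - l\<^sup>2 * v))))"
  have sub: "K1 k \<subseteq> I" "K2 k \<subseteq> I" if "k \<in> L" for k using K(1)[OF that] K12[OF that] by auto
  have [measurable]: "lin x (K1 k) \<in> borel_measurable M" "lin y (K2 k) \<in> borel_measurable M" if "k \<in> L" for k
    using measurable_lin sub[OF that] by auto
  have "l\<^sup>2 \<le> 1" using l by (simp add: power_le_one)
  from mult_right_mono[OF this, of v] have lv: "l\<^sup>2 * v < 1" using v by linarith
  have "(\<integral>\<^sup>+\<omega>. ennreal (exp (\<Sum>k\<in>L. ?g k \<omega>)) \<partial>M) = ennreal (\<Prod>k\<in>L. ?B k)"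
  proof (rule nn_integral_exp_rows[OF K L,
      where f = "\<lambda>k z. - l * ((b k + (\<Sum>i\<in>K1 k. x i * z i)) * (b k + (\<Sum>i\<in>K2 k. y i * z i)))"])
    fix k assume k: "k \<in> L"
    show "(\<lambda>z. - l * ((b k + (\<Sum>i\<in>K1 k. x i * z i)) * (b k + (\<Sum>i\<in>K2 k. y i * z i)))) \<in> borel_measurable (PiM (K k) (\<lambda>_. borel))"
      using K12[OF k] by (intro borel_measurable_times borel_measurable_add borel_measurable_const measurable_lin_PiM) auto
    show "- l * ((b k + (\<Sum>i\<in>K1 k. x i * restrict (\<lambda>i. X i \<omega>) (K k) i))
        * (b k + (\<Sum>i\<in>K2 k. y i * restrict (\<lambda>i. X i \<omega>) (K k) i))) = ?g k \<omega>" for \<omega>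
    proof -
      have "(\<Sum>i\<in>K1 k. x i * restrict (\<lambda>i. X i \<omega>) (K k) i) = lin x (K1 k) \<omega>"
        "(\<Sum>i\<in>K2 k. y i * restrict (\<lambda>i. X i \<omega>) (K k) i) = lin y (K2 k) \<omega>"
        unfolding lin_def using K12[OF k] by (auto intro!: sum.cong simp: subset_iff)
      then show ?thesis by simp
    qed
    have "distributed M lborel (lin x (K1 k)) std_normal_density"
      using lin_normal[OF sub(1)[OF k], of x] x[OF k] by simp
    moreover have "distributed M lborel (lin y (K2 k)) (normal_density 0 (sqrt v))"
      using lin_normal[OF sub(2)[OF k], of y] y[OF k] v by simp
    moreover have "indep_var borel (lin y (K2 k)) borel (lin x (K1 k))"
      using K12[OF k] sub[OF k] by (intro indep_lin) auto
    ultimately show "(\<integral>\<^sup>+\<omega>. ennreal (exp (?g k \<omega>)) \<partial>M) = ennreal (?B k)"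
      using product_mgf[of "lin y (K2 k)" "lin x (K1 k)" "sqrt v" l "b k"] v lv by simp
    show "0 \<le> ?B k" using lv by simp
  qed
  also have "\<dots> \<le> ennreal (\<Prod>k\<in>L. exp (- l * (b k)\<^sup>2 + l\<^sup>2 / 2 * (1 + 2 * v) * ((b k)\<^sup>2 + v)))"
    using product_mgf_factor_le[of l v] l v lv by (intro ennreal_leI prod_mono) auto
  also have "(\<Prod>k\<in>L. exp (- l * (b k)\<^sup>2 + l\<^sup>2 / 2 * (1 + 2 * v) * ((b k)\<^sup>2 + v)))
      = exp (- l * (\<Sum>k\<in>L. (b k)\<^sup>2) + l\<^sup>2 / 2 * (1 + 2 * v) * ((\<Sum>k\<in>L. (b k)\<^sup>2) + card L * v))"
    unfolding exp_sum[OF L, symmetric] by (simp only: sum.distrib sum_distrib_left[symmetric] sum_constant)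
  finally have "prob {\<omega> \<in> space M. - l * a \<le> (\<Sum>k\<in>L. ?g k \<omega>)}
      \<le> exp (- (- l * a)) * exp (- l * (\<Sum>k\<in>L. (b k)\<^sup>2) + l\<^sup>2 / 2 * (1 + 2 * v) * ((\<Sum>k\<in>L. (b k)\<^sup>2) + card L * v))"
    by (intro chernoff_bound) auto
  also have "\<dots> = exp (l * a - l * (\<Sum>k\<in>L. (b k)\<^sup>2) + l\<^sup>2 / 2 * (1 + 2 * v) * ((\<Sum>k\<in>L. (b k)\<^sup>2) + card L * v))"
    unfolding exp_add[symmetric] by (rule arg_cong[where f = exp]) simp
  also have "{\<omega> \<in> space M. - l * a \<le> (\<Sum>k\<in>L. ?g k \<omega>)}
      = {\<omega> \<in> space M. (\<Sum>k\<in>L. (b k + lin x (K1 k) \<omega>) * (b k + lin y (K2 k) \<omega>)) \<le> a}"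
    using l by (auto simp: sum_distrib_left[symmetric] sum_negf)
  finally show ?thesis .
qed

end

section \<open>The noise event\<close>

lemma noise_gaussian_family:
  assumes "p > 0" "n > 0"
  shows "gaussian_family (noise p n) ({..<p} \<times> {..<n}) (\<lambda>i \<omega>. \<omega> i)"
proof -
  let ?I = "{..<p} \<times> {..<n}" and ?Z = "std_normal_distribution"
  have Z: "prob_space ?Z" by (rule prob_space_normal_density) simp
  interpret prob_space "noise p n" unfolding noise_def by (rule prob_space_PiM) (rule Z)
  have comp: "distr (noise p n) borel (\<lambda>\<omega>. \<omega> i) = ?Z" if "i \<in> ?I" for i
  proof -
    have "distr (noise p n) borel (\<lambda>\<omega>. \<omega> i) = distr (noise p n) ?Z (\<lambda>\<omega>. \<omega> i)"
      by (rule distr_cong) auto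
    then show ?thesis unfolding noise_def using distr_PiM_component[of ?I "\<lambda>_. ?Z" i] Z that by simp
  qed
  have rv: "random_variable borel (\<lambda>\<omega>. \<omega> i)" if "i \<in> ?I" for i
  proof -
    have "(\<lambda>\<omega>. \<omega> i) \<in> measurable (noise p n) ?Z"
      unfolding noise_def by (rule measurable_component_singleton[OF that])
    then show ?thesis by simp
  qed
  show ?thesis
  proof unfold_locales
    show "indep_vars (\<lambda>_. borel) (\<lambda>i \<omega>. \<omega> i) ?I"
    proof (subst indep_vars_iff_distr_eq_PiM')
      have "distr (noise p n) (Pi\<^sub>M ?I (\<lambda>_. borel)) (\<lambda>x. \<lambda>i\<in>?I. x i) = distr (noise p n) (noise p n) (\<lambda>x. x)"
      proof (rule distr_cong)
        show "sets (Pi\<^sub>M ?I (\<lambda>_. borel)) = sets (noise p n)" unfolding noise_def by (rule sets_PiM_cong) auto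
      qed (auto simp: noise_def space_PiM PiE_def extensional_restrict)
      also have "\<dots> = noise p n" by (rule distr_id)
      also have "\<dots> = (\<Pi>\<^sub>M i\<in>?I. distr (noise p n) borel (\<lambda>\<omega>. \<omega> i))"
        unfolding noise_def by (rule PiM_cong) (use comp in \<open>auto simp: noise_def\<close>)
      finally show "distr (noise p n) (Pi\<^sub>M ?I (\<lambda>_. borel)) (\<lambda>x. \<lambda>i\<in>?I. x i)
        = (\<Pi>\<^sub>M i\<in>?I. distr (noise p n) borel (\<lambda>\<omega>. \<omega> i))" .
    qed (use assms rv in auto)
    show "distributed (noise p n) lborel (\<lambda>\<omega>. \<omega> i) std_normal_density" if "i \<in> ?I" for i
    proof -
      have "distr (noise p n) lborel (\<lambda>\<omega>. \<omega> i) = distr (noise p n) borel (\<lambda>\<omega>. \<omega> i)"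
        by (rule distr_cong) auto
      then show ?thesis unfolding distributed_def using comp[OF that] rv[OF that] by auto
    qed
  qed auto
qed

text \<open>Only finitely many constraints on the noise are imposed, one pair for each grid point, so that the
  event is measurable and a union bound applies. They control the sample covariance of the noise and
  its component along \<open>b\<close> in all directions by the net lemmas.\<close>

definition good_noise :: "nat \<Rightarrow> nat \<Rightarrow> (nat \<Rightarrow> real) \<Rightarrow> real \<Rightarrow> real \<Rightarrow> (nat \<times> nat \<Rightarrow> real) \<Rightarrow> bool" where
  "good_noise p n b t s \<omega> \<longleftrightarrow> (\<forall>z\<in>grid n.
     \<bar>(\<Sum>k<p. (\<Sum>j<n. of_int (z j) * \<omega> (k, j))\<^sup>2) - p * sqnorm n (\<lambda>j. of_int (z j))\<bar> \<le> t * sqnorm n (\<lambda>j. of_int (z j)) \<and>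
     (\<Sum>j<n. (\<Sum>k<p. b k * \<omega> (k, j)) * of_int (z j)) \<le> s * sqrt (sqnorm p b) * sqrt (sqnorm n (\<lambda>j. of_int (z j))))"

lemma noise_measurable_coord:
  "k < p \<Longrightarrow> j < n \<Longrightarrow> (\<lambda>\<omega>. \<omega> (k, j)) \<in> borel_measurable (noise p n)"
proof -
  assume "k < p" "j < n"
  then have "(\<lambda>\<omega>. \<omega> (k, j)) \<in> measurable (noise p n) std_normal_distribution"
    unfolding noise_def by (intro measurable_component_singleton) auto
  then show ?thesis by simp
qed

lemma good_noise_prob:
  fixes t s :: real
  assumes p: "p > 0" and n: "n > 0" and b: "sqnorm p b > 0" and t: "t > 0" and s: "s \<ge> 0"
  shows "{\<omega> \<in> space (noise p n). \<not> good_noise p n b t s \<omega>} \<in> sets (noise p n)" (is ?meas)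
    "measure (noise p n) {\<omega> \<in> space (noise p n). \<not> good_noise p n b t s \<omega>}
      \<le> card (grid n) * (2 * exp (- (t\<^sup>2 / (16 * (p + t)))) + exp (- (s\<^sup>2 / 2)))"
proof -
  interpret gaussian_family "noise p n" "{..<p} \<times> {..<n}" "\<lambda>i \<omega>. \<omega> i"
    by (rule noise_gaussian_family[OF p n])
  note [measurable] = noise_measurable_coord
  let ?M = "noise p n"
  define V where "V = (\<lambda>z :: nat \<Rightarrow> int. sqnorm n (\<lambda>j. of_int (z j)))"
  define E1 where "E1 = (\<lambda>z :: nat \<Rightarrow> int. {\<omega> \<in> space ?M. t * V z < \<bar>(\<Sum>k<p. (\<Sum>j<n. of_int (z j) * \<omega> (k, j))\<^sup>2) - p * V z\<bar>})"
  define E2 where "E2 = (\<lambda>z :: nat \<Rightarrow> int. {\<omega> \<in> space ?M. s * sqrt (sqnorm p b) * sqrt (V z) < (\<Sum>j<n. (\<Sum>k<p. b k * \<omega> (k, j)) * of_int (z j))})"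
  have [measurable]: "E1 z \<in> sets ?M" "E2 z \<in> sets ?M" for z
    unfolding E1_def E2_def by (measurable; simp)+
  have bad: "{\<omega> \<in> space ?M. \<not> good_noise p n b t s \<omega>} = (\<Union>z\<in>grid n. E1 z \<union> E2 z)"
    unfolding good_noise_def E1_def E2_def V_def by (auto simp: not_le)
  show ?meas unfolding bad using finite_grid by (intro sets.finite_UN) auto
  have e1: "prob (E1 z) \<le> 2 * exp (- (t\<^sup>2 / (16 * (p + t))))" for z
  proof (cases "V z = 0")
    case True
    then have "z j = 0" if "j < n" for j using sqnorm_eq_0D[OF _ that, of "\<lambda>j. of_int (z j)"] unfolding V_def by simp
    then have "E1 z = {}" unfolding E1_def True by auto
    then show ?thesis by simp
  next
    case False
    then have V: "V z > 0" unfolding V_def by (rule sqnorm_pos)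
    let ?x = "\<lambda>(k, j). real_of_int (z j)"
    have lin: "lin ?x ({k} \<times> {..<n}) \<omega> = (\<Sum>j<n. of_int (z j) * \<omega> (k, j))" for k \<omega>
      unfolding lin_def sum.cartesian_product' by simp
    have "prob (E1 z) \<le> prob {\<omega> \<in> space ?M. t \<le> \<bar>(\<Sum>k<p. (lin ?x ({k} \<times> {..<n}) \<omega>)\<^sup>2) / V z - card {..<p}\<bar>}"
    proof (rule finite_measure_mono)
      show "E1 z \<subseteq> {\<omega> \<in> space ?M. t \<le> \<bar>(\<Sum>k<p. (lin ?x ({k} \<times> {..<n}) \<omega>)\<^sup>2) / V z - card {..<p}\<bar>}"
      proof (clarsimp simp: E1_def lin)
        fix \<omega> assume a: "t * V z < \<bar>(\<Sum>k<p. (\<Sum>j<n. of_int (z j) * \<omega> (k, j))\<^sup>2) - p * V z\<bar>"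
        have "(\<Sum>k<p. (\<Sum>j<n. of_int (z j) * \<omega> (k, j))\<^sup>2) - p * V z
          = ((\<Sum>k<p. (\<Sum>j<n. of_int (z j) * \<omega> (k, j))\<^sup>2) / V z - p) * V z"
          using V by (simp add: left_diff_distrib)
        then have "t * V z < \<bar>(\<Sum>k<p. (\<Sum>j<n. of_int (z j) * \<omega> (k, j))\<^sup>2) / V z - p\<bar> * V z"
          using a V by (simp add: abs_mult)
        then show "t \<le> \<bar>(\<Sum>k<p. (\<Sum>j<n. of_int (z j) * \<omega> (k, j))\<^sup>2) / V z - p\<bar>" using V by simp
      qed
      show "{\<omega> \<in> space ?M. t \<le> \<bar>(\<Sum>k<p. (lin ?x ({k} \<times> {..<n}) \<omega>)\<^sup>2) / V z - card {..<p}\<bar>} \<in> events"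
        unfolding lin by measurable
    qed
    also have "\<dots> \<le> 2 * exp (- (t\<^sup>2 / (16 * (card {..<p} + t))))"
    proof (rule sq_sum_tail[OF _ _ _ _ V t])
      show "(\<Sum>i\<in>{k} \<times> {..<n}. (?x i)\<^sup>2) = V z" for k
        unfolding V_def sqnorm_def sum.cartesian_product' by simp
    qed (auto simp: disjoint_family_on_def)
    finally show ?thesis by simp
  qed
  have e2: "prob (E2 z) \<le> exp (- (s\<^sup>2 / 2))" for z
  proof (cases "V z = 0")
    case True
    then have "z j = 0" if "j < n" for j using sqnorm_eq_0D[OF _ that, of "\<lambda>j. of_int (z j)"] unfolding V_def by simp
    then have "E2 z = {}" unfolding E2_def True by auto
    then show ?thesis by simp
  next
    case False
    then have V: "V z > 0" unfolding V_def by (rule sqnorm_pos)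
    let ?x = "\<lambda>(k, j). b k * real_of_int (z j)" and ?K = "{..<p} \<times> {..<n}"
    have lin: "lin ?x ?K \<omega> = (\<Sum>j<n. (\<Sum>k<p. b k * \<omega> (k, j)) * of_int (z j))" for \<omega>
    proof -
      have "lin ?x ?K \<omega> = (\<Sum>k<p. \<Sum>j<n. b k * of_int (z j) * \<omega> (k, j))"
        unfolding lin_def sum.cartesian_product by (intro sum.cong) auto
      also have "\<dots> = (\<Sum>j<n. (\<Sum>k<p. b k * \<omega> (k, j)) * of_int (z j))"
        by (subst sum.swap) (simp add: sum_distrib_left mult_ac)
      finally show ?thesis .
    qed
    have sq: "(\<Sum>i\<in>?K. (?x i)\<^sup>2) = sqnorm p b * V z"
    proof -
      have "(\<Sum>i\<in>?K. (?x i)\<^sup>2) = (\<Sum>k<p. \<Sum>j<n. (b k)\<^sup>2 * (of_int (z j))\<^sup>2)"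
        unfolding sum.cartesian_product by (intro sum.cong) (auto simp: power_mult_distrib)
      then show ?thesis unfolding sqnorm_def V_def sum_product .
    qed
    have "prob (E2 z) \<le> prob {\<omega> \<in> space ?M. (\<Sum>i\<in>?K. (?x i)\<^sup>2) > 0 \<and> s * sqrt (\<Sum>i\<in>?K. (?x i)\<^sup>2) \<le> lin ?x ?K \<omega>}"
    proof (rule finite_measure_mono)
      show "E2 z \<subseteq> {\<omega> \<in> space ?M. (\<Sum>i\<in>?K. (?x i)\<^sup>2) > 0 \<and> s * sqrt (\<Sum>i\<in>?K. (?x i)\<^sup>2) \<le> lin ?x ?K \<omega>}"
        unfolding sq lin E2_def using V b by (auto simp: real_sqrt_mult)
      show "{\<omega> \<in> space ?M. (\<Sum>i\<in>?K. (?x i)\<^sup>2) > 0 \<and> s * sqrt (\<Sum>i\<in>?K. (?x i)\<^sup>2) \<le> lin ?x ?K \<omega>} \<in> events"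
        unfolding sq lin by measurable
    qed
    also have "\<dots> \<le> exp (- (s\<^sup>2 / 2))" by (rule lin_upper_tail[OF _ s]) simp
    finally show ?thesis .
  qed
  have "prob (\<Union>z\<in>grid n. E1 z \<union> E2 z) \<le> (\<Sum>z\<in>grid n. prob (E1 z \<union> E2 z))"
    by (rule measure_UNION_le[OF finite_grid]) auto
  also have "\<dots> \<le> (\<Sum>z\<in>grid n. 2 * exp (- (t\<^sup>2 / (16 * (p + t)))) + exp (- (s\<^sup>2 / 2)))"
  proof (rule sum_mono)
    fix z
    have "prob (E1 z \<union> E2 z) \<le> prob (E1 z) + prob (E2 z)" by (rule measure_Un_le) auto
    then show "prob (E1 z \<union> E2 z) \<le> 2 * exp (- (t\<^sup>2 / (16 * (p + t)))) + exp (- (s\<^sup>2 / 2))"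
      using e1[of z] e2[of z] by linarith
  qed
  finally show "prob {\<omega> \<in> space ?M. \<not> good_noise p n b t s \<omega>}
      \<le> card (grid n) * (2 * exp (- (t\<^sup>2 / (16 * (p + t)))) + exp (- (s\<^sup>2 / 2)))"
    unfolding bad by simp
qed

lemma hollow_gram_carrier: "hollow_gram (observation p n \<sigma> \<theta> \<eta> \<omega>) \<in> carrier_mat n n"
  unfolding hollow_gram_def off_diag_def observation_def by (auto simp: mat_diag_def)

lemma hollow_gram_nth:
  assumes "i < n" "j < n"
  shows "hollow_gram (observation p n \<sigma> \<theta> \<eta> \<omega>) $$ (i, j) =
    (if i = j then 0 else \<Sum>k<p. (\<theta> $ k * \<eta> $ i + \<sigma> * \<omega> (k, i)) * (\<theta> $ k * \<eta> $ j + \<sigma> * \<omega> (k, j)))"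
  using assms unfolding hollow_gram_def off_diag_def observation_def
  by (auto simp: mat_diag_def scalar_prod_def atLeast0LessThan)

lemma hollow_gram_symm: "symmetric_on n (\<lambda>i j. hollow_gram (observation p n \<sigma> \<theta> \<eta> \<omega>) $$ (i, j))"
  unfolding symmetric_on_def by (auto simp: hollow_gram_nth mult.commute)

lemma sum_mult_le_norm:
  assumes "sqrt (sqnorm n a) \<le> A"
  shows "\<bar>\<Sum>i<n. a i * x i\<bar> \<le> A * sqrt (sqnorm n x)"
proof -
  have "\<bar>\<Sum>i<n. a i * x i\<bar> \<le> sqrt (sqnorm n a * sqnorm n x)"
    using Cauchy_Schwarz_ineq_sum[of a x "{..<n}"] unfolding sqnorm_def by (intro real_le_rsqrt) simp
  also have "\<dots> = sqrt (sqnorm n a) * sqrt (sqnorm n x)" by (rule real_sqrt_mult)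
  also have "\<dots> \<le> A * sqrt (sqnorm n x)" by (intro mult_right_mono assms) simp
  finally show ?thesis .
qed

text \<open>For \<open>i \<noteq> j\<close> the entries of the remainder are \<open>\<sigma>\<^sup>2 (\<eta> i a j + \<eta> j a i + S i j)\<close>, where \<open>a\<close> is the noise
  along \<open>b\<close> and \<open>S\<close> the centred Gram matrix of the noise; deleting the diagonal adds a diagonal
  matrix whose entries are bounded by the same quantities and by \<open>T\<close>.\<close>

lemma good_noise_bounds_form:
  fixes \<sigma> t s :: real and \<theta> \<eta> :: "real Matrix.vec"
  defines "b \<equiv> \<lambda>k. \<theta> $ k / \<sigma>"
  assumes g: "good_noise p n b t s \<omega>" and t: "t \<ge> 0" and s: "s \<ge> 0" and n: "n > 0" and \<sigma>: "\<sigma> > 0"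
    and \<eta>: "is_label n (\<lambda>i. \<eta> $ i)"
  defines "T \<equiv> sqnorm p (\<lambda>k. \<theta> $ k)"
  shows "\<bar>bilin n (\<lambda>i j. hollow_gram (observation p n \<sigma> \<theta> \<eta> \<omega>) $$ (i, j) - T * \<eta> $ i * \<eta> $ j) x x\<bar>
    \<le> (\<sigma>\<^sup>2 * (8 * sqrt n * s * sqrt (sqnorm p b) + 6 * t) + T) * sqnorm n x"
proof -
  define S where "S = (\<lambda>j l. (\<Sum>k<p. \<omega> (k, j) * \<omega> (k, l)) - (if j = l then real p else 0))"
  define a where "a = (\<lambda>j. \<Sum>k<p. b k * \<omega> (k, j))"
  define A where "A = 2 * (s * sqrt (sqnorm p b))"
  have A0: "A \<ge> 0" unfolding A_def using s by simp
  have sS: "symmetric_on n S" unfolding symmetric_on_def S_def by (auto simp: mult.commute)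
  have bS: "bilin n S y y = (\<Sum>k<p. (\<Sum>j<n. y j * \<omega> (k, j))\<^sup>2) - p * sqnorm n y" for y
  proof -
    have "(\<Sum>k<p. (\<Sum>j<n. y j * \<omega> (k, j))\<^sup>2) = (\<Sum>k<p. \<Sum>i<n. \<Sum>j<n. y i * (\<omega> (k, i) * \<omega> (k, j)) * y j)"
      unfolding power2_eq_square sum_product by (simp add: mult_ac)
    also have "\<dots> = (\<Sum>i<n. \<Sum>j<n. \<Sum>k<p. y i * (\<omega> (k, i) * \<omega> (k, j)) * y j)"
      by (subst sum.swap, rule sum.cong[OF refl], rule sum.swap)
    also have "\<dots> = (\<Sum>i<n. \<Sum>j<n. y i * S i j * y j + (if i = j then p * (y i * y j) else 0))"
      unfolding S_def by (intro sum.cong refl) (auto simp: sum_distrib_left sum_distrib_right algebra_simps)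
    also have "\<dots> = bilin n S y y + p * sqnorm n y"
      by (simp add: bilin_def sqnorm_def sum.distrib power2_eq_square sum_distrib_left)
    finally show ?thesis by simp
  qed
  have qS: "\<bar>bilin n S y y\<bar> \<le> 3 * t * sqnorm n y" for y
    by (rule grid_bounds_quadratic_form[OF sS t]) (use g in \<open>auto simp: good_noise_def bS\<close>)
  have aA: "sqrt (sqnorm n a) \<le> A" unfolding A_def
    by (rule grid_bounds_linear_form[OF _ n]) (use g s in \<open>auto simp: good_noise_def a_def\<close>)
  have diag: "\<bar>S i i\<bar> \<le> 3 * t" "\<bar>a i\<bar> \<le> A" if i: "i < n" for i
  proof -
    let ?e = "\<lambda>j. if j = i then 1 else 0 :: real"
    have ne: "sqnorm n ?e = 1"
    proof -
      have "sqnorm n ?e = (\<Sum>j<n. if j = i then 1 else 0)" unfolding sqnorm_def by (intro sum.cong) auto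
      then show ?thesis using i by simp
    qed
    have "bilin n S ?e ?e = (\<Sum>k<n. \<Sum>j<n. if j = i then (if k = i then S k j else 0) else 0)"
      unfolding bilin_def by (intro sum.cong) auto
    then have "bilin n S ?e ?e = S i i" using i by simp
    then show "\<bar>S i i\<bar> \<le> 3 * t" using qS[of ?e] ne by simp
    have "(\<Sum>j<n. a j * ?e j) = (\<Sum>j<n. if j = i then a j else 0)" by (intro sum.cong) auto
    then show "\<bar>a i\<bar> \<le> A" using sum_mult_le_norm[OF aA, of ?e] ne i by simp
  qed
  have \<theta>: "\<theta> $ k = \<sigma> * b k" for k unfolding b_def using \<sigma> by simp
  have e2: "\<eta> $ i * \<eta> $ i = 1" "\<bar>\<eta> $ i\<bar> = 1" if "i < n" for i using \<eta> that unfolding is_label_def by auto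
  define N where "N = (\<lambda>i j. hollow_gram (observation p n \<sigma> \<theta> \<eta> \<omega>) $$ (i, j) - T * \<eta> $ i * \<eta> $ j)"
  define d where "d = (\<lambda>i. \<sigma>\<^sup>2 * (2 * (\<eta> $ i * a i) + S i i) + T)"
  have gram: "(\<Sum>k<p. (\<theta> $ k * \<eta> $ i + \<sigma> * \<omega> (k, i)) * (\<theta> $ k * \<eta> $ j + \<sigma> * \<omega> (k, j)))
      = T * \<eta> $ i * \<eta> $ j + \<sigma>\<^sup>2 * (\<eta> $ i * a j + \<eta> $ j * a i + (\<Sum>k<p. \<omega> (k, i) * \<omega> (k, j)))" for i j
    unfolding a_def T_def sqnorm_def \<theta> sum_distrib_left sum_distrib_right sum.distrib[symmetric]
    by (intro sum.cong refl) (simp add: power2_eq_square algebra_simps)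
  have N: "N i j = \<sigma>\<^sup>2 * (\<eta> $ i * a j + \<eta> $ j * a i + S i j) - (if i = j then d i else 0)"
    if "i < n" "j < n" for i j
    unfolding N_def hollow_gram_nth[OF that] gram
    using e2[OF that(1)] by (auto simp: S_def d_def algebra_simps)
  have bN: "bilin n N x x = \<sigma>\<^sup>2 * (2 * ((\<Sum>i<n. \<eta> $ i * x i) * (\<Sum>j<n. a j * x j)) + bilin n S x x)
      - (\<Sum>i<n. d i * (x i)\<^sup>2)"
  proof -
    have "bilin n N x x = (\<Sum>i<n. \<Sum>j<n. \<sigma>\<^sup>2 * ((\<eta> $ i * x i) * (a j * x j)) + \<sigma>\<^sup>2 * ((a i * x i) * (\<eta> $ j * x j))
        + \<sigma>\<^sup>2 * (x i * S i j * x j) - (if i = j then d i * (x i * x j) else 0))"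
      unfolding bilin_def by (intro sum.cong refl) (auto simp: N algebra_simps)
    also have "\<dots> = \<sigma>\<^sup>2 * ((\<Sum>i<n. \<eta> $ i * x i) * (\<Sum>j<n. a j * x j)) + \<sigma>\<^sup>2 * ((\<Sum>i<n. a i * x i) * (\<Sum>j<n. \<eta> $ j * x j))
        + \<sigma>\<^sup>2 * bilin n S x x - (\<Sum>i<n. d i * (x i)\<^sup>2)"
      unfolding sum_product bilin_def
      by (simp add: sum.distrib sum_subtractf sum_distrib_left power2_eq_square)
    finally show ?thesis by (simp add: algebra_simps)
  qed
  have n1: "\<bar>(\<Sum>i<n. \<eta> $ i * x i) * (\<Sum>j<n. a j * x j)\<bar> \<le> sqrt n * A * sqnorm n x"
  proof -
    have "\<bar>\<Sum>i<n. \<eta> $ i * x i\<bar> \<le> sqrt n * sqrt (sqnorm n x)"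
      by (rule sum_mult_le_norm) (simp add: sqnorm_label[OF \<eta>])
    then have "\<bar>\<Sum>i<n. \<eta> $ i * x i\<bar> * \<bar>\<Sum>j<n. a j * x j\<bar> \<le> (sqrt n * sqrt (sqnorm n x)) * (A * sqrt (sqnorm n x))"
      using sum_mult_le_norm[OF aA, of x] by (intro mult_mono) auto
    also have "\<dots> = sqrt n * A * (sqrt (sqnorm n x) * sqrt (sqnorm n x))" by (simp only: mult_ac)
    finally show ?thesis by (simp add: abs_mult)
  qed
  have T0: "T \<ge> 0" unfolding T_def by simp
  have "\<bar>\<Sum>i<n. d i * (x i)\<^sup>2\<bar> \<le> (\<sigma>\<^sup>2 * (2 * A + 3 * t) + T) * sqnorm n x"
  proof -
    have "\<bar>d i\<bar> \<le> \<sigma>\<^sup>2 * (2 * A + 3 * t) + T" if i: "i < n" for i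
    proof -
      have "\<bar>\<eta> $ i * a i\<bar> \<le> A" using diag(2)[OF i] e2(2)[OF i] by (simp add: abs_mult)
      then have "\<bar>2 * (\<eta> $ i * a i) + S i i\<bar> \<le> 2 * A + 3 * t" using diag(1)[OF i] by linarith
      then have "\<sigma>\<^sup>2 * \<bar>2 * (\<eta> $ i * a i) + S i i\<bar> \<le> \<sigma>\<^sup>2 * (2 * A + 3 * t)" by (intro mult_left_mono) auto
      moreover have "\<sigma>\<^sup>2 * \<bar>2 * (\<eta> $ i * a i) + S i i\<bar> = \<bar>\<sigma>\<^sup>2 * (2 * (\<eta> $ i * a i) + S i i)\<bar>"
        by (simp add: abs_mult)
      ultimately show ?thesis unfolding d_def using T0 by linarith
    qed
    then have "(\<Sum>i<n. \<bar>d i * (x i)\<^sup>2\<bar>) \<le> (\<Sum>i<n. (\<sigma>\<^sup>2 * (2 * A + 3 * t) + T) * (x i)\<^sup>2)"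
      by (intro sum_mono) (simp add: abs_mult mult_right_mono)
    then show ?thesis unfolding sqnorm_def sum_distrib_left by (rule order_trans[OF sum_abs])
  qed
  moreover have "\<bar>\<sigma>\<^sup>2 * (2 * ((\<Sum>i<n. \<eta> $ i * x i) * (\<Sum>j<n. a j * x j)) + bilin n S x x)\<bar>
      \<le> \<sigma>\<^sup>2 * (2 * (sqrt n * A * sqnorm n x) + 3 * t * sqnorm n x)"
    unfolding abs_mult[of "\<sigma>\<^sup>2"] using n1 qS[of x] by (intro mult_mono) auto
  ultimately have "\<bar>bilin n N x x\<bar> \<le> \<sigma>\<^sup>2 * (2 * (sqrt n * A * sqnorm n x) + 3 * t * sqnorm n x)
      + (\<sigma>\<^sup>2 * (2 * A + 3 * t) + T) * sqnorm n x" unfolding bN by linarith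
  also have "\<dots> = (\<sigma>\<^sup>2 * (2 * sqrt n * A + 2 * A + 6 * t) + T) * sqnorm n x" by (simp add: algebra_simps)
  also have "\<dots> \<le> (\<sigma>\<^sup>2 * (4 * sqrt n * A + 6 * t) + T) * sqnorm n x"
  proof (intro mult_right_mono add_right_mono mult_left_mono)
    have "1 * A \<le> sqrt n * A" using n A0 by (intro mult_right_mono) auto
    then show "2 * sqrt n * A + 2 * A \<le> 4 * sqrt n * A" by (simp only: mult.assoc)
  qed auto
  finally show ?thesis unfolding N_def A_def by (simp add: mult.assoc)
qed

section \<open>The expected loss\<close>

text \<open>The margin of coordinate \<open>i\<close> at the truth is \<open>\<sigma>\<^sup>2 m\<close> times the sum over rows \<open>k\<close> of
  \<open>(b k + U k) (b k + W k)\<close>, with \<open>m = n - 1\<close>, \<open>U k\<close> the signed noise of observation \<open>i\<close> and \<open>W k\<close> the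
  average of the signed noise of the others, of variance \<open>1 / m\<close>. The exponent is optimal, up to
  terms of relative order \<open>1 / n\<close>, for \<open>l = B / (B + p / n)\<close>, and then equals \<open>- r2 / 2\<close>.\<close>

lemma thin_prob:
  fixes \<sigma> \<gamma> :: real and \<theta> \<eta> :: "real Matrix.vec"
  assumes p: "p > 0" and n: "n \<ge> 3" and \<sigma>: "\<sigma> > 0" and \<eta>: "is_label n (\<lambda>i. \<eta> $ i)" and i: "i < n" and \<gamma>: "\<gamma> \<ge> 0"
  defines "T \<equiv> sqnorm p (\<lambda>k. \<theta> $ k)"
  assumes T: "T > 0"
  defines "r2 \<equiv> (T / \<sigma>\<^sup>2)\<^sup>2 / (T / \<sigma>\<^sup>2 + p / n)"
  defines "E \<equiv> {\<omega> \<in> space (noise p n). i \<in> thin_set n (\<lambda>i j. hollow_gram (observation p n \<sigma> \<theta> \<eta> \<omega>) $$ (i, j)) (\<lambda>i. \<eta> $ i) (\<gamma> * n * T / 2)}"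
  shows "E \<in> sets (noise p n)"
    "measure (noise p n) E \<le> exp (- (r2 / 2) + 2 * r2 / (real n - 1) + \<gamma> * r2)"
proof -
  have n0: "n > 0" using n by simp
  interpret gaussian_family "noise p n" "{..<p} \<times> {..<n}" "\<lambda>i \<omega>. \<omega> i"
    by (rule noise_gaussian_family[OF p n0])
  define m where "m = real n - 1"
  have m: "m \<ge> 2" using n unfolding m_def by simp
  define b where "b = (\<lambda>k. \<theta> $ k / \<sigma>)"
  define B where "B = (\<Sum>k<p. (b k)\<^sup>2)"
  have \<theta>: "\<theta> $ k = \<sigma> * b k" for k unfolding b_def using \<sigma> by simp
  have BT: "B = T / \<sigma>\<^sup>2" unfolding B_def b_def T_def sqnorm_def by (simp add: power_divide sum_divide_distrib)
  have B: "B > 0" using T \<sigma> unfolding BT by simp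
  have TB: "T = \<sigma>\<^sup>2 * B" using \<sigma> unfolding BT by simp
  define K where "K = (\<lambda>k :: nat. {k} \<times> {..<n})"
  define K1 where "K1 = (\<lambda>k :: nat. {k} \<times> {i})"
  define K2 where "K2 = (\<lambda>k :: nat. {k} \<times> ({..<n} - {i}))"
  define x where "x = (\<lambda>(k :: nat, j). \<eta> $ j)"
  define y where "y = (\<lambda>(k :: nat, j). \<eta> $ j / m)"
  have e2: "\<eta> $ j * \<eta> $ j = 1" if "j < n" for j using \<eta> that unfolding is_label_def by auto
  have card: "real (card ({..<n} - {i})) = m" using i n unfolding m_def by (simp add: of_nat_diff)
  have lx: "lin x (K1 k) \<omega> = \<eta> $ i * \<omega> (k, i)" for k \<omega>
    unfolding lin_def K1_def x_def sum.cartesian_product' by simp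
  have ly: "lin y (K2 k) \<omega> = (\<Sum>j\<in>{..<n} - {i}. \<eta> $ j * \<omega> (k, j)) / m" for k \<omega>
    unfolding lin_def K2_def y_def sum.cartesian_product' by (simp add: sum_divide_distrib)
  let ?Z = "\<lambda>\<omega>. \<Sum>k<p. (b k + lin x (K1 k) \<omega>) * (b k + lin y (K2 k) \<omega>)"
  have matvec: "\<eta> $ i * matvec n (\<lambda>i j. hollow_gram (observation p n \<sigma> \<theta> \<eta> \<omega>) $$ (i, j)) (\<lambda>i. \<eta> $ i) i = \<sigma>\<^sup>2 * m * ?Z \<omega>" for \<omega>
  proof -
    have "matvec n (\<lambda>i j. hollow_gram (observation p n \<sigma> \<theta> \<eta> \<omega>) $$ (i, j)) (\<lambda>i. \<eta> $ i) i
      = (\<Sum>j\<in>{..<n} - {i}. (\<Sum>k<p. (\<theta> $ k * \<eta> $ i + \<sigma> * \<omega> (k, i)) * (\<theta> $ k * \<eta> $ j + \<sigma> * \<omega> (k, j))) * \<eta> $ j)"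
      unfolding matvec_def by (rule sum.mono_neutral_cong_right) (use i in \<open>auto simp: hollow_gram_nth\<close>)
    also have "\<dots> = (\<Sum>k<p. (\<theta> $ k * \<eta> $ i + \<sigma> * \<omega> (k, i)) * (\<Sum>j\<in>{..<n} - {i}. \<theta> $ k * (\<eta> $ j * \<eta> $ j) + \<sigma> * (\<eta> $ j * \<omega> (k, j))))"
      unfolding sum_distrib_left sum_distrib_right
      by (subst sum.swap) (intro sum.cong refl, simp add: algebra_simps)
    also have "\<dots> = (\<Sum>k<p. (\<theta> $ k * \<eta> $ i + \<sigma> * \<omega> (k, i)) * (\<theta> $ k * m + \<sigma> * (m * lin y (K2 k) \<omega>)))"
    proof (intro sum.cong refl arg_cong[where f = "\<lambda>z. _ * z"])
      fix k
      have "(\<Sum>j\<in>{..<n} - {i}. \<theta> $ k * (\<eta> $ j * \<eta> $ j) + \<sigma> * (\<eta> $ j * \<omega> (k, j)))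
          = (\<Sum>j\<in>{..<n} - {i}. \<theta> $ k + \<sigma> * (\<eta> $ j * \<omega> (k, j)))"
        by (intro sum.cong refl) (auto simp: e2)
      also have "\<dots> = m * \<theta> $ k + \<sigma> * (\<Sum>j\<in>{..<n} - {i}. \<eta> $ j * \<omega> (k, j))"
        unfolding sum.distrib sum_distrib_left[symmetric] sum_constant card ..
      finally show "(\<Sum>j\<in>{..<n} - {i}. \<theta> $ k * (\<eta> $ j * \<eta> $ j) + \<sigma> * (\<eta> $ j * \<omega> (k, j)))
          = \<theta> $ k * m + \<sigma> * (m * lin y (K2 k) \<omega>)"
        unfolding ly using m by (simp add: mult.commute)
    qed
    finally have "\<eta> $ i * matvec n (\<lambda>i j. hollow_gram (observation p n \<sigma> \<theta> \<eta> \<omega>) $$ (i, j)) (\<lambda>i. \<eta> $ i) i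
      = (\<Sum>k<p. (\<theta> $ k * (\<eta> $ i * \<eta> $ i) + \<sigma> * (\<eta> $ i * \<omega> (k, i))) * (\<theta> $ k * m + \<sigma> * (m * lin y (K2 k) \<omega>)))"
      by (simp add: sum_distrib_left algebra_simps)
    also have "\<dots> = \<sigma>\<^sup>2 * m * ?Z \<omega>"
      unfolding e2[OF i] \<theta> lx[symmetric] sum_distrib_left
      by (intro sum.cong refl) (simp add: power2_eq_square algebra_simps)
    finally show ?thesis .
  qed
  define a where "a = \<gamma> * n * B / (2 * m)"
  have "\<sigma>\<^sup>2 * m > 0" using \<sigma> m by simp
  then have thin_iff: "i \<in> thin_set n (\<lambda>i j. hollow_gram (observation p n \<sigma> \<theta> \<eta> \<omega>) $$ (i, j)) (\<lambda>i. \<eta> $ i) (\<gamma> * n * T / 2)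
      \<longleftrightarrow> ?Z \<omega> \<le> a" for \<omega>
  proof -
    have "\<gamma> * n * T / 2 = \<sigma>\<^sup>2 * m * a" unfolding a_def TB using m by simp
    then show ?thesis unfolding thin_set_def using i matvec[of \<omega>] mult_le_cancel_left_pos[OF \<open>\<sigma>\<^sup>2 * m > 0\<close>, of "?Z \<omega>" a] by simp
  qed
  have E: "E = {\<omega> \<in> space (noise p n). ?Z \<omega> \<le> a}" unfolding E_def thin_iff ..
  have sub: "K1 k \<subseteq> {..<p} \<times> {..<n}" "K2 k \<subseteq> {..<p} \<times> {..<n}" if "k < p" for k
    using that i unfolding K1_def K2_def by auto
  have [measurable]: "lin x (K1 k) \<in> borel_measurable (noise p n)" "lin y (K2 k) \<in> borel_measurable (noise p n)" if "k < p" for k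
    using measurable_lin sub[OF that] by auto
  show "E \<in> sets (noise p n)" unfolding E by measurable
  define D where "D = B + p / n"
  have D: "D > 0" "B \<le> D" using B unfolding D_def by (auto intro: add_pos_nonneg)
  \<comment> \<open>The minimizer of \<open>- l B + l\<^sup>2 D / 2\<close>, with value \<open>- r2 / 2\<close>.\<close>
  define l where "l = B / D"
  have l: "0 < l" "l \<le> 1" using B D unfolding l_def by auto
  have r2: "l * B = r2" "l\<^sup>2 * D = r2" unfolding r2_def BT[symmetric] D_def[symmetric] l_def
    using D by (auto simp: power2_eq_square)
  have r20: "r2 \<ge> 0" using r2(1) l B by (metis less_imp_le mult_nonneg_nonneg)
  define v where "v = 1 / m"
  have v: "0 < v" "v \<le> 1 / 2" using m unfolding v_def by auto
  have "prob E \<le> exp (l * a - l * B + l\<^sup>2 / 2 * (1 + 2 * v) * (B + card {..<p} * v))"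
    unfolding E B_def
  proof (rule product_sum_lower_tail[where K = K])
    show "(\<Sum>i\<in>K1 k. (x i)\<^sup>2) = 1" for k
      unfolding K1_def x_def sum.cartesian_product' using e2[OF i] by (simp add: power2_eq_square)
    show "(\<Sum>i\<in>K2 k. (y i)\<^sup>2) = v" for k
    proof -
      have "(\<Sum>i\<in>K2 k. (y i)\<^sup>2) = (\<Sum>j\<in>{..<n} - {i}. (\<eta> $ j / m)\<^sup>2)"
        unfolding K2_def y_def sum.cartesian_product' by simp
      also have "\<dots> = (\<Sum>j\<in>{..<n} - {i}. 1 / m\<^sup>2)"
        by (intro sum.cong refl) (auto simp: power_divide power2_eq_square e2)
      also have "\<dots> = v" using card m unfolding v_def by (simp add: power2_eq_square)
      finally show ?thesis .
    qed
  qed (use i v l in \<open>auto simp: K_def K1_def K2_def disjoint_family_on_def\<close>)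
  also have "\<dots> \<le> exp (- (r2 / 2) + 2 * r2 / (real n - 1) + \<gamma> * r2)"
  proof -
    have nm: "real n / m = 1 + v" unfolding v_def m_def using n by (simp add: field_simps)
    have "B + p * v \<le> (1 + v) * D"
    proof -
      have "p * v = p / n * (real n / m)" unfolding v_def using n0 by simp
      then show ?thesis unfolding D_def nm using B v by (simp add: algebra_simps)
    qed
    then have "(1 + 2 * v) * (B + p * v) \<le> (1 + 2 * v) * ((1 + v) * D)"
      using v by (intro mult_left_mono) auto
    also have "\<dots> \<le> (1 + 4 * v) * D"
    proof -
      have "v * v \<le> v * (1 / 2)" using v by (intro mult_left_mono) auto
      then have "(1 + 2 * v) * (1 + v) \<le> 1 + 4 * v" by (simp add: algebra_simps)
      then have "(1 + 2 * v) * (1 + v) * D \<le> (1 + 4 * v) * D" using D by (intro mult_right_mono) auto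
      then show ?thesis by (simp only: mult.assoc)
    qed
    finally have "l\<^sup>2 / 2 * ((1 + 2 * v) * (B + p * v)) \<le> l\<^sup>2 / 2 * ((1 + 4 * v) * D)"
      by (intro mult_left_mono) auto
    also have "\<dots> = (1 + 4 * v) * (l\<^sup>2 * D) / 2" by simp
    finally have 1: "l\<^sup>2 / 2 * (1 + 2 * v) * (B + p * v) \<le> (1 + 4 * v) * r2 / 2" unfolding r2(2) by (simp only: mult.assoc)
    have "l * a = (\<gamma> * r2) * ((1 + v) / 2)" unfolding a_def r2(1)[symmetric] nm[symmetric] by (simp add: mult_ac)
    also have "\<dots> \<le> (\<gamma> * r2) * 1" using v \<gamma> r20 by (intro mult_left_mono) auto
    finally have "l * a \<le> \<gamma> * r2" by simp
    moreover have "2 * r2 / (real n - 1) = 2 * v * r2" unfolding v_def m_def using n by (simp add: of_nat_diff)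
    moreover have "(1 + 4 * v) * r2 / 2 = r2 / 2 + 2 * v * r2" by (simp add: algebra_simps)
    ultimately show ?thesis using 1 unfolding r2(1) exp_le_cancel_iff card_lessThan by linarith
  qed
  finally show "prob E \<le> exp (- (r2 / 2) + 2 * r2 / (real n - 1) + \<gamma> * r2)" .
qed

lemma observation_carrier: "observation p n \<sigma> \<theta> \<eta> \<omega> \<in> carrier_mat p n"
  unfolding observation_def by simp

lemma expected_loss_le_2n:
  assumes p: "p > 0" and n: "n > 0" and \<eta>: "is_label n (\<lambda>i. \<eta> $ i)"
    and sel: "spectral_selector p n vhat" and s0: "s0 \<in> {-1, 1}"
  shows "expect p n \<sigma> \<theta> \<eta> (\<lambda>Y. loss n (iter_est s0 vhat k Y) \<eta>) \<le> 2 * n"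
proof -
  interpret gaussian_family "noise p n" "{..<p} \<times> {..<n}" "\<lambda>i \<omega>. \<omega> i"
    by (rule noise_gaussian_family[OF p n])
  let ?L = "\<lambda>\<omega>. loss n (iter_est s0 vhat k (observation p n \<sigma> \<theta> \<eta> \<omega>)) \<eta>"
  have "?L \<omega> \<le> 2 * real n" for \<omega>
  proof (rule loss_le_2n[OF _ \<eta>], rule iter_est_label(2)[where vhat = vhat, OF hollow_gram_carrier _ s0])
    have "top_eigenvector (hollow_gram (observation p n \<sigma> \<theta> \<eta> \<omega>)) (vhat (observation p n \<sigma> \<theta> \<eta> \<omega>))"
      using sel observation_carrier unfolding spectral_selector_def by blast
    then show "dim_vec (vhat (observation p n \<sigma> \<theta> \<eta> \<omega>)) = n"
      using top_eigenvector_rayleigh(1)[OF hollow_gram_carrier hollow_gram_symm] carrier_vecD by blast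
  qed
  then show ?thesis unfolding expect_def
    by (cases "integrable (noise p n) ?L") (auto intro!: integral_le_const simp: not_integrable_integral_eq)
qed

text \<open>Off the bad noise event the loss is at most \<open>22 / \<gamma>\<close> times the number of thin coordinates, and on it at
  most \<open>2 n\<close>. The thresholds \<open>s\<close> and \<open>t\<close> of the noise event are chosen so that each of the three parts of
  the remainder takes at most \<open>\<gamma> n T / 128\<close> of the admissible \<open>\<gamma> n T / 32\<close>; the constant \<open>10 ^ 7\<close> exceeds
  \<open>16 * 768 ^ 2\<close> and \<open>2 * 1024 ^ 2\<close>, which arise from them in the tail bounds.\<close>

lemma expected_loss_le:
  fixes \<sigma> \<gamma> :: real and \<theta> \<eta> :: "real Matrix.vec"
  assumes p: "p > 0" and n: "n \<ge> 3" and \<sigma>: "\<sigma> > 0" and \<eta>: "is_label n (\<lambda>i. \<eta> $ i)"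
    and sel: "spectral_selector p n vhat" and s0: "s0 \<in> {-1, 1}" and k: "real n < 8 * 4 ^ k"
    and \<gamma>: "\<gamma> > 0" "\<gamma> \<le> 1" "128 \<le> \<gamma> * n"
  defines "T \<equiv> sqnorm p (\<lambda>k. \<theta> $ k)"
  assumes T: "T > 0"
  defines "B \<equiv> T / \<sigma>\<^sup>2"
  defines "r2 \<equiv> B\<^sup>2 / (B + p / n)"
  shows "1 / n * expect p n \<sigma> \<theta> \<eta> (\<lambda>Y. loss n (iter_est s0 vhat k Y) \<eta>)
    \<le> 22 / \<gamma> * exp (- (r2 / 2) + 2 * r2 / (real n - 1) + \<gamma> * r2)
      + 6 * card (grid n) * exp (- (\<gamma>\<^sup>2 * n * r2 / 10 ^ 7))"
proof -
  have n0: "n > 0" using n by simp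
  interpret gaussian_family "noise p n" "{..<p} \<times> {..<n}" "\<lambda>i \<omega>. \<omega> i"
    by (rule noise_gaussian_family[OF p n0])
  have B: "B > 0" using T \<sigma> unfolding B_def by simp
  define b where "b = (\<lambda>k. \<theta> $ k / \<sigma>)"
  have bB: "sqnorm p b = B" unfolding b_def B_def T_def sqnorm_def by (simp add: power_divide sum_divide_distrib)
  define s where "s = \<gamma> * sqrt n * sqrt B / 1024"
  define t where "t = \<gamma> * n * B / 768"
  have s: "s \<ge> 0" unfolding s_def using \<gamma> B by simp
  have t: "t > 0" unfolding t_def using \<gamma> B n by simp
  define M where "M = (\<lambda>\<omega> i j. hollow_gram (observation p n \<sigma> \<theta> \<eta> \<omega>) $$ (i, j))"
  define G where "G = {\<omega> \<in> space (noise p n). \<not> good_noise p n b t s \<omega>}"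
  define E where "E = (\<lambda>i. {\<omega> \<in> space (noise p n). i \<in> thin_set n (M \<omega>) (\<lambda>i. \<eta> $ i) (\<gamma> * n * T / 2)})"
  have G: "G \<in> events" "prob G \<le> card (grid n) * (2 * exp (- (t\<^sup>2 / (16 * (p + t)))) + exp (- (s\<^sup>2 / 2)))"
    unfolding G_def using good_noise_prob[OF p n0 _ t s, of b] bB B by auto
  have E: "E i \<in> events" "prob (E i) \<le> exp (- (r2 / 2) + 2 * r2 / (real n - 1) + \<gamma> * r2)" if "i < n" for i
    unfolding E_def M_def T_def r2_def B_def
    using thin_prob[OF p n \<sigma> \<eta> that less_imp_le[OF \<gamma>(1)] T[unfolded T_def]] by simp_all
  let ?L = "\<lambda>\<omega>. loss n (iter_est s0 vhat k (observation p n \<sigma> \<theta> \<eta> \<omega>)) \<eta>"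
  let ?U = "\<lambda>\<omega>. 22 / \<gamma> * (\<Sum>i<n. indicator (E i) \<omega> :: real) + 2 * real n * (indicator G \<omega> :: real)"
  have top: "top_eigenvector (hollow_gram (observation p n \<sigma> \<theta> \<eta> \<omega>)) (vhat (observation p n \<sigma> \<theta> \<eta> \<omega>))" for \<omega>
    using sel observation_carrier unfolding spectral_selector_def by blast
  have dimv: "dim_vec (vhat (observation p n \<sigma> \<theta> \<eta> \<omega>)) = n" for \<omega>
    using top_eigenvector_rayleigh(1)[OF hollow_gram_carrier hollow_gram_symm top] carrier_vecD by blast
  have LU: "?L \<omega> \<le> ?U \<omega>" if \<omega>: "\<omega> \<in> space (noise p n)" for \<omega>
  proof (cases "\<omega> \<in> G")
    case True
    have "?L \<omega> \<le> 2 * real n"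
      by (rule loss_le_2n[OF iter_est_label(2)[where vhat = vhat, OF hollow_gram_carrier dimv s0] \<eta>])
    moreover have "0 \<le> 22 / \<gamma> * (\<Sum>i<n. indicator (E i) \<omega>)" using \<gamma> by (intro mult_nonneg_nonneg sum_nonneg) auto
    ultimately show ?thesis using True by simp
  next
    case False
    then have g: "good_noise p n b t s \<omega>" using \<omega> unfolding G_def by simp
    have bound: "\<bar>bilin n (\<lambda>i j. M \<omega> i j - T * \<eta> $ i * \<eta> $ j) x x\<bar> \<le> (\<gamma> * n * T / 32) * sqnorm n x" for x
    proof -
      have "\<bar>bilin n (\<lambda>i j. M \<omega> i j - T * \<eta> $ i * \<eta> $ j) x x\<bar>
        \<le> (\<sigma>\<^sup>2 * (8 * sqrt n * s * sqrt (sqnorm p b) + 6 * t) + T) * sqnorm n x"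
        unfolding M_def T_def b_def
        by (rule good_noise_bounds_form) (use g t s n0 \<sigma> \<eta> in \<open>auto simp: b_def\<close>)
      also have "\<dots> \<le> (\<gamma> * n * T / 32) * sqnorm n x"
      proof (rule mult_right_mono)
        have "8 * sqrt n * s * sqrt B = \<gamma> * (sqrt n * sqrt n) * (sqrt B * sqrt B) / 128"
          unfolding s_def by simp
        then have "8 * sqrt n * s * sqrt B = \<gamma> * n * B / 128" using B by simp
        then have "\<sigma>\<^sup>2 * (8 * sqrt n * s * sqrt (sqnorm p b) + 6 * t) = \<gamma> * n * T / 64"
          unfolding bB t_def B_def using \<sigma> by (simp add: field_simps)
        moreover have "T \<le> \<gamma> * n * T / 128" using mult_right_mono[OF \<gamma>(3), of T] T by simp
        moreover have "0 \<le> \<gamma> * n * T" using \<gamma> T by simp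
        ultimately show "\<sigma>\<^sup>2 * (8 * sqrt n * s * sqrt (sqnorm p b) + 6 * t) + T \<le> \<gamma> * n * T / 32" by linarith
      qed simp
      finally show ?thesis .
    qed
    have "?L \<omega> \<le> 22 / \<gamma> * card (thin_set n (M \<omega>) (\<lambda>i. \<eta> $ i) (\<gamma> * n * T / 2))"
      unfolding M_def
      by (rule loss_iter_est_le[where vhat = vhat and Y = "observation p n \<sigma> \<theta> \<eta> \<omega>", OF hollow_gram_carrier hollow_gram_symm _ \<eta> T n0 \<gamma>(1,2) s0 top k])
        (use bound in \<open>simp add: M_def\<close>)
    also have "real (card (thin_set n (M \<omega>) (\<lambda>i. \<eta> $ i) (\<gamma> * n * T / 2))) = (\<Sum>i<n. indicator (E i) \<omega>)"
    proof -
      have "thin_set n (M \<omega>) (\<lambda>i. \<eta> $ i) (\<gamma> * n * T / 2) = {i \<in> {..<n}. \<omega> \<in> E i}"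
        unfolding E_def using \<omega> by (auto simp: thin_set_def)
      then show ?thesis unfolding indicator_def by (simp add: sum.If_cases Int_def)
    qed
    finally show ?thesis using False by simp
  qed
  have intU: "integrable (noise p n) ?U" using E(1) G(1)
    by (intro Bochner_Integration.integrable_add integrable_mult_right Bochner_Integration.integrable_sum integrable_real_indicator)
      (auto simp: emeasure_eq_measure)
  have U: "(LINT \<omega>|noise p n. ?U \<omega>) = 22 / \<gamma> * (\<Sum>i<n. prob (E i)) + 2 * real n * prob G"
    using E(1) G(1)
    by (subst Bochner_Integration.integral_add) (auto simp: emeasure_eq_measure intro!: integrable_mult_right Bochner_Integration.integrable_sum integrable_real_indicator)
  have U0: "0 \<le> (LINT \<omega>|noise p n. ?U \<omega>)" unfolding U using \<gamma> by (intro add_nonneg_nonneg mult_nonneg_nonneg sum_nonneg) auto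
  have "expect p n \<sigma> \<theta> \<eta> (\<lambda>Y. loss n (iter_est s0 vhat k Y) \<eta>) \<le> (LINT \<omega>|noise p n. ?U \<omega>)"
  proof (cases "integrable (noise p n) ?L")
    case True
    then show ?thesis unfolding expect_def using intU LU by (intro integral_mono) auto
  next
    case False
    \<comment> \<open>The integral of a function that is not integrable is 0.\<close>
    then show ?thesis unfolding expect_def using U0 by (simp add: not_integrable_integral_eq)
  qed
  also have "\<dots> \<le> 22 / \<gamma> * (\<Sum>i<n. exp (- (r2 / 2) + 2 * r2 / (real n - 1) + \<gamma> * r2))
      + 2 * real n * (3 * card (grid n) * exp (- (\<gamma>\<^sup>2 * n * r2 / 10 ^ 7)))"
    unfolding U
  proof (intro add_mono mult_left_mono sum_mono)
    define D where "D = B + p / n"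
    have D: "D > 0" using B unfolding D_def by (auto intro: add_pos_nonneg)
    have r2: "r2 * D = B\<^sup>2" unfolding r2_def D_def[symmetric] using D by simp
    have r2B: "r2 \<le> B" unfolding r2_def D_def[symmetric] using D B
      by (simp add: divide_le_eq power2_eq_square D_def)
    have r20: "r2 \<ge> 0" unfolding r2_def using B by simp
    have "t\<^sup>2 / (16 * (p + t)) \<ge> \<gamma>\<^sup>2 * n * r2 / 10 ^ 7"
    proof -
      have "\<gamma> * (n * B) \<le> 1 * (n * B)" using \<gamma>(2) B by (intro mult_right_mono) auto
      moreover have "t = \<gamma> * (n * B) / 768" "0 \<le> n * B" unfolding t_def using B by auto
      ultimately have "t \<le> 1 * (n * B)" by linarith
      then have pt: "p + t \<le> n * D" unfolding D_def using n0 by (simp add: field_simps)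
      have "\<gamma>\<^sup>2 * n * r2 / 10 ^ 7 * (16 * (p + t)) \<le> \<gamma>\<^sup>2 * n * r2 / 10 ^ 7 * (16 * (n * D))"
        using pt r20 by (intro mult_left_mono) auto
      also have "\<dots> = \<gamma>\<^sup>2 * (real n)\<^sup>2 * (r2 * D) * (16 / 10 ^ 7)" by (simp add: power2_eq_square)
      also have "\<dots> \<le> \<gamma>\<^sup>2 * (real n)\<^sup>2 * (r2 * D) * (1 / 768\<^sup>2)"
        unfolding r2 by (intro mult_left_mono) (auto simp: divide_simps)
      also have "\<dots> = t\<^sup>2" unfolding r2 t_def by (simp add: power_mult_distrib power_divide)
      finally show ?thesis using t by (subst pos_le_divide_eq) (auto intro: add_nonneg_pos)
    qed
    then have 1: "exp (- (t\<^sup>2 / (16 * (p + t)))) \<le> exp (- (\<gamma>\<^sup>2 * n * r2 / 10 ^ 7))" by simp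
    have "s\<^sup>2 / 2 \<ge> \<gamma>\<^sup>2 * n * r2 / 10 ^ 7"
    proof -
      have "\<gamma>\<^sup>2 * n * r2 \<le> \<gamma>\<^sup>2 * n * B" using r2B by (intro mult_left_mono) auto
      moreover have "s\<^sup>2 / 2 = \<gamma>\<^sup>2 * n * B / 2097152" unfolding s_def using B by (simp add: power_mult_distrib power_divide)
      moreover have "0 \<le> \<gamma>\<^sup>2 * n * B" using B by simp
      ultimately have "\<gamma>\<^sup>2 * n * r2 \<le> 5000000 * s\<^sup>2" by linarith
      then show ?thesis by (simp add: field_simps)
    qed
    then have 2: "exp (- (s\<^sup>2 / 2)) \<le> exp (- (\<gamma>\<^sup>2 * n * r2 / 10 ^ 7))" by simp
    have "prob G \<le> card (grid n) * (3 * exp (- (\<gamma>\<^sup>2 * n * r2 / 10 ^ 7)))"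
    proof (rule order_trans[OF G(2)], rule mult_left_mono)
      show "2 * exp (- (t\<^sup>2 / (16 * (p + t)))) + exp (- (s\<^sup>2 / 2)) \<le> 3 * exp (- (\<gamma>\<^sup>2 * n * r2 / 10 ^ 7))"
        using 1 2 by linarith
    qed simp
    then show "prob G \<le> 3 * card (grid n) * exp (- (\<gamma>\<^sup>2 * n * r2 / 10 ^ 7))" by simp
  qed (use E \<gamma> in auto)
  also have "\<dots> = n * (22 / \<gamma> * exp (- (r2 / 2) + 2 * r2 / (real n - 1) + \<gamma> * r2)
      + 6 * card (grid n) * exp (- (\<gamma>\<^sup>2 * n * r2 / 10 ^ 7)))" by (simp add: algebra_simps)
  finally show ?thesis using n0 by (simp add: field_simps)
qed

section \<open>From exponential bounds to the Gaussian tail\<close>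

lemma std_normal_tail_mono: "s \<le> t \<Longrightarrow> std_normal_tail t \<le> std_normal_tail s"
proof -
  interpret prob_space std_normal_distribution by (rule prob_space_normal_density) simp
  assume "s \<le> t"
  then show ?thesis unfolding std_normal_tail_def by (intro finite_measure_mono) auto
qed

text \<open>On the unit interval to the right of \<open>t\<close> the density is at least its value at \<open>t + 1\<close>, and
  \<open>sqrt (2 pi) \<le> 3\<close>.\<close>

lemma std_normal_tail_lower:
  assumes t: "t \<ge> 0"
  shows "exp (- ((t + 1)\<^sup>2 / 2)) / 3 \<le> std_normal_tail t"
proof -
  interpret prob_space std_normal_distribution by (rule prob_space_normal_density) simp
  have "sqrt (2 * pi) \<le> 3" using pi_less_4 by (intro real_le_lsqrt) auto
  then have "exp (- ((t + 1)\<^sup>2 / 2)) / 3 \<le> exp (- ((t + 1)\<^sup>2 / 2)) / sqrt (2 * pi)"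
    by (intro divide_left_mono) auto
  also have "\<dots> = std_normal_density (t + 1)" by (simp add: normal_density_def)
  finally have d: "exp (- ((t + 1)\<^sup>2 / 2)) / 3 \<le> std_normal_density (t + 1)" .
  have "ennreal (std_normal_density (t + 1)) = (\<integral>\<^sup>+x. ennreal (std_normal_density (t + 1)) * indicator {t<..t + 1} x \<partial>lborel)"
    by (simp add: nn_integral_cmult_indicator)
  also have "\<dots> \<le> (\<integral>\<^sup>+x. ennreal (std_normal_density x) * indicator {t<..} x \<partial>lborel)"
  proof (rule nn_integral_mono)
    fix x :: real
    have "std_normal_density (t + 1) \<le> std_normal_density x" if "t < x" "x \<le> t + 1"
      unfolding normal_density_def using that t by (intro mult_left_mono) (auto intro!: power_mono)
    then show "ennreal (std_normal_density (t + 1)) * indicator {t<..t + 1} x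
        \<le> ennreal (std_normal_density x) * indicator {t<..} x"
      by (auto simp: indicator_def ennreal_leI)
  qed
  also have "\<dots> = emeasure std_normal_distribution {t<..}" by (simp add: emeasure_density)
  finally have "std_normal_density (t + 1) \<le> std_normal_tail t"
    unfolding std_normal_tail_def by (simp add: emeasure_eq_measure)
  with d show ?thesis by linarith
qed

lemma std_normal_tail_nonpos:
  assumes "t \<le> 0"
  shows "1 / 6 \<le> std_normal_tail t"
proof -
  have "exp (- (1 / 2)) \<ge> (1 / 2 :: real)" using exp_ge_add_one_self[of "- (1 / 2) :: real"] by simp
  then have "(1 / 6 :: real) \<le> std_normal_tail 0" using std_normal_tail_lower[of 0] by simp
  also have "\<dots> \<le> std_normal_tail t" by (rule std_normal_tail_mono) fact
  finally show ?thesis .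
qed

text \<open>Subtracting \<open>C ln r\<close> from the argument of the tail multiplies it by about \<open>exp (C r ln r)\<close>, more than
  enough to absorb the surplus \<open>exp (2 a r)\<close> and the loss incurred by bounding the tail at \<open>t\<close> through
  the density at \<open>t + 1\<close>. If the argument is not positive, the trivial bound on the risk suffices.\<close>

lemma exponential_le_tail:
  fixes r \<epsilon> a C :: real
  assumes r: "exp 1 \<le> r" and a: "a \<ge> 1" and C: "C \<ge> 4 * a + 10" and \<epsilon>: "0 \<le> \<epsilon>" "\<epsilon> \<le> 1"
    and R: "R \<le> 2" "R \<le> exp (- (r\<^sup>2 / 2 * (1 - \<epsilon>)) + 2 * a * r)"
  shows "R \<le> C * std_normal_tail (r * (1 - \<epsilon>) - C * ln r)"
proof -
  define t where "t = r * (1 - \<epsilon>) - C * ln r"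
  have r0: "r > 0" "r \<ge> 1" using r exp_ge_add_one_self[of "1::real"] by linarith+
  have ln: "ln r \<ge> 1" using r r0 by (simp add: ln_ge_iff)
  have lnC: "C * ln r \<ge> C" using ln C a mult_left_mono[of 1 "ln r" C] by simp
  show ?thesis
  proof (cases "t \<le> 0")
    case True
    have "14 * (1 / 6) \<le> C * std_normal_tail t"
      using std_normal_tail_nonpos[OF True] C a by (intro mult_mono) auto
    then show ?thesis using R(1) unfolding t_def by linarith
  next
    case False
    define u where "u = t + 1"
    have u: "u \<ge> 0" using False unfolding u_def by simp
    have ur: "u \<le> r"
    proof -
      have "r * (1 - \<epsilon>) \<le> r * 1" using \<epsilon> r0 by (intro mult_left_mono) auto
      then show ?thesis unfolding u_def t_def using lnC C a by linarith
    qed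
    have "u\<^sup>2 \<le> r * u" using mult_right_mono[OF ur u] by (simp add: power2_eq_square)
    also have "r * u = r\<^sup>2 * (1 - \<epsilon>) - r * (C * ln r - 1)" unfolding u_def t_def by (simp add: power2_eq_square algebra_simps)
    also have "\<dots> \<le> r\<^sup>2 * (1 - \<epsilon>) - r * (4 * a)"
      using mult_left_mono[of "4 * a" "C * ln r - 1" r] lnC C r0 by simp
    finally have "u\<^sup>2 \<le> r\<^sup>2 * (1 - \<epsilon>) - r * (4 * a)" .
    then have "- (r\<^sup>2 / 2 * (1 - \<epsilon>)) + 2 * a * r \<le> - (u\<^sup>2 / 2)" by (simp add: field_simps)
    then have "R \<le> exp (- (u\<^sup>2 / 2))" using R(2) by (meson exp_le_cancel_iff order_trans)
    also have "\<dots> = 3 * (exp (- (u\<^sup>2 / 2)) / 3)" by simp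
    also have "\<dots> \<le> C * std_normal_tail t"
      using std_normal_tail_lower[of t] False C a unfolding u_def by (intro mult_mono) auto
    finally show ?thesis unfolding t_def .
  qed
qed

lemma snr_mono:
  assumes "0 < d" "d \<le> D" "\<sigma> > 0"
  shows "snr p n \<sigma> d \<le> snr p n \<sigma> D"
proof -
  define x where "x = d\<^sup>2 / \<sigma>\<^sup>2"
  define y where "y = D\<^sup>2 / \<sigma>\<^sup>2"
  define c where "c = real p / real n"
  have x: "0 < x" "x \<le> y" and c: "c \<ge> 0"
    using assms unfolding x_def y_def c_def by (auto intro!: divide_right_mono power_mono)
  have "x * sqrt (y + c) \<le> y * sqrt (x + c)"
  proof (rule power2_le_imp_le)
    have "(x * x) * c \<le> (y * y) * c" using x c by (intro mult_right_mono mult_mono) auto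
    moreover have "(x * y) * x \<le> (x * y) * y" using x by (intro mult_left_mono) auto
    ultimately have "x\<^sup>2 * (y + c) \<le> y\<^sup>2 * (x + c)" by (simp add: power2_eq_square algebra_simps)
    then show "(x * sqrt (y + c))\<^sup>2 \<le> (y * sqrt (x + c))\<^sup>2" using x c by (simp add: power_mult_distrib)
  qed (use x c in auto)
  then have "x / sqrt (x + c) \<le> y / sqrt (y + c)" using x c by (simp add: frac_le_eq divide_simps)
  then show ?thesis unfolding snr_def x_def y_def c_def .
qed

text \<open>The bound at a signal stronger than the minimal one is at least as good as at the minimal one,
  because \<open>C ln\<close> has slope at most 1/2 beyond \<open>2 C\<close>.\<close>

lemma tail_argument_mono:
  fixes r s \<epsilon> C :: real
  assumes r: "r \<ge> 2 * C" and s: "r \<le> s" and C: "C > 0" and \<epsilon>: "\<epsilon> \<le> 1 / 2"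
  shows "r * (1 - \<epsilon>) - C * ln r \<le> s * (1 - \<epsilon>) - C * ln s"
proof -
  have r0: "r > 0" using r C by linarith
  have "ln (s / r) \<le> s / r - 1" using r0 s by (intro ln_le_minus_one) auto
  then have "ln s - ln r \<le> (s - r) / r" using r0 s by (simp add: ln_div diff_divide_distrib)
  then have "C * (ln s - ln r) \<le> C * ((s - r) / r)" using C by (intro mult_left_mono) auto
  also have "\<dots> = (C / r) * (s - r)" by simp
  also have "\<dots> \<le> (1 / 2) * (s - r)" using r r0 s by (intro mult_right_mono) (auto simp: field_simps)
  also have "\<dots> \<le> (1 - \<epsilon>) * (s - r)" using \<epsilon> s by (intro mult_right_mono) auto
  finally show ?thesis by (simp add: algebra_simps)
qed

text \<open>Indeed \<open>4 ^ k\<close> is at least \<open>exp k\<close>, hence at least \<open>n ^ 3 / exp 1\<close>.\<close>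

lemma iteration_count_suffices:
  assumes n: "n \<ge> 1" and k: "k = nat \<lfloor>3 * ln (real n)\<rfloor>"
  shows "real n < 8 * 4 ^ k"
proof -
  have "3 * ln (real n) - 1 \<le> real k" unfolding k using n by (simp add: le_nat_iff)
  then have "exp (3 * ln (real n) - 1) \<le> exp (real k)" by simp
  also have "\<dots> = exp 1 ^ k" by (simp add: exp_of_nat_mult[symmetric])
  also have "\<dots> \<le> 4 ^ k" using exp_le by (intro power_mono) auto
  finally have "exp (3 * ln (real n)) / exp 1 \<le> 4 ^ k" by (simp add: exp_diff)
  moreover have "exp (3 * ln (real n)) = real n ^ 3"
    using n exp_of_nat_mult[of 3 "ln (real n)"] by simp
  ultimately have "real n ^ 3 \<le> 4 ^ k * exp 1" by (simp add: pos_divide_le_eq)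
  also have "\<dots> \<le> 4 ^ k * 3" by (intro mult_left_mono exp_le) simp
  finally have "real n ^ 3 \<le> 4 ^ k * 3" .
  moreover have "real n \<le> real n ^ 3" using n by (intro self_le_power) auto
  ultimately have "real n \<le> 4 ^ k * 3" by linarith
  also have "\<dots> < 8 * 4 ^ k" by simp
  finally show ?thesis .
qed

text \<open>Here the margin is chosen: \<open>\<gamma> = a / r + a / sqrt n\<close>. The first summand makes \<open>\<gamma>\<^sup>2 n r\<^sup>2\<close> a large multiple of
  \<open>n\<close>, which beats the size of the grid, and the second makes it a large multiple of \<open>r\<^sup>2\<close>, so that the
  bad noise event is negligible compared with \<open>exp (- (r\<^sup>2 / 2))\<close> however large \<open>r\<close> is. The price in the
  exponent is \<open>\<gamma> r\<^sup>2 = a r + a r\<^sup>2 / sqrt n\<close>: one term is absorbed by the logarithmic correction, the other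
  by \<open>\<epsilon>\<close>. The value of \<open>a\<close> only has to make \<open>a\<^sup>2 / 10 ^ 7\<close> large compared with the exponent 204 in
  the bound \<open>exp (204 n)\<close> on the size of the grid.\<close>

lemma risk_exponential_bound:
  fixes p n :: nat and \<sigma> a :: real and \<theta> \<eta> :: "real Matrix.vec"
  defines "a \<equiv> 10 ^ 5"
  defines "T \<equiv> sqnorm p (\<lambda>k. \<theta> $ k)"
  defines "r \<equiv> (T / \<sigma>\<^sup>2) / sqrt (T / \<sigma>\<^sup>2 + p / n)"
  assumes p: "p > 0" and \<sigma>: "\<sigma> > 0" and \<eta>: "is_label n (\<lambda>i. \<eta> $ i)"
    and sel: "spectral_selector p n vhat" and s0: "s0 \<in> {-1, 1}" and k: "k = nat \<lfloor>3 * ln (real n)\<rfloor>"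
    and T: "T > 0" and r: "r \<ge> 2 * a" and n: "sqrt (real n) \<ge> 8 * a"
  shows "1 / n * expect p n \<sigma> \<theta> \<eta> (\<lambda>Y. loss n (iter_est s0 vhat k Y) \<eta>)
    \<le> exp (- (r\<^sup>2 / 2 * (1 - 4 * a / sqrt n)) + 2 * a * r)"
proof -
  have a: "a = 100000" unfolding a_def by simp
  define q where "q = sqrt (real n)"
  have q: "q \<ge> 8 * a" "q > 0" "real n = q * q"
    using n a unfolding q_def by (simp, linarith, simp)
  have n_big: "real n \<ge> 8 * a * q" using mult_right_mono[OF q(1), of q] q by simp
  have "real 3 \<le> 8 * a * q" using q(1) a by simp
  then have "real 3 \<le> real n" using n_big by linarith
  then have n3: "n \<ge> 3" by (simp only: of_nat_le_iff)
  have r0: "r > 0" using r a by simp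
  define B where "B = T / \<sigma>\<^sup>2"
  have B: "B > 0" using T \<sigma> unfolding B_def by simp
  have r2: "r\<^sup>2 = B\<^sup>2 / (B + p / n)"
    unfolding r_def B_def[symmetric] using B by (simp add: power_divide add_nonneg_nonneg)
  define \<gamma> where "\<gamma> = a / r + a / q"
  have g0: "\<gamma> > 0" unfolding \<gamma>_def using a r0 q by (simp add: add_pos_pos)
  have g1: "\<gamma> \<le> 1"
  proof -
    have "a / r \<le> 1 / 2" using r r0 by (simp add: divide_le_eq)
    moreover have "a / q \<le> 1 / 2" using q a by (simp add: divide_le_eq)
    ultimately show ?thesis unfolding \<gamma>_def by linarith
  qed
  have gq: "a \<le> \<gamma> * q" unfolding \<gamma>_def using a r0 q by (simp add: field_simps)
  have gr: "a \<le> \<gamma> * r" unfolding \<gamma>_def using a r0 q by (simp add: field_simps)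
  have g128: "128 \<le> \<gamma> * n"
  proof -
    have "a * q \<le> \<gamma> * q * q" using gq q by (intro mult_right_mono) auto
    moreover have "128 \<le> a * q" using q(1) a by simp
    ultimately show ?thesis unfolding q(3) by simp
  qed
  have bound: "1 / n * expect p n \<sigma> \<theta> \<eta> (\<lambda>Y. loss n (iter_est s0 vhat k Y) \<eta>)
    \<le> 22 / \<gamma> * exp (- (r\<^sup>2 / 2) + 2 * r\<^sup>2 / (real n - 1) + \<gamma> * r\<^sup>2)
      + 6 * card (grid n) * exp (- (\<gamma>\<^sup>2 * n * r\<^sup>2 / 10 ^ 7))"
    unfolding r2 B_def T_def
    by (rule expected_loss_le[OF p n3 \<sigma> \<eta> sel s0 iteration_count_suffices[OF _ k] g0 g1 g128 T[unfolded T_def]])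
      (use n3 in simp)
  define X where "X = - (r\<^sup>2 / 2 * (1 - 4 * a / q)) + a * r"
  have t1: "22 / \<gamma> * exp (- (r\<^sup>2 / 2) + 2 * r\<^sup>2 / (real n - 1) + \<gamma> * r\<^sup>2) \<le> r * exp X"
  proof (intro mult_mono)
    have "22 \<le> r * \<gamma>" using gr a by (simp add: mult.commute)
    then show "22 / \<gamma> \<le> r" using g0 by (simp add: divide_le_eq)
    have "2 / (real n - 1) \<le> a / q"
    proof -
      have "2 * q \<le> a * (real n - 1)"
      proof -
        have "a * (real n - 1) \<ge> a * (8 * a * q - 1)" using n_big a by (intro mult_left_mono) auto
        moreover have "a * (8 * a * q - 1) \<ge> 2 * q" using q(1) unfolding a by simp
        ultimately show ?thesis by linarith
      qed
      then show ?thesis using q n3 by (simp add: divide_simps)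
    qed
    then have "2 / (real n - 1) * r\<^sup>2 \<le> a / q * r\<^sup>2" by (intro mult_right_mono) auto
    then have "- (r\<^sup>2 / 2) + 2 * r\<^sup>2 / (real n - 1) + \<gamma> * r\<^sup>2 \<le> - (r\<^sup>2 / 2) + a / q * r\<^sup>2 + \<gamma> * r\<^sup>2"
      by simp
    also have "\<dots> = X"
    proof -
      have "\<gamma> * r\<^sup>2 = a * r + a / q * r\<^sup>2" unfolding \<gamma>_def using r0 by (simp add: power2_eq_square field_simps)
      then show ?thesis unfolding X_def by (simp add: algebra_simps)
    qed
    finally show "exp (- (r\<^sup>2 / 2) + 2 * r\<^sup>2 / (real n - 1) + \<gamma> * r\<^sup>2) \<le> exp X" by simp
  qed (use r0 in auto)
  have t2: "6 * card (grid n) * exp (- (\<gamma>\<^sup>2 * n * r\<^sup>2 / 10 ^ 7)) \<le> 6 * exp X"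
  proof -
    have "real (card (grid n)) \<le> (3 * 2 ^ 202) ^ n" by (rule card_grid)
    also have "\<dots> \<le> exp 204 ^ n"
    proof (intro power_mono)
      have "(2::real) \<le> exp 1" using exp_ge_add_one_self[of "1::real"] by simp
      then have "(2::real) ^ 204 \<le> exp 1 ^ 204" by (intro power_mono) auto
      also have "\<dots> = exp 204" by (simp add: exp_of_nat_mult[symmetric])
      finally show "3 * 2 ^ 202 \<le> (exp 204 :: real)" by simp
    qed simp
    also have "\<dots> = exp (204 * n)" by (simp add: exp_of_nat_mult[symmetric] mult.commute)
    finally have c: "real (card (grid n)) \<le> exp (204 * n)" .
    have "a\<^sup>2 * r\<^sup>2 \<le> \<gamma>\<^sup>2 * n * r\<^sup>2"
    proof -
      have "a\<^sup>2 \<le> (\<gamma> * q)\<^sup>2" using gq a by (intro power_mono) auto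
      then show ?thesis unfolding q(3) by (intro mult_right_mono) (auto simp: power2_eq_square algebra_simps)
    qed
    moreover have "a\<^sup>2 * n \<le> \<gamma>\<^sup>2 * n * r\<^sup>2"
    proof -
      have "a\<^sup>2 \<le> (\<gamma> * r)\<^sup>2" using gr a by (intro power_mono) auto
      then have "a\<^sup>2 * n \<le> (\<gamma> * r)\<^sup>2 * n" by (intro mult_right_mono) auto
      then show ?thesis by (simp add: power_mult_distrib mult_ac)
    qed
    ultimately have "204 * n - \<gamma>\<^sup>2 * n * r\<^sup>2 / 10 ^ 7 \<le> - (r\<^sup>2)" using zero_le_power2[of r] unfolding a by simp
    also have "\<dots> \<le> X"
    proof -
      have "r\<^sup>2 / 2 * (1 - 4 * a / q) \<le> r\<^sup>2 / 2 * 1" using q a by (intro mult_left_mono) auto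
      moreover have "0 \<le> a * r" "0 \<le> r\<^sup>2" using r0 a by auto
      ultimately show ?thesis unfolding X_def by linarith
    qed
    finally have e: "exp (204 * n - \<gamma>\<^sup>2 * n * r\<^sup>2 / 10 ^ 7) \<le> exp X" by simp
    have "card (grid n) * exp (- (\<gamma>\<^sup>2 * n * r\<^sup>2 / 10 ^ 7)) \<le> exp (204 * n) * exp (- (\<gamma>\<^sup>2 * n * r\<^sup>2 / 10 ^ 7))"
      using c by (intro mult_right_mono) auto
    also have "\<dots> = exp (204 * n - \<gamma>\<^sup>2 * n * r\<^sup>2 / 10 ^ 7)" by (simp add: exp_add[symmetric])
    also note e
    finally show ?thesis by simp
  qed
  have "r + 6 \<le> exp (a * r)"
  proof -
    have "r + 6 \<le> a * r + 1" using r r0 unfolding a by simp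
    then show ?thesis using exp_ge_add_one_self[of "a * r"] by linarith
  qed
  then have "(r + 6) * exp X \<le> exp (a * r) * exp X" by (intro mult_right_mono) auto
  also have "\<dots> = exp (- (r\<^sup>2 / 2 * (1 - 4 * a / q)) + 2 * a * r)"
    unfolding exp_add[symmetric] X_def by (rule arg_cong[where f = exp]) (simp add: algebra_simps)
  finally show ?thesis using bound t1 t2 unfolding q_def[symmetric] by (simp add: algebra_simps)
qed

lemma label_vecs_label: "\<eta> \<in> label_vecs n \<Longrightarrow> is_label n (\<lambda>i. \<eta> $ i)"
  unfolding label_vecs_def is_label_def by auto

lemma eucl_norm_sqnorm:
  assumes "\<theta> \<in> carrier_vec p"
  shows "(eucl_norm \<theta>)\<^sup>2 = sqnorm p (\<lambda>k. \<theta> $ k)" "eucl_norm \<theta> \<ge> 0"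
proof -
  have "\<theta> \<bullet> \<theta> = sqnorm p (\<lambda>k. \<theta> $ k)"
    using assms by (simp add: scalar_prod_def sqnorm_def atLeast0LessThan power2_eq_square)
  then show "(eucl_norm \<theta>)\<^sup>2 = sqnorm p (\<lambda>k. \<theta> $ k)" "eucl_norm \<theta> \<ge> 0" unfolding eucl_norm_def by auto
qed

lemma param_space_nonempty:
  assumes "p \<ge> 1" "\<Delta> > 0"
  shows "param_space p n \<Delta> \<noteq> {}"
proof -
  let ?\<theta> = "Matrix.vec p (\<lambda>_. \<Delta>)"
  have "(eucl_norm ?\<theta>)\<^sup>2 = p * \<Delta>\<^sup>2" by (subst eucl_norm_sqnorm(1)[of _ p]) (auto simp: sqnorm_def)
  moreover have "1 * \<Delta>\<^sup>2 \<le> p * \<Delta>\<^sup>2" using assms by (intro mult_right_mono) auto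
  ultimately have "\<Delta>\<^sup>2 \<le> (eucl_norm ?\<theta>)\<^sup>2" by simp
  then have "\<Delta> \<le> eucl_norm ?\<theta>" by (rule power2_le_imp_le) (simp add: eucl_norm_sqnorm(2)[of ?\<theta> p])
  moreover have "Matrix.vec n (\<lambda>_. 1) \<in> label_vecs n" unfolding label_vecs_def by auto
  ultimately have "(?\<theta>, Matrix.vec n (\<lambda>_. 1)) \<in> param_space p n \<Delta>" unfolding param_space_def by auto
  then show ?thesis by blast
qed

text \<open>For small \<open>n\<close> the value \<open>\<epsilon> = 1\<close> makes the argument of the tail negative, and the right-hand side exceeds
  the trivial bound 2.\<close>

lemma risk_tail_bound:
  fixes p n :: nat and \<sigma> \<Delta> \<epsilon> :: real
  defines "a \<equiv> 10 ^ 5 :: real"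
  defines "C \<equiv> 4 * a + 10"
  defines "\<epsilon> \<equiv> (if 4 * a / sqrt (real n) \<le> 1 / 2 then 4 * a / sqrt (real n) else 1)"
  assumes n: "n \<ge> 2" and p: "p \<ge> 1" and \<sigma>: "\<sigma> > 0" and \<Delta>: "\<Delta> > 0" and r: "snr p n \<sigma> \<Delta> > 2 * C"
    and s0: "s0 \<in> {-1, 1}" and sel: "spectral_selector p n vhat" and k: "k = nat \<lfloor>3 * ln (real n)\<rfloor>"
    and par: "(\<theta>, \<eta>) \<in> param_space p n \<Delta>"
  shows "1 / real n * expect p n \<sigma> \<theta> \<eta> (\<lambda>Y. loss n (iter_est s0 vhat k Y) \<eta>)
    \<le> C * std_normal_tail (snr p n \<sigma> \<Delta> * (1 - \<epsilon>) - C * ln (snr p n \<sigma> \<Delta>))"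
proof -
  let ?R = "1 / real n * expect p n \<sigma> \<theta> \<eta> (\<lambda>Y. loss n (iter_est s0 vhat k Y) \<eta>)"
  have a: "a = 100000" unfolding a_def by simp
  have \<theta>: "\<theta> \<in> carrier_vec p" "\<Delta> \<le> eucl_norm \<theta>" and \<eta>: "is_label n (\<lambda>i. \<eta> $ i)"
    using par label_vecs_label unfolding param_space_def by auto
  define r1 where "r1 = snr p n \<sigma> (eucl_norm \<theta>)"
  have rr: "snr p n \<sigma> \<Delta> \<le> r1" unfolding r1_def by (rule snr_mono[OF \<Delta> \<theta>(2) \<sigma>])
  have e: "exp 1 \<le> (3 :: real)" by (rule exp_le)
  have R2: "?R \<le> 2"
  proof -
    have "expect p n \<sigma> \<theta> \<eta> (\<lambda>Y. loss n (iter_est s0 vhat k Y) \<eta>) \<le> 2 * n"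
      by (rule expected_loss_le_2n[OF _ _ \<eta> sel s0]) (use p n in auto)
    then show ?thesis using n by (simp add: field_simps)
  qed
  show ?thesis
  proof (cases "4 * a / sqrt (real n) \<le> 1 / 2")
    case False
    then have \<epsilon>: "\<epsilon> = 1" unfolding \<epsilon>_def by simp
    have ln: "ln (snr p n \<sigma> \<Delta>) \<ge> 0" using r unfolding C_def a by simp
    have "C * (1 / 6) \<le> C * std_normal_tail (snr p n \<sigma> \<Delta> * (1 - \<epsilon>) - C * ln (snr p n \<sigma> \<Delta>))"
      using ln unfolding \<epsilon> C_def a by (intro mult_left_mono std_normal_tail_nonpos) auto
    then show ?thesis using R2 unfolding C_def a by simp
  next
    case True
    then have \<epsilon>: "\<epsilon> = 4 * a / sqrt (real n)" unfolding \<epsilon>_def by simp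
    have \<epsilon>1: "0 \<le> \<epsilon>" "\<epsilon> \<le> 1 / 2" using True unfolding \<epsilon> a by auto
    have sq: "sqrt (real n) \<ge> 8 * a" using True n by (simp add: divide_le_eq)
    have r1: "r1 = (sqnorm p (\<lambda>k. \<theta> $ k) / \<sigma>\<^sup>2) / sqrt (sqnorm p (\<lambda>k. \<theta> $ k) / \<sigma>\<^sup>2 + p / n)"
      unfolding r1_def snr_def eucl_norm_sqnorm(1)[OF \<theta>(1)] ..
    have T: "sqnorm p (\<lambda>k. \<theta> $ k) > 0" unfolding eucl_norm_sqnorm(1)[OF \<theta>(1), symmetric] using \<theta>(2) \<Delta> by simp
    have "?R \<le> exp (- (r1\<^sup>2 / 2 * (1 - \<epsilon>)) + 2 * a * r1)"
      unfolding r1 \<epsilon> a_def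
    proof (rule risk_exponential_bound[OF _ \<sigma> \<eta> sel s0 k T])
      show "2 * 10 ^ 5 \<le> sqnorm p (\<lambda>k. \<theta> $ k) / \<sigma>\<^sup>2 / sqrt (sqnorm p (\<lambda>k. \<theta> $ k) / \<sigma>\<^sup>2 + p / n)"
        unfolding r1[symmetric] using r rr unfolding C_def a by simp
      show "8 * 10 ^ 5 \<le> sqrt (real n)" using sq unfolding a by simp
    qed (use p in simp)
    then have "?R \<le> C * std_normal_tail (r1 * (1 - \<epsilon>) - C * ln r1)"
      by (intro exponential_le_tail[where a = a]) (use R2 r rr e \<epsilon>1 in \<open>auto simp: C_def a\<close>)
    also have "\<dots> \<le> C * std_normal_tail (snr p n \<sigma> \<Delta> * (1 - \<epsilon>) - C * ln (snr p n \<sigma> \<Delta>))"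
      using tail_argument_mono[OF _ rr, of C \<epsilon>] r \<epsilon>1 unfolding C_def a
      by (intro mult_left_mono std_normal_tail_mono) auto
    finally show ?thesis .
  qed
qed

theorem theorem5:
  shows "\<exists>C C' :: real. C > 0 \<and> C' > 0 \<and>
    (\<forall>(p :: nat \<Rightarrow> nat) (\<sigma> :: nat \<Rightarrow> real) (\<Delta> :: nat \<Rightarrow> real)
      (s0 :: real) (vhat :: nat \<Rightarrow> real Matrix.mat \<Rightarrow> real Matrix.vec).
      (\<forall>n\<ge>2. p n \<ge> 1 \<and> \<sigma> n > 0 \<and> \<Delta> n > 0 \<and> snr (p n) n (\<sigma> n) (\<Delta> n) > C) \<longrightarrow>
      s0 \<in> {-1, 1} \<longrightarrow>
      (\<forall>n\<ge>2. spectral_selector (p n) n (vhat n)) \<longrightarrow>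
      (\<exists>\<epsilon> :: nat \<Rightarrow> real. \<epsilon> \<longlonglongrightarrow> 0 \<and>
        (\<forall>n\<ge>2.
          (let r = snr (p n) n (\<sigma> n) (\<Delta> n); k = nat \<lfloor>3 * ln (real n)\<rfloor> in
           (SUP (\<theta>, \<eta>) \<in> param_space (p n) n (\<Delta> n).
              1 / real n * expect (p n) n (\<sigma> n) \<theta> \<eta>
                (\<lambda>Y. loss n (iter_est s0 (vhat n) k Y) \<eta>))
           \<le> C' * std_normal_tail (r * (1 - \<epsilon> n - C' * ln r / r))))))"
proof -
  define a :: real where "a = 10 ^ 5"
  define C' where "C' = 4 * a + 10"
  define \<epsilon> where "\<epsilon> = (\<lambda>n :: nat. if 4 * a / sqrt (real n) \<le> 1 / 2 then 4 * a / sqrt (real n) else 1)"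
  have C': "C' > 0" unfolding C'_def a_def by simp
  have lim: "(\<lambda>n. 4 * a / sqrt (real n)) \<longlonglongrightarrow> 0" by real_asymp
  then have "\<forall>\<^sub>F n in sequentially. 4 * a / sqrt (real n) < 1 / 2"
    by (rule order_tendstoD) simp
  then have "\<forall>\<^sub>F n in sequentially. 4 * a / sqrt (real n) = \<epsilon> n"
    by eventually_elim (simp add: \<epsilon>_def)
  then have \<epsilon>: "\<epsilon> \<longlonglongrightarrow> 0" by (rule Lim_transform_eventually[OF lim])
  show ?thesis
  proof (rule exI[of _ "2 * C'"], rule exI[of _ C'], intro conjI allI impI)
    show "\<exists>\<epsilon> :: nat \<Rightarrow> real. \<epsilon> \<longlonglongrightarrow> 0 \<and>
        (\<forall>n\<ge>2.
          (let r = snr (p n) n (\<sigma> n) (\<Delta> n); k = nat \<lfloor>3 * ln (real n)\<rfloor> in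
           (SUP (\<theta>, \<eta>) \<in> param_space (p n) n (\<Delta> n).
              1 / real n * expect (p n) n (\<sigma> n) \<theta> \<eta>
                (\<lambda>Y. loss n (iter_est s0 (vhat n) k Y) \<eta>))
           \<le> C' * std_normal_tail (r * (1 - \<epsilon> n - C' * ln r / r))))"
      if h: "\<forall>n\<ge>2. p n \<ge> 1 \<and> \<sigma> n > 0 \<and> \<Delta> n > 0 \<and> snr (p n) n (\<sigma> n) (\<Delta> n) > 2 * C'"
        and s0: "s0 \<in> {-1, 1}" and sel: "\<forall>n\<ge>2. spectral_selector (p n) n (vhat n)"
      for p :: "nat \<Rightarrow> nat" and \<sigma> \<Delta> :: "nat \<Rightarrow> real" and s0 :: real
        and vhat :: "nat \<Rightarrow> real Matrix.mat \<Rightarrow> real Matrix.vec"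
    proof (intro exI[of _ \<epsilon>] conjI allI impI \<epsilon>)
      fix n :: nat assume n: "n \<ge> 2"
      define r where "r = snr (p n) n (\<sigma> n) (\<Delta> n)"
      have hn: "p n \<ge> 1" "\<sigma> n > 0" "\<Delta> n > 0" "r > 2 * C'" using h n unfolding r_def by auto
      have arg: "r * (1 - \<epsilon> n - C' * ln r / r) = r * (1 - \<epsilon> n) - C' * ln r"
        using hn(4) C' by (simp add: field_simps)
      have "(SUP (\<theta>, \<eta>) \<in> param_space (p n) n (\<Delta> n). 1 / real n * expect (p n) n (\<sigma> n) \<theta> \<eta>
          (\<lambda>Y. loss n (iter_est s0 (vhat n) (nat \<lfloor>3 * ln (real n)\<rfloor>) Y) \<eta>))
        \<le> C' * std_normal_tail (r * (1 - \<epsilon> n) - C' * ln r)"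
      proof (rule cSUP_least[OF param_space_nonempty[OF hn(1,3)]], clarify)
        fix \<theta> \<eta> assume "(\<theta>, \<eta>) \<in> param_space (p n) n (\<Delta> n)"
        then show "1 / real n * expect (p n) n (\<sigma> n) \<theta> \<eta>
            (\<lambda>Y. loss n (iter_est s0 (vhat n) (nat \<lfloor>3 * ln (real n)\<rfloor>) Y) \<eta>)
          \<le> C' * std_normal_tail (r * (1 - \<epsilon> n) - C' * ln r)"
          unfolding C'_def a_def \<epsilon>_def r_def
          by (intro risk_tail_bound[OF n _ _ _ _ s0 _ refl])
            (use hn sel n in \<open>auto simp: r_def C'_def a_def\<close>)
      qed
      then show "let r = snr (p n) n (\<sigma> n) (\<Delta> n); k = nat \<lfloor>3 * ln (real n)\<rfloor> in
           (SUP (\<theta>, \<eta>) \<in> param_space (p n) n (\<Delta> n).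
              1 / real n * expect (p n) n (\<sigma> n) \<theta> \<eta>
                (\<lambda>Y. loss n (iter_est s0 (vhat n) k Y) \<eta>))
           \<le> C' * std_normal_tail (r * (1 - \<epsilon> n - C' * ln r / r))"
        unfolding Let_def r_def[symmetric] arg .
    qed
  qed (use C' in auto)
qed

end
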